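(* Let $X$ be a finite connected CW complex, let $1\le d\le\dim X$, let $E\colon X_{d-1}\to\mathbb{R}$ and $W\colon X_d\to\mathbb{R}$ be functions, and let $\beta>0$. The pseudo-inverse $\partial^+_{E,W}\colon C_{d-1}(X;\mathbb{R})\to C_d(X;\mathbb{R})$ of the boundary operator $\partial\colon C_d(X;\mathbb{R})\to C_{d-1}(X;\mathbb{R})$ with respect to the modified inner products defined by $E$ and $W$ is given by $$\partial^+_{E,W}=\frac{1}{\Delta_W\nabla_E}\sum_{L,T}\tau_L\,w_T\,\sigma_{L,T},\qquad \sigma_{L,T}=\varphi_T\circ\zeta_L\colon C_{d-1}(X;\mathbb{R})\to C_d(X;\mathbb{R}),$$ where the sum is over all $(d-1)$-dimensional spanning co-trees $L$ and all $d$-dimensional spanning trees $T$ of $X$, $\Delta_W=\sum_T w_T$ and $\nabla_E=\sum_L\tau_L$.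
   Context: $X_k$ is the set of $k$-cells of $X$, $X^{(k)}$ the $k$-skeleton, $C_*(X;\mathbb{R})$ the real cellular chain complex, $B_{d-1}(X;\mathbb{R})$ the image of $\partial\colon C_d(X;\mathbb{R})\to C_{d-1}(X;\mathbb{R})$, and $\beta_k(X)=\dim H_k(X;\mathbb{Q})$. Modified inner products: on $C_{d-1}(X;\mathbb{R})$ the cells are orthogonal with $\langle f,f\rangle_E=e^{\beta E_f}$ for $f\in X_{d-1}$; on $C_d(X;\mathbb{R})$ the cells are orthogonal with $\langle b,b\rangle_W=e^{\beta W_b}$ for $b\in X_d$. The pseudo-inverse of a linear map $A\colon U\to V$ of finite-dimensional real inner product spaces is the (Moore–Penrose) linear map $A^+\colon V\to U$ such that, for each $v\in V$, $A^+v$ is the element of smallest norm among all $u\in U$ minimizing the norm of $Au-v$. A $d$-dimensional spanning tree of $X$ is a subcomplex $T\subset X$ with $H_d(T)=0$, $\beta_{d-1}(T)=\beta_{d-1}(X)$, and $X^{(d-1)}\subset T\subset X^{(d)}$. Its weight is $w_T=\theta_T^2\prod_{b\in T_d}e^{-\beta W_b}$, where $\theta_T$ is the order of the torsion subgroup of $H_{d-1}(T;\mathbb{Z})$ and $T_d$ is the set of $d$-cells of $T$. For such $T$ the composition $C_d(T;\mathbb{R})\subset C_d(X;\mathbb{R})\xrightarrow{\partial}B_{d-1}(X;\mathbb{R})$ is an isomorphism, and $\varphi_T\colon B_{d-1}(X;\mathbb{R})\to C_d(X;\mathbb{R})$ is its inverse followed by the inclusion $C_d(T;\mathbb{R})\subset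 C_d(X;\mathbb{R})$. A $(d-1)$-dimensional spanning co-tree of $X$ is a subcomplex $L\subset X$ such that the inclusion induces an isomorphism $H_{d-1}(L;\mathbb{Q})\to H_{d-1}(X;\mathbb{Q})$, $\beta_{d-2}(L)=\beta_{d-2}(X)$, and $X^{(d-2)}\subset L\subset X^{(d-1)}$. Its weight is $\tau_L=a_L^2\prod_{b\in L_{d-1}}e^{-\beta E_b}$, where $a_L$ is the order of the finite group $H_{d-1}(X,L;\mathbb{Z})$ and $L_{d-1}$ is the set of $(d-1)$-cells of $L$. For such $L$ the composition $B_{d-1}(X;\mathbb{R})\to C_{d-1}(X;\mathbb{R})\to C_{d-1}(X;\mathbb{R})/C_{d-1}(L;\mathbb{R})$ is an isomorphism, and $\zeta_L\colon C_{d-1}(X;\mathbb{R})\to B_{d-1}(X;\mathbb{R})$ is the quotient map $C_{d-1}(X;\mathbb{R})\to C_{d-1}(X;\mathbb{R})/C_{d-1}(L;\mathbb{R})$ followed by the inverse of that isomorphism. *)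

theory Defs
  imports "HOL-Homology.Homology" "Jordan_Normal_Form.Missing_VectorSpace"
begin

section \<open>Finite CW complexes\<close>

text \<open>The closed disk \<open>D\<^sup>n\<close>, and its bounding sphere \<open>S\<close> of dimension \<open>n - 1\<close> as a set of points;
  the latter is empty for \<open>n = 0\<close>.\<close>

definition disk :: "nat \<Rightarrow> (nat \<Rightarrow> real) topology" where
  "disk n = subtopology (Euclidean_space n) {x. (\<Sum>i<n. (x i)\<^sup>2) \<le> 1}"

definition disk_sphere :: "nat \<Rightarrow> (nat \<Rightarrow> real) set" where
  "disk_sphere n = {x \<in> topspace (Euclidean_space n). (\<Sum>i<n. (x i)\<^sup>2) = 1}"

definition disk_interior :: "nat \<Rightarrow> (nat \<Rightarrow> real) set" where
  "disk_interior n = topspace (disk n) - disk_sphere n"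

text \<open>A space together with index sets for the cells of each dimension and a characteristic map for
  each cell. Dimensions are integers, as in the library's homology groups, so that skeleta and
  homology groups in degree \<open>-1\<close> are available. A cell is the pair of a dimension and an index.\<close>

record ('a, 'c) cw =
  cw_top :: "'a topology"
  cw_cells :: "int \<Rightarrow> 'c set"
  cw_char :: "int \<Rightarrow> 'c \<Rightarrow> (nat \<Rightarrow> real) \<Rightarrow> 'a"

definition open_cell :: "('a, 'c) cw \<Rightarrow> int \<Rightarrow> 'c \<Rightarrow> 'a set" where
  "open_cell X n s = cw_char X n s ` disk_interior (nat n)"

definition skeleton :: "('a, 'c) cw \<Rightarrow> int \<Rightarrow> 'a set" where
  "skeleton X n = (\<Union>k\<in>{..n}. \<Union>s\<in>cw_cells X k. open_cell X k s)"

text \<open>Closure-finiteness and the weak topology need not be required separately, because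
  there are only finitely many cells.\<close>

definition finite_cw_complex :: "('a, 'c) cw \<Rightarrow> bool" where
  "finite_cw_complex X \<longleftrightarrow>
     Hausdorff_space (cw_top X) \<and>
     finite (SIGMA n:UNIV. cw_cells X n) \<and>
     (\<forall>n<0. cw_cells X n = {}) \<and>
     topspace (cw_top X) = (\<Union>n. \<Union>s\<in>cw_cells X n. open_cell X n s) \<and>
     (\<forall>m n. \<forall>s\<in>cw_cells X m. \<forall>t\<in>cw_cells X n.
        (m, s) \<noteq> (n, t) \<longrightarrow> disjnt (open_cell X m s) (open_cell X n t)) \<and>
     (\<forall>n. \<forall>s\<in>cw_cells X n.
        continuous_map (disk (nat n)) (cw_top X) (cw_char X n s) \<and>
        homeomorphic_map (subtopology (disk (nat n)) (disk_interior (nat n)))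
          (subtopology (cw_top X) (open_cell X n s)) (cw_char X n s) \<and>
        cw_char X n s ` disk_sphere (nat n) \<subseteq> skeleton X (n - 1))"

definition cw_dim :: "('a, 'c) cw \<Rightarrow> int" where
  "cw_dim X = Max (insert (-1) {n. cw_cells X n \<noteq> {}})"

definition cells_of :: "('a, 'c) cw \<Rightarrow> 'a set \<Rightarrow> int \<Rightarrow> 'c set" where
  "cells_of X K n = {s \<in> cw_cells X n. open_cell X n s \<subseteq> K}"

definition subcomplex :: "('a, 'c) cw \<Rightarrow> 'a set \<Rightarrow> bool" where
  "subcomplex X K \<longleftrightarrow>
     closedin (cw_top X) K \<and> K = (\<Union>n. \<Union>s\<in>cells_of X K n. open_cell X n s)"

section \<open>The cellular chain complex\<close>

text \<open>\<open>cellular_group X n\<close> is the cellular chain group \<open>H\<^sub>n(X\<^sup>n, X\<^sup>n\<^sup>-\<^sup>1)\<close>. It is free abelian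
  on the classes \<open>cell_class X n s\<close>, the images under the characteristic maps of one generator
  of \<open>H\<^sub>n(D\<^sup>n, S\<^sup>n\<^sup>-\<^sup>1)\<close> that is chosen once and for all for each \<open>n\<close>. (The library's homology groups
  are written multiplicatively.)\<close>

definition cellular_group :: "('a, 'c) cw \<Rightarrow> int \<Rightarrow> 'a chain set monoid" where
  "cellular_group X n =
     relative_homology_group n (subtopology (cw_top X) (skeleton X n)) (skeleton X (n - 1))"

definition disk_class :: "nat \<Rightarrow> (nat \<Rightarrow> real) chain set" where
  "disk_class n = (let G = relative_homology_group (int n) (disk n) (disk_sphere n) in
     SOME g. g \<in> carrier G \<and> subgroup_generated G {g} = G)"

definition cell_class :: "('a, 'c) cw \<Rightarrow> int \<Rightarrow> 'c \<Rightarrow> 'a chain set" where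
  "cell_class X n s =
     hom_induced n (disk (nat n)) (disk_sphere (nat n))
       (subtopology (cw_top X) (skeleton X n)) (skeleton X (n - 1))
       (cw_char X n s) (disk_class (nat n))"

text \<open>The incidence numbers \<open>[b : f]\<close> are the coordinates, in the basis of \<open>(n-1)\<close>-cells, of the
  image of the \<open>n\<close>-cell \<open>b\<close> under the boundary map
  \<open>H\<^sub>n(X\<^sup>n, X\<^sup>n\<^sup>-\<^sup>1) \<rightarrow> H\<^sub>n\<^sub>-\<^sub>1(X\<^sup>n\<^sup>-\<^sup>1, X\<^sup>n\<^sup>-\<^sup>2)\<close> of the triple.\<close>

definition incidence :: "('a, 'c) cw \<Rightarrow> int \<Rightarrow> 'c \<Rightarrow> 'c \<Rightarrow> int" where
  "incidence X n b = (let G = cellular_group X (n - 1) in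
     THE m. (\<forall>f. f \<notin> cw_cells X (n - 1) \<longrightarrow> m f = 0) \<and>
       hom_relboundary n (subtopology (cw_top X) (skeleton X n))
         (skeleton X (n - 1)) (skeleton X (n - 2)) (cell_class X n b)
       = finprod G (\<lambda>f. cell_class X (n - 1) f [^]\<^bsub>G\<^esub> m f) (cw_cells X (n - 1)))"

text \<open>\<open>C\<^sub>n(K; R)\<close> for a subcomplex \<open>K\<close> of \<open>X\<close>, as the coefficient functions on the \<open>n\<close>-cells of \<open>X\<close>
  that vanish off \<open>K\<close>; the coefficient ring is given by the type \<open>'r\<close>.\<close>

definition chains :: "('a, 'c) cw \<Rightarrow> 'a set \<Rightarrow> int \<Rightarrow> ('c \<Rightarrow> 'r::comm_ring_1) set" where
  "chains X K n = {c. \<forall>s. s \<notin> cells_of X K n \<longrightarrow> c s = 0}"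

definition boundary :: "('a, 'c) cw \<Rightarrow> int \<Rightarrow> ('c \<Rightarrow> 'r::comm_ring_1) \<Rightarrow> 'c \<Rightarrow> 'r" where
  "boundary X n c = (\<lambda>f. if f \<in> cw_cells X (n - 1)
     then \<Sum>b\<in>cw_cells X n. of_int (incidence X n b f) * c b else 0)"

section \<open>Cellular homology\<close>

definition coset :: "('c \<Rightarrow> 'r::comm_ring_1) set \<Rightarrow> ('c \<Rightarrow> 'r) \<Rightarrow> ('c \<Rightarrow> 'r) set" where
  "coset B z = {\<lambda>s. b s + z s | b. b \<in> B}"

definition coeff_ring :: "'r::comm_ring_1 ring" where
  "coeff_ring = \<lparr>carrier = UNIV, mult = (*), one = 1, zero = 0, add = (+)\<rparr>"

text \<open>The ring operations of a library module are not used.\<close>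

definition quotient_module ::
  "('c \<Rightarrow> 'r::comm_ring_1) set \<Rightarrow> ('c \<Rightarrow> 'r) set \<Rightarrow> ('r, ('c \<Rightarrow> 'r) set) module" where
  "quotient_module Z B =
     \<lparr>carrier = coset B ` Z, mult = undefined, one = undefined, zero = B,
      add = (\<lambda>P Q. {\<lambda>s. p s + q s | p q. p \<in> P \<and> q \<in> Q}),
      smult = (\<lambda>a P. \<Union>p\<in>P. coset B (\<lambda>s. a * p s))\<rparr>"

text \<open>Relative cycles and boundaries of \<open>(K, L)\<close> are taken in \<open>C(K)\<close>, as in the library's singular
  theory: cycles are the chains with boundary in \<open>C(L)\<close>, boundaries are taken modulo \<open>C(L)\<close>.\<close>

definition rel_cycles ::
  "('a, 'c) cw \<Rightarrow> 'a set \<Rightarrow> 'a set \<Rightarrow> int \<Rightarrow> ('c \<Rightarrow> 'r::comm_ring_1) set" where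
  "rel_cycles X K L n = {c \<in> chains X K n. boundary X n c \<in> chains X L (n - 1)}"

definition rel_boundaries ::
  "('a, 'c) cw \<Rightarrow> 'a set \<Rightarrow> 'a set \<Rightarrow> int \<Rightarrow> ('c \<Rightarrow> 'r::comm_ring_1) set" where
  "rel_boundaries X K L n =
     {\<lambda>s. boundary X (n + 1) e s + l s | e l. e \<in> chains X K (n + 1) \<and> l \<in> chains X L n}"

definition rel_homology ::
  "('a, 'c) cw \<Rightarrow> 'a set \<Rightarrow> 'a set \<Rightarrow> int \<Rightarrow> ('r::comm_ring_1, ('c \<Rightarrow> 'r) set) module" where
  "rel_homology X K L n = quotient_module (rel_cycles X K L n) (rel_boundaries X K L n)"

abbreviation homology ::
  "('a, 'c) cw \<Rightarrow> 'a set \<Rightarrow> int \<Rightarrow> ('r::comm_ring_1, ('c \<Rightarrow> 'r) set) module" where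
  "homology X K n \<equiv> rel_homology X K {} n"

text \<open>The map \<open>H\<^sub>n(K) \<rightarrow> H\<^sub>n(X)\<close> induced by inclusion, sending the class of a cycle \<open>z\<close> in \<open>K\<close> to its
  class in \<open>X\<close>.\<close>

definition inclusion_map ::
  "('a, 'c) cw \<Rightarrow> int \<Rightarrow> ('c \<Rightarrow> 'r::comm_ring_1) set \<Rightarrow> ('c \<Rightarrow> 'r) set" where
  "inclusion_map X n h = (\<Union>z\<in>h. coset (rel_boundaries X (topspace (cw_top X)) {} n) z)"

definition betti :: "('a, 'c) cw \<Rightarrow> 'a set \<Rightarrow> int \<Rightarrow> nat" where
  "betti X K n =
     vectorspace.dim (coeff_ring :: rat ring) (homology X K n :: (rat, ('c \<Rightarrow> rat) set) module)"

definition torsion :: "(int, 'm) module \<Rightarrow> 'm set" where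
  "torsion M = {h \<in> carrier M. \<exists>k. k \<noteq> 0 \<and> k \<odot>\<^bsub>M\<^esub> h = \<zero>\<^bsub>M\<^esub>}"

section \<open>Spanning trees and co-trees\<close>

definition spanning_tree :: "('a, 'c) cw \<Rightarrow> int \<Rightarrow> 'a set \<Rightarrow> bool" where
  "spanning_tree X d T \<longleftrightarrow>
     subcomplex X T \<and>
     carrier (homology X T d :: (int, ('c \<Rightarrow> int) set) module)
       = {\<zero>\<^bsub>(homology X T d :: (int, ('c \<Rightarrow> int) set) module)\<^esub>} \<and>
     betti X T (d - 1) = betti X (topspace (cw_top X)) (d - 1) \<and>
     skeleton X (d - 1) \<subseteq> T \<and> T \<subseteq> skeleton X d"

definition tree_torsion :: "('a, 'c) cw \<Rightarrow> int \<Rightarrow> 'a set \<Rightarrow> nat" where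
  "tree_torsion X d T = card (torsion (homology X T (d - 1) :: (int, ('c \<Rightarrow> int) set) module))"

definition tree_weight ::
  "('a, 'c) cw \<Rightarrow> int \<Rightarrow> real \<Rightarrow> ('c \<Rightarrow> real) \<Rightarrow> 'a set \<Rightarrow> real" where
  "tree_weight X d \<beta> W T =
     (real (tree_torsion X d T))\<^sup>2 * (\<Prod>b\<in>cells_of X T d. exp (- \<beta> * W b))"

text \<open>\<open>spanning_cotree X d L\<close> says that \<open>L\<close> is a spanning co-tree of dimension \<open>d - 1\<close> (not \<open>d\<close>).\<close>

definition spanning_cotree :: "('a, 'c) cw \<Rightarrow> int \<Rightarrow> 'a set \<Rightarrow> bool" where
  "spanning_cotree X d L \<longleftrightarrow>
     subcomplex X L \<and>
     inclusion_map X (d - 1) \<in>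
       module_hom (coeff_ring :: rat ring) (homology X L (d - 1) :: (rat, ('c \<Rightarrow> rat) set) module)
         (homology X (topspace (cw_top X)) (d - 1)) \<and>
     bij_betw (inclusion_map X (d - 1))
       (carrier (homology X L (d - 1) :: (rat, ('c \<Rightarrow> rat) set) module))
       (carrier (homology X (topspace (cw_top X)) (d - 1))) \<and>
     betti X L (d - 2) = betti X (topspace (cw_top X)) (d - 2) \<and>
     skeleton X (d - 2) \<subseteq> L \<and> L \<subseteq> skeleton X (d - 1)"

definition cotree_index :: "('a, 'c) cw \<Rightarrow> int \<Rightarrow> 'a set \<Rightarrow> nat" where
  "cotree_index X d L =
     card (carrier (rel_homology X (topspace (cw_top X)) L (d - 1)
       :: (int, ('c \<Rightarrow> int) set) module))"

definition cotree_weight ::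
  "('a, 'c) cw \<Rightarrow> int \<Rightarrow> real \<Rightarrow> ('c \<Rightarrow> real) \<Rightarrow> 'a set \<Rightarrow> real" where
  "cotree_weight X d \<beta> E L =
     (real (cotree_index X d L))\<^sup>2 * (\<Prod>f\<in>cells_of X L (d - 1). exp (- \<beta> * E f))"

definition real_chains :: "('a, 'c) cw \<Rightarrow> int \<Rightarrow> ('c \<Rightarrow> real) set" where
  "real_chains X n = chains X (topspace (cw_top X)) n"

definition real_boundaries :: "('a, 'c) cw \<Rightarrow> int \<Rightarrow> ('c \<Rightarrow> real) set" where
  "real_boundaries X n = boundary X (n + 1) ` real_chains X (n + 1)"

definition phi :: "('a, 'c) cw \<Rightarrow> int \<Rightarrow> 'a set \<Rightarrow> ('c \<Rightarrow> real) \<Rightarrow> 'c \<Rightarrow> real" where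
  "phi X d T = inv_into (chains X T d) (boundary X d)"

text \<open>\<open>coset (chains X L (d - 1))\<close> is the quotient map to \<open>C\<^sub>d\<^sub>-\<^sub>1(X) / C\<^sub>d\<^sub>-\<^sub>1(L)\<close>.\<close>

definition zeta :: "('a, 'c) cw \<Rightarrow> int \<Rightarrow> 'a set \<Rightarrow> ('c \<Rightarrow> real) \<Rightarrow> 'c \<Rightarrow> real" where
  "zeta X d L = inv_into (real_boundaries X (d - 1)) (coset (chains X L (d - 1)))
                  \<circ> coset (chains X L (d - 1))"

definition sigma :: "('a, 'c) cw \<Rightarrow> int \<Rightarrow> 'a set \<Rightarrow> 'a set \<Rightarrow> ('c \<Rightarrow> real) \<Rightarrow> 'c \<Rightarrow> real" where
  "sigma X d L T = phi X d T \<circ> zeta X d L"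

definition total_tree_weight :: "('a, 'c) cw \<Rightarrow> int \<Rightarrow> real \<Rightarrow> ('c \<Rightarrow> real) \<Rightarrow> real" where
  "total_tree_weight X d \<beta> W = (\<Sum>T | spanning_tree X d T. tree_weight X d \<beta> W T)"

definition total_cotree_weight :: "('a, 'c) cw \<Rightarrow> int \<Rightarrow> real \<Rightarrow> ('c \<Rightarrow> real) \<Rightarrow> real" where
  "total_cotree_weight X d \<beta> E = (\<Sum>L | spanning_cotree X d L. cotree_weight X d \<beta> E L)"

section \<open>Pseudo-inverses with respect to the modified inner products\<close>

definition cell_inner ::
  "('a, 'c) cw \<Rightarrow> int \<Rightarrow> real \<Rightarrow> ('c \<Rightarrow> real) \<Rightarrow> ('c \<Rightarrow> real) \<Rightarrow> ('c \<Rightarrow> real) \<Rightarrow> real" where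
  "cell_inner X n \<beta> F x y = (\<Sum>s\<in>cw_cells X n. exp (\<beta> * F s) * x s * y s)"

definition cell_norm ::
  "('a, 'c) cw \<Rightarrow> int \<Rightarrow> real \<Rightarrow> ('c \<Rightarrow> real) \<Rightarrow> ('c \<Rightarrow> real) \<Rightarrow> real" where
  "cell_norm X n \<beta> F x = sqrt (cell_inner X n \<beta> F x x)"

definition least_squares ::
  "('b \<Rightarrow> real) set \<Rightarrow> (('c \<Rightarrow> real) \<Rightarrow> real) \<Rightarrow> (('b \<Rightarrow> real) \<Rightarrow> 'c \<Rightarrow> real) \<Rightarrow>
     ('c \<Rightarrow> real) \<Rightarrow> ('b \<Rightarrow> real) set" where
  "least_squares U normV A v =
     {u \<in> U. \<forall>u'\<in>U. normV (\<lambda>s. A u s - v s) \<le> normV (\<lambda>s. A u' s - v s)}"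

definition pseudo_inverse ::
  "('b \<Rightarrow> real) set \<Rightarrow> (('b \<Rightarrow> real) \<Rightarrow> real) \<Rightarrow> (('c \<Rightarrow> real) \<Rightarrow> real) \<Rightarrow>
     (('b \<Rightarrow> real) \<Rightarrow> 'c \<Rightarrow> real) \<Rightarrow> ('c \<Rightarrow> real) \<Rightarrow> 'b \<Rightarrow> real" where
  "pseudo_inverse U normU normV A v =
     (THE u. u \<in> least_squares U normV A v \<and>
             (\<forall>u'\<in>least_squares U normV A v. normU u \<le> normU u'))"

definition boundary_pinv ::
  "('a, 'c) cw \<Rightarrow> int \<Rightarrow> real \<Rightarrow> ('c \<Rightarrow> real) \<Rightarrow> ('c \<Rightarrow> real) \<Rightarrow> ('c \<Rightarrow> real) \<Rightarrow> 'c \<Rightarrow> real" where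
  "boundary_pinv X d \<beta> E W =
     pseudo_inverse (real_chains X d) (cell_norm X d \<beta> W) (cell_norm X (d - 1) \<beta> E)
       (boundary X d)"

end

theory Submission
  imports Defs "HOL-Library.Function_Algebras"
begin

text \<open>Write \<open>\<partial>\<close> for the boundary operator from \<open>C\<^sub>d\<close> to \<open>C\<^sub>d\<^sub>-\<^sub>1\<close>. A subcomplex between the skeleta
  of dimensions \<open>d - 1\<close> and \<open>d\<close> is a spanning tree exactly if the chains on its \<open>d\<close>-cells form a
  complement of the kernel of \<open>\<partial>\<close>, and a subcomplex one dimension lower is a spanning co-tree exactly
  if the chains on its \<open>(d - 1)\<close>-cells form a complement of the image of \<open>\<partial>\<close>. In these terms
  \<open>\<phi>\<^sub>T (\<partial> c)\<close> is the projection of \<open>c\<close> to the tree along the kernel, and \<open>v - \<zeta>\<^sub>L v\<close> is the projection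
  of \<open>v\<close> to the co-tree along the image. The pseudo-inverse sends \<open>v\<close> to the preimage,
  orthogonal to the kernel, of the orthogonal projection of \<open>v\<close> to the image. Hence two things are to
  be shown: the weighted average of the \<open>v - \<zeta>\<^sub>L v\<close> is orthogonal to the image, and the weighted
  average of the \<open>\<phi>\<^sub>T (\<partial> c)\<close> is orthogonal to the kernel.

  Both are instances of one statement about a subspace \<open>K\<close> of a coordinate space and the projections
  \<open>\<pi>\<^sub>T\<close> along \<open>K\<close> to those coordinate subspaces that are complements of \<open>K\<close>
  (\<open>averaged_projection_orthogonal\<close>). The inner product of \<open>\<pi>\<^sub>T c\<close> with \<open>z \<in> K\<close> is a sum over the
  \<open>t \<in> T\<close>, and the terms are regrouped by the set \<open>S = T - {t}\<close>. All complements
  \<open>S \<union> {t}\<close> of a given \<open>S\<close> share, up to a factor, one linear functional \<open>l\<close> that vanishes on \<open>K\<close> and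
  on the coordinates in \<open>S\<close>; the \<open>t\<close>-coordinate of \<open>\<pi>\<^sub>T c\<close> is \<open>l c / l e\<^sub>t\<close>. If the number
  \<open>\<theta>\<^sub>T\<close> in the weight is proportional to the absolute value of \<open>l e\<^sub>t\<close>, the terms belonging to \<open>S\<close> add up
  to a multiple of \<open>l c * (\<Sum>t. l e\<^sub>t * z\<^sub>t) = l c * l z = 0\<close>.

  The proportionality is a fact about lattices. Both the torsion order of a tree and the
  order of the relative homology group of a co-tree are indices of subgroups of the form \<open>N + \<int> a\<close>
  in a fixed group of integer chains, where only \<open>a\<close> depends on \<open>t\<close>; and \<open>N + \<int> k a\<close>
  has \<open>k\<close> times the index of \<open>N + \<int> a\<close> (\<open>index_exchange\<close>, \<open>exchange_compatibility\<close>).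

  The definitions of trees and co-trees use integral and rational homology, the conclusion is about
  real chains. Rational and real complements are compared by applying \<open>\<rat>\<close>-linear functions from
  \<open>\<real>\<close> to \<open>\<rat>\<close> to the coefficients (\<open>complements_rat_real\<close>).

  All of this needs that the incidence numbers are what they should be, that is, that the cells are a
  basis of the cellular chain group, and that consecutive boundary operators compose to zero. The
  basis theorem rests on the case of a single attached cell (\<open>characteristic_map_iso\<close>): cells
  generate by induction on their number, with the exact sequence of a triple, and they are
  independent because the coefficient of a cell can be read off in the homology relative to the
  complement of that cell.\<close>

section \<open>The disk and its radial deformation\<close>

definition sqnorm :: "nat \<Rightarrow> (nat \<Rightarrow> real) \<Rightarrow> real" where
  "sqnorm n x = (\<Sum>i<n. (x i)\<^sup>2)"

lemma sqnorm_nonneg [simp]: "0 \<le> sqnorm n x"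
  by (simp add: sqnorm_def sum_nonneg)

lemma sqnorm_scale: "sqnorm n (\<lambda>i. c * x i) = c\<^sup>2 * sqnorm n x"
  by (simp add: sqnorm_def power_mult_distrib sum_distrib_left)

lemma disk_top_of_set: "disk n = top_of_set {x. (\<forall>i\<ge>n. x i = 0) \<and> sqnorm n x \<le> 1}"
  by (simp add: disk_def Euclidean_space_def euclidean_product_topology subtopology_subtopology
      sqnorm_def Collect_conj_eq)

lemma topspace_disk: "topspace (disk n) = {x. (\<forall>i\<ge>n. x i = 0) \<and> sqnorm n x \<le> 1}"
  by (simp add: disk_top_of_set)

lemma disk_sphere_eq: "disk_sphere n = {x. (\<forall>i\<ge>n. x i = 0) \<and> sqnorm n x = 1}"
  by (simp add: disk_sphere_def topspace_Euclidean_space sqnorm_def)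

lemma disk_interior_eq: "disk_interior n = {x. (\<forall>i\<ge>n. x i = 0) \<and> sqnorm n x < 1}"
  by (auto simp: disk_interior_def topspace_disk disk_sphere_eq)

lemma disk_sphere_subset: "disk_sphere n \<subseteq> topspace (disk n)"
  by (auto simp: topspace_disk disk_sphere_eq)

lemma disk_interior_nonempty: "disk_interior n \<noteq> {}"
proof -
  have "(\<lambda>i. 0) \<in> disk_interior n" by (simp add: disk_interior_eq sqnorm_def)
  then show ?thesis by blast
qed

lemma Hausdorff_disk: "Hausdorff_space (disk n)"
  by (simp add: disk_top_of_set Hausdorff_space_subtopology)

lemma continuous_on_coord: "continuous_on S (\<lambda>x::nat \<Rightarrow> real. x i)"
  by (rule continuous_on_subset[OF continuous_on_product_coordinates]) auto

lemma continuous_on_coord_snd: "continuous_on S (\<lambda>p::real \<times> (nat \<Rightarrow> real). snd p i)"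
  using continuous_on_compose[OF continuous_on_snd[OF continuous_on_id] continuous_on_coord, of S i]
  by (simp add: o_def)

lemma continuous_on_sqnorm [continuous_intros]:
  assumes "continuous_on S f" shows "continuous_on S (\<lambda>z. sqnorm n (f z))"
proof -
  have "continuous_on S (\<lambda>z. f z i)" for i
    using continuous_on_compose[OF assms continuous_on_coord, of i] by (simp add: o_def)
  then show ?thesis unfolding sqnorm_def by (intro continuous_intros)
qed

lemma compact_space_disk: "compact_space (disk n)"
proof -
  let ?P = "{x::nat \<Rightarrow> real. (\<forall>i\<ge>n. x i = 0) \<and> sqnorm n x \<le> 1}"
  have "compactin (product_topology (\<lambda>i. euclidean) UNIV) (PiE UNIV (\<lambda>i. {-1..1::real}))"
    by (simp add: compactin_PiE)
  then have c: "compact (PiE UNIV (\<lambda>i::nat. {-1..1::real}))"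
    by (simp add: euclidean_product_topology)
  have "closedin (Euclidean_space n) (topspace (disk n))"
    unfolding closedin_Euclidean_space_iff
  proof
    have "?P = {x. \<forall>i\<ge>n. x i = 0} \<inter> {x. sqnorm n x \<le> 1}" by auto
    moreover have "closed {x::nat \<Rightarrow> real. \<forall>i\<ge>n. x i = 0}"
      by (intro closed_Collect_all closed_Collect_imp closed_Collect_eq continuous_intros
          continuous_on_coord) auto
    moreover have "closed {x::nat \<Rightarrow> real. sqnorm n x \<le> 1}"
      by (intro closed_Collect_le continuous_intros)
    ultimately show "closed (topspace (disk n))"
      unfolding topspace_disk by auto
    show "topspace (disk n) \<subseteq> topspace (Euclidean_space n)"
      by (auto simp: topspace_disk topspace_Euclidean_space)
  qed
  then have cl: "closed ?P" by (auto dest: closedin_Euclidean_imp_closed simp: topspace_disk)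
  have "?P \<subseteq> PiE UNIV (\<lambda>i. {-1..1})"
  proof (clarsimp simp: PiE_UNIV_domain Pi_iff)
    fix x i assume z: "\<forall>i\<ge>n. x i = 0" and s: "sqnorm n x \<le> 1"
    show "- 1 \<le> x i \<and> x i \<le> (1::real)"
    proof (cases "i < n")
      case True
      then have "(x i)\<^sup>2 \<le> sqnorm n x"
        unfolding sqnorm_def by (intro member_le_sum) auto
      then have "(x i)\<^sup>2 \<le> 1" using s by linarith
      then have "\<bar>x i\<bar> \<le> 1" by (simp only: abs_square_le_1)
      then show ?thesis by auto
    qed (use z in auto)
  qed
  then have "compact ?P"
    using compact_Int_closed[OF c cl] by (simp add: Int_absorb1)
  then show ?thesis by (simp add: disk_top_of_set compact_space_subtopology)
qed

lemma contractible_disk: "contractible_space (disk n)"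
proof -
  let ?P = "{x::nat \<Rightarrow> real. (\<forall>i\<ge>n. x i = 0) \<and> sqnorm n x \<le> 1}"
  let ?h = "\<lambda>(t::real, x::nat \<Rightarrow> real). (\<lambda>i. (1 - t) * x i)"
  have cont: "continuous_on ({0..1} \<times> ?P) ?h"
    unfolding case_prod_unfold
    by (intro continuous_on_coordinatewise_then_product continuous_on_mult continuous_on_coord_snd
        continuous_intros)
  have im: "?h ` ({0..1} \<times> ?P) \<subseteq> ?P"
  proof (clarsimp simp: sqnorm_scale)
    fix t :: real and x assume "0 \<le> t" "t \<le> 1" "sqnorm n x \<le> 1"
    then have "(1 - t)\<^sup>2 \<le> 1\<^sup>2" by (intro power_mono) auto
    then show "(1 - t)\<^sup>2 * sqnorm n x \<le> 1"
      using mult_mono[of "(1-t)\<^sup>2" 1 "sqnorm n x" 1] \<open>sqnorm n x \<le> 1\<close> by simp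
  qed
  have "continuous_map (prod_topology (top_of_set {0..1}) (disk n)) (disk n) ?h"
    using cont im by (auto simp: disk_top_of_set)
  then have "homotopic_with (\<lambda>x. True) (disk n) (disk n) id (\<lambda>x. (\<lambda>i. 0))"
    unfolding homotopic_with_def by (intro exI[of _ ?h]) auto
  then show ?thesis unfolding contractible_space_def by blast
qed

text \<open>A homotopy of the disk that moves points outwards until they hit the sphere. It starts at the
  identity, keeps the sphere fixed throughout, and at time 1 has moved all points of norm at least
  \<open>1/2\<close> to the sphere. Being defined on the whole disk, it extends by the identity to any space to
  which the disk is attached.\<close>

definition push :: "nat \<Rightarrow> real \<times> (nat \<Rightarrow> real) \<Rightarrow> nat \<Rightarrow> real" where
  "push n = (\<lambda>(t, x) i. (1 + t) / max 1 ((1 + t) * sqrt (sqnorm n x)) * x i)"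

lemma sqnorm_push:
  assumes "0 \<le> t"
  shows "sqnorm n (push n (t, x)) = (min 1 ((1 + t) * sqrt (sqnorm n x)))\<^sup>2"
proof -
  have "sqnorm n (push n (t, x))
      = ((1 + t) / max 1 ((1 + t) * sqrt (sqnorm n x)))\<^sup>2 * sqnorm n x"
    unfolding push_def prod.case by (rule sqnorm_scale)
  also have "\<dots> = ((1 + t) * sqrt (sqnorm n x) / max 1 ((1 + t) * sqrt (sqnorm n x)))\<^sup>2"
    by (simp add: power_mult_distrib power_divide)
  also have "(1 + t) * sqrt (sqnorm n x) / max 1 ((1 + t) * sqrt (sqnorm n x))
      = min 1 ((1 + t) * sqrt (sqnorm n x))"
    by (auto simp: max_def min_def)
  finally show ?thesis .
qed

lemma push_disk: "x \<in> topspace (disk n) \<Longrightarrow> 0 \<le> t \<Longrightarrow> push n (t, x) \<in> topspace (disk n)"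
  unfolding topspace_disk by (auto simp: sqnorm_push power_le_one) (simp add: push_def)

lemma push_sphere: "x \<in> disk_sphere n \<Longrightarrow> 0 \<le> t \<Longrightarrow> push n (t, x) = x"
  by (auto simp: disk_sphere_eq push_def max_def)

lemma push_0: "x \<in> topspace (disk n) \<Longrightarrow> push n (0, x) = x"
  by (auto simp: topspace_disk push_def max_def fun_eq_iff)

lemma push_1: "x \<in> topspace (disk n) \<Longrightarrow> 1/4 \<le> sqnorm n x \<Longrightarrow> push n (1, x) \<in> disk_sphere n"
proof -
  assume x: "x \<in> topspace (disk n)" "1/4 \<le> sqnorm n x"
  then have "sqrt ((1/2)\<^sup>2) \<le> sqrt (sqnorm n x)"
    by (intro real_sqrt_le_mono) (simp add: power2_eq_square)
  then have "min 1 ((1 + 1) * sqrt (sqnorm n x)) = 1" by auto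
  then show ?thesis
    using x sqnorm_push[of 1 n x] by (auto simp: disk_sphere_eq topspace_disk push_def)
qed

lemma push_collar:
  assumes "1/4 \<le> sqnorm n x" "0 \<le> t" shows "1/4 \<le> sqnorm n (push n (t, x))"
proof -
  have h: "sqrt ((1/2)\<^sup>2) \<le> sqrt (sqnorm n x)"
    using assms by (intro real_sqrt_le_mono) (simp add: power2_eq_square)
  then have "1/2 \<le> sqrt (sqnorm n x)" by simp
  then have "1 * (1/2) \<le> (1 + t) * sqrt (sqnorm n x)"
    using assms by (intro mult_mono) auto
  then have "1/2 \<le> min 1 ((1 + t) * sqrt (sqnorm n x))" by auto
  then have "(1/2)\<^sup>2 \<le> (min 1 ((1 + t) * sqrt (sqnorm n x)))\<^sup>2" by (intro power_mono) auto
  then show ?thesis using assms by (simp add: sqnorm_push power2_eq_square)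
qed

lemma continuous_map_push:
  "continuous_map (prod_topology (top_of_set {0..1}) (disk n)) (disk n) (push n)"
proof -
  have "continuous_on ({0..1} \<times> topspace (disk n)) (push n)"
    unfolding push_def case_prod_unfold
    by (intro continuous_on_coordinatewise_then_product continuous_on_mult continuous_on_coord_snd
        continuous_on_divide continuous_on_max continuous_intros) (auto simp: max_def)
  moreover have "push n \<in> ({0..1} \<times> topspace (disk n)) \<rightarrow> topspace (disk n)"
    using push_disk by auto
  ultimately show ?thesis
    by (simp add: disk_top_of_set image_subset_iff_funcset)
qed

section \<open>Attaching one cell\<close>

text \<open>\<open>Z\<close> arises from its closed subset \<open>B\<close> by attaching one \<open>n\<close>-cell with characteristic map \<open>\<phi>\<close>.
  Because the disk is compact and \<open>Z\<close> is Hausdorff, \<open>Z\<close> automatically carries the quotient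
  topology.\<close>

locale cell_attachment =
  fixes Z :: "'a topology" and B :: "'a set" and n :: nat and \<phi> :: "(nat \<Rightarrow> real) \<Rightarrow> 'a"
  assumes Hausdorff: "Hausdorff_space Z" and closed_B: "closedin Z B"
    and cont: "continuous_map (disk n) Z \<phi>" and sphere: "\<phi> ` disk_sphere n \<subseteq> B"
    and homeo: "homeomorphic_map (subtopology (disk n) (disk_interior n))
                  (subtopology Z (topspace Z - B)) \<phi>"
begin

lemma B_subset: "B \<subseteq> topspace Z" using closed_B by (rule closedin_subset)

lemma interior_image: "\<phi> ` disk_interior n = topspace Z - B"
proof -
  have "\<phi> ` topspace (subtopology (disk n) (disk_interior n)) = topspace (subtopology Z (topspace Z - B))"
    using homeo by (rule homeomorphic_imp_surjective_map)
  then show ?thesis by (simp add: disk_interior_def Int_absorb1 Diff_subset)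
qed

lemma interior_inj: "inj_on \<phi> (disk_interior n)"
  using homeomorphic_imp_injective_map[OF homeo] by (simp add: disk_interior_def Int_absorb1 Diff_subset)

lemma disk_cases: "x \<in> topspace (disk n) \<Longrightarrow> x \<in> disk_interior n \<or> x \<in> disk_sphere n"
  by (auto simp: disk_interior_def)

text \<open>The bound \<open>1/4\<close> on the squared norm is the radius \<open>1/2\<close> beyond which \<open>push\<close> reaches the sphere.\<close>

definition collar :: "'a set" where
  "collar = B \<union> \<phi> ` {x \<in> topspace (disk n). 1/4 \<le> sqnorm n x}"

text \<open>The homotopy \<open>push\<close>, transported to the attached cell and extended by the identity. The inverse
  of \<open>\<phi>\<close> is taken on the open cell only, where \<open>\<phi>\<close> is injective.\<close>

definition spread :: "real \<times> 'a \<Rightarrow> 'a" where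
  "spread = (\<lambda>(t, z). if z \<in> B then z else \<phi> (push n (t, inv_into (disk_interior n) \<phi> z)))"

lemma spread_characteristic_map:
  assumes x: "x \<in> topspace (disk n)" and t: "0 \<le> t"
  shows "spread (t, \<phi> x) = \<phi> (push n (t, x))"
proof (cases "x \<in> disk_interior n")
  case True
  then have "\<phi> x \<notin> B" using interior_image by blast
  then show ?thesis using True by (simp add: spread_def inv_into_f_f[OF interior_inj])
next
  case False
  then have "x \<in> disk_sphere n" using disk_cases x by blast
  then show ?thesis using sphere push_sphere t by (auto simp: spread_def)
qed

lemma cover: "topspace Z = B \<union> \<phi> ` topspace (disk n)"
proof -
  have "\<phi> ` topspace (disk n) \<subseteq> topspace Z"
    using cont by (simp add: continuous_map_image_subset_topspace)
  moreover have "topspace Z - B \<subseteq> \<phi> ` topspace (disk n)"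
    unfolding interior_image[symmetric] by (rule image_mono) (simp add: disk_interior_def Diff_subset)
  ultimately show ?thesis using B_subset by blast
qed

text \<open>The preimage of a closed set is a union of two closed pieces: the part in \<open>B\<close>, and the image of
  a closed subset of the compact cylinder over the disk, on which the map is given by \<open>push\<close>.\<close>

lemma continuous_map_spread:
  "continuous_map (prod_topology (top_of_set {0..1}) Z) Z spread"
  unfolding continuous_map_closedin
proof (intro conjI allI impI)
  let ?I = "top_of_set {0..1::real}"
  let ?q = "\<lambda>(t::real, x). (t, \<phi> x)"
  let ?k = "\<phi> \<circ> push n"
  have k: "continuous_map (prod_topology ?I (disk n)) Z ?k"
    by (rule continuous_map_compose[OF continuous_map_push cont])
  have q: "closed_map (prod_topology ?I (disk n)) (prod_topology ?I Z) ?q"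
  proof (rule continuous_imp_closed_map)
    have "compact_space ?I" by (rule compact_space_subtopology) simp
    then show "compact_space (prod_topology ?I (disk n))"
      by (intro compact_space_prod_topology[THEN iffD2] disjI2 conjI compact_space_disk)
    show "Hausdorff_space (prod_topology ?I Z)"
      by (simp add: Hausdorff_space_prod_topology Hausdorff Hausdorff_space_subtopology)
    show "continuous_map (prod_topology ?I (disk n)) (prod_topology ?I Z) ?q"
      using continuous_map_compose[OF continuous_map_snd cont, of ?I]
      by (simp add: case_prod_unfold continuous_map_paired continuous_map_fst o_def)
  qed
  show "spread \<in> topspace (prod_topology ?I Z) \<rightarrow> topspace Z"
  proof clarsimp
    fix t :: real and z assume t: "0 \<le> t" "t \<le> 1" and z: "z \<in> topspace Z"
    then consider "z \<in> B" | x where "x \<in> topspace (disk n)" "z = \<phi> x" using cover by blast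
    then show "spread (t, z) \<in> topspace Z"
    proof cases
      case 1 then show ?thesis using z by (simp add: spread_def)
    next
      case 2 then show ?thesis using cover push_disk[OF 2(1) t(1)] spread_characteristic_map[OF 2(1) t(1)] by auto
    qed
  qed
  fix C assume C: "closedin Z C"
  have "{p \<in> topspace (prod_topology ?I Z). spread p \<in> C}
      = {0..1} \<times> (B \<inter> C) \<union> ?q ` {p \<in> topspace (prod_topology ?I (disk n)). ?k p \<in> C}" (is "?L = ?R1 \<union> ?R2")
  proof (intro equalityI subsetI)
    fix p assume p: "p \<in> ?L"
    obtain t z where tz: "p = (t, z)" by force
    with p have t: "0 \<le> t" "t \<le> 1" and z: "z \<in> topspace Z" "spread (t, z) \<in> C" by auto
    show "p \<in> ?R1 \<union> ?R2"
    proof (cases "z \<in> B")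
      case True then show ?thesis using t z tz by (simp add: spread_def)
    next
      case False
      then obtain x where x: "x \<in> topspace (disk n)" "z = \<phi> x" using cover z by blast
      then have "(t, x) \<in> {p \<in> topspace (prod_topology ?I (disk n)). ?k p \<in> C}"
        using t z spread_characteristic_map[OF x(1) t(1)] by simp
      moreover have "p = ?q (t, x)" using tz x by simp
      ultimately show ?thesis by blast
    qed
  next
    fix p assume "p \<in> ?R1 \<union> ?R2"
    then show "p \<in> ?L"
    proof
      assume "p \<in> ?R1" then show ?thesis using B_subset by (auto simp: spread_def)
    next
      assume "p \<in> ?R2"
      then obtain r where r: "r \<in> {p \<in> topspace (prod_topology ?I (disk n)). ?k p \<in> C}" "p = ?q r"
        by (rule imageE)
      obtain t x where "r = (t, x)" by (rule prod.exhaust)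
      with r have "p = (t, \<phi> x)" "0 \<le> t" "t \<le> 1" "x \<in> topspace (disk n)"
        "\<phi> (push n (t, x)) \<in> C" by simp_all
      then show ?thesis using cover spread_characteristic_map[of x t] by simp
    qed
  qed
  moreover have "closedin (prod_topology ?I Z) ?R1"
    using closed_B C by (auto simp: closedin_prod_Times_iff)
  moreover have "closedin (prod_topology ?I Z) ?R2"
    by (rule q[unfolded closed_map_def, rule_format, OF closedin_continuous_map_preimage[OF k C]])
  ultimately show "closedin (prod_topology ?I Z) {p \<in> topspace (prod_topology ?I Z). spread p \<in> C}"
    by (simp add: closedin_Un)
qed

lemma collar_subset: "collar \<subseteq> topspace Z"
  using cover by (auto simp: collar_def)

lemma spread_collar:
  assumes "z \<in> collar" "0 \<le> t" shows "spread (t, z) \<in> collar"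
  using assms(1) unfolding collar_def
proof
  assume "z \<in> B" then show "spread (t, z) \<in> B \<union> \<phi> ` {x \<in> topspace (disk n). 1/4 \<le> sqnorm n x}"
    by (simp add: spread_def)
next
  assume "z \<in> \<phi> ` {x \<in> topspace (disk n). 1/4 \<le> sqnorm n x}"
  then obtain x where x: "x \<in> topspace (disk n)" "1/4 \<le> sqnorm n x" "z = \<phi> x" by blast
  have "push n (t, x) \<in> {x \<in> topspace (disk n). 1/4 \<le> sqnorm n x}"
    using x assms push_disk push_collar by auto
  then show "spread (t, z) \<in> B \<union> \<phi> ` {x \<in> topspace (disk n). 1/4 \<le> sqnorm n x}"
    using x assms by (auto simp: spread_characteristic_map)
qed

lemma spread_1: assumes "z \<in> collar" shows "spread (1, z) \<in> B"
  using assms unfolding collar_def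
proof
  assume "z \<in> \<phi> ` {x \<in> topspace (disk n). 1/4 \<le> sqnorm n x}"
  then obtain x where x: "x \<in> topspace (disk n)" "1/4 \<le> sqnorm n x" "z = \<phi> x" by blast
  then show "spread (1, z) \<in> B" using push_1 sphere by (auto simp: spread_characteristic_map)
qed (simp add: spread_def)

lemma spread_0: assumes "z \<in> topspace Z" shows "spread (0, z) = z"
proof (cases "z \<in> B")
  case False
  then obtain x where x: "x \<in> topspace (disk n)" "z = \<phi> x" using cover assms by blast
  then show ?thesis using push_0[OF x(1)] by (simp add: spread_characteristic_map)
qed (simp add: spread_def)

text \<open>The homotopy \<open>spread\<close> deforms the collar into \<open>B\<close> within the collar, so thickening \<open>B\<close> to the
  collar does not change the relative homology.\<close>

lemma collar_iso:
  "hom_induced p Z B Z collar id \<in> iso (relative_homology_group p Z B) (relative_homology_group p Z collar)"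
proof (rule homotopy_equivalence_relative_homology_group_isomorphism)
  let ?g = "\<lambda>z. spread (1, z)"
  have sB: "(\<lambda>z. spread (t, z)) \<in> B \<rightarrow> B" for t by (auto simp: spread_def)
  show "continuous_map Z Z id" by simp
  show "id \<in> B \<rightarrow> collar" by (auto simp: collar_def)
  show cg: "continuous_map Z Z ?g"
    using continuous_map_o_Pair[OF continuous_map_spread, of 1] by (simp add: o_def)
  show "?g \<in> collar \<rightarrow> B" using spread_1 by auto
  have *: "homotopic_with (\<lambda>h. h \<in> S \<rightarrow> S) Z Z ?g id"
    if S: "\<And>t. 0 \<le> t \<Longrightarrow> (\<lambda>z. spread (t, z)) \<in> S \<rightarrow> S" and sub: "S \<subseteq> topspace Z" for S
  proof -
    have "homotopic_with (\<lambda>h. h \<in> S \<rightarrow> S) Z Z id ?g"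
    proof (subst homotopic_with)
      fix h k :: "'a \<Rightarrow> 'a" assume eq: "\<And>x. x \<in> topspace Z \<Longrightarrow> h x = k x"
      show "(h \<in> S \<rightarrow> S) = (k \<in> S \<rightarrow> S)" using eq sub by (auto simp: Pi_iff subset_iff)
    next
      show "\<exists>h. continuous_map (prod_topology (top_of_set {0..1::real}) Z) Z h \<and>
        (\<forall>x\<in>topspace Z. h (0, x) = id x) \<and> (\<forall>x\<in>topspace Z. h (1, x) = spread (1, x)) \<and>
        (\<forall>t\<in>{0..1}. (\<lambda>x. h (t, x)) \<in> S \<rightarrow> S)"
      proof (intro exI conjI ballI)
        show "continuous_map (prod_topology (top_of_set {0..1}) Z) Z spread"
          by (rule continuous_map_spread)
      qed (use spread_0 S in auto)
    qed
    then show ?thesis by (rule homotopic_with_symD)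
  qed
  show "homotopic_with (\<lambda>h. h \<in> B \<rightarrow> B) Z Z (?g \<circ> id) id"
    using *[OF sB B_subset] by simp
  show "homotopic_with (\<lambda>k. k \<in> collar \<rightarrow> collar) Z Z (id \<circ> ?g) id"
    using *[of collar] spread_collar collar_subset by simp
qed

text \<open>The collar is a neighbourhood of \<open>B\<close>, so \<open>B\<close> can be excised; what remains lives in the open
  cell.\<close>

lemma excision_iso:
  "hom_induced p (subtopology Z (topspace Z - B)) (collar - B) Z collar id
     \<in> iso (relative_homology_group p (subtopology Z (topspace Z - B)) (collar - B))
          (relative_homology_group p Z collar)"
proof -
  let ?V = "topspace Z - \<phi> ` {x \<in> topspace (disk n). sqnorm n x \<le> 1/4}"
  have "closedin (disk n) {x \<in> topspace (disk n). sqnorm n x \<in> {..1/4}}"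
  proof (rule closedin_continuous_map_preimage)
    show "continuous_map (disk n) euclideanreal (sqnorm n)"
      unfolding disk_top_of_set by (simp add: continuous_intros)
  qed simp
  then have "closedin Z (\<phi> ` {x \<in> topspace (disk n). sqnorm n x \<in> {..1/4}})"
    by (rule continuous_imp_closed_map[OF cont compact_space_disk Hausdorff, unfolded closed_map_def,
          rule_format])
  then have V: "openin Z ?V" by (auto simp: openin_diff)
  have "?V \<subseteq> collar"
  proof
    fix z assume z: "z \<in> ?V"
    show "z \<in> collar"
    proof (cases "z \<in> B")
      case False
      then obtain x where "x \<in> topspace (disk n)" "z = \<phi> x" using z cover by blast
      then show ?thesis using z by (force simp: collar_def)
    qed (simp add: collar_def)
  qed
  moreover have "B \<subseteq> ?V"
  proof
    fix z assume z: "z \<in> B"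
    have "x \<in> disk_interior n" if "x \<in> topspace (disk n)" "sqnorm n x \<le> 1/4" for x
      using that by (auto simp: disk_interior_eq topspace_disk)
    then have "z \<noteq> \<phi> x" if "x \<in> topspace (disk n)" "sqnorm n x \<le> 1/4" for x
      using z interior_image that by blast
    then show "z \<in> ?V" using z B_subset by blast
  qed
  ultimately have "B \<subseteq> Z interior_of collar"
    using V by (meson interior_of_maximal order_trans)
  then have "hom_induced p (subtopology Z (topspace Z - B)) (collar - B) (subtopology Z (topspace Z)) collar id
     \<in> iso (relative_homology_group p (subtopology Z (topspace Z - B)) (collar - B))
          (relative_homology_group p (subtopology Z (topspace Z)) collar)"
    by (intro homology_excision_axiom) (simp_all add: closure_of_closedin closed_B collar_subset)
  then show ?thesis by simp
qed

text \<open>The disk itself is obtained from its sphere by attaching a cell, so the isomorphisms above also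
  apply to it and can be compared along \<open>\<phi>\<close>.\<close>

lemma disk_attachment: "cell_attachment (disk n) (disk_sphere n) n id"
proof
  show "closedin (disk n) (disk_sphere n)"
  proof -
    have "closedin (disk n) {x \<in> topspace (disk n). sqnorm n x \<in> {1}}"
    proof (rule closedin_continuous_map_preimage)
      show "continuous_map (disk n) euclideanreal (sqnorm n)"
        unfolding disk_top_of_set by (simp add: continuous_intros)
    qed simp
    moreover have "{x \<in> topspace (disk n). sqnorm n x \<in> {1}} = disk_sphere n"
      by (auto simp: topspace_disk disk_sphere_eq)
    ultimately show ?thesis by simp
  qed
qed (auto simp: Hausdorff_disk disk_interior_def)

text \<open>Thickening and excision identify both sides with homology groups of the open cell and of the
  open disk, relative to a ring around the missing boundary, and there \<open>\<phi>\<close> is a homeomorphism. The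
  claim follows from the two commuting squares that connect these groups.\<close>

lemma characteristic_map_iso:
  "hom_induced p (disk n) (disk_sphere n) Z B \<phi>
     \<in> iso (relative_homology_group p (disk n) (disk_sphere n)) (relative_homology_group p Z B)"
proof -
  interpret D: cell_attachment "disk n" "disk_sphere n" n id by (rule disk_attachment)
  let ?ring = "{x \<in> topspace (disk n). 1/4 \<le> sqnorm n x}"
  have D_collar: "D.collar = disk_sphere n \<union> ?ring"
    unfolding D.collar_def by simp
  have maps: "\<phi> \<in> D.collar \<rightarrow> collar" "\<phi> \<in> disk_sphere n \<rightarrow> B"
    using sphere unfolding D_collar collar_def by auto
  have D_diff: "D.collar - disk_sphere n = {x \<in> disk_interior n. 1/4 \<le> sqnorm n x}"
    unfolding D_collar by (auto simp: disk_interior_def)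
  have ring: "\<phi> ` (D.collar - disk_sphere n) = collar - B"
  proof (intro equalityI subsetI)
    fix z assume "z \<in> \<phi> ` (D.collar - disk_sphere n)"
    then obtain x where x: "x \<in> disk_interior n" "1/4 \<le> sqnorm n x" "z = \<phi> x"
      unfolding D_diff by blast
    then have "z \<notin> B" using interior_image by blast
    moreover have "x \<in> ?ring" using x by (auto simp: disk_interior_def)
    ultimately show "z \<in> collar - B" using x unfolding collar_def by blast
  next
    fix z assume "z \<in> collar - B"
    then obtain x where x: "x \<in> ?ring" "z = \<phi> x" "z \<notin> B" unfolding collar_def by blast
    then have "x \<notin> disk_sphere n" using sphere by blast
    then show "z \<in> \<phi> ` (D.collar - disk_sphere n)" using x unfolding D_collar by blast
  qed
  let ?DI = "subtopology (disk n) (topspace (disk n) - disk_sphere n)"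
  let ?ZI = "subtopology Z (topspace Z - B)"
  have inner: "hom_induced p ?DI (D.collar - disk_sphere n) ?ZI (collar - B) \<phi>
      \<in> iso (relative_homology_group p ?DI (D.collar - disk_sphere n))
           (relative_homology_group p ?ZI (collar - B))"
  proof (rule homeomorphic_map_relative_homology_iso)
    show "homeomorphic_map ?DI ?ZI \<phi>" using homeo by (simp add: disk_interior_def)
    show "D.collar - disk_sphere n \<subseteq> topspace ?DI" unfolding D_collar by auto
  qed (rule ring)
  let ?m = "hom_induced p (disk n) D.collar Z collar \<phi>"
  let ?eD = "hom_induced p ?DI (D.collar - disk_sphere n) (disk n) D.collar id"
  let ?eZ = "hom_induced p ?ZI (collar - B) Z collar id"
  let ?iD = "hom_induced p (disk n) (disk_sphere n) (disk n) D.collar id"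
  let ?iZ = "hom_induced p Z B Z collar id"
  let ?f = "hom_induced p (disk n) (disk_sphere n) Z B \<phi>"
  let ?g = "hom_induced p ?DI (D.collar - disk_sphere n) ?ZI (collar - B) \<phi>"
  have sq1: "?m \<circ> ?eD = ?eZ \<circ> ?g"
  proof -
    have "continuous_map ?DI ?ZI \<phi>"
      using homeo by (simp add: homeomorphic_imp_continuous_map disk_interior_def)
    then have "hom_induced p ?DI (D.collar - disk_sphere n) Z collar (id \<circ> \<phi>) = ?eZ \<circ> ?g"
      using ring by (intro hom_induced_compose) (auto simp: continuous_map_from_subtopology)
    moreover have "hom_induced p ?DI (D.collar - disk_sphere n) Z collar (\<phi> \<circ> id) = ?m \<circ> ?eD"
      using maps cont by (intro hom_induced_compose) (auto simp: continuous_map_from_subtopology)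
    ultimately show ?thesis by simp
  qed
  have sq2: "?iZ \<circ> ?f = ?m \<circ> ?iD"
  proof -
    have "hom_induced p (disk n) (disk_sphere n) Z collar (id \<circ> \<phi>) = ?iZ \<circ> ?f"
      using maps cont by (intro hom_induced_compose) (auto simp: collar_def)
    moreover have "hom_induced p (disk n) (disk_sphere n) Z collar (\<phi> \<circ> id) = ?m \<circ> ?iD"
      using maps cont by (intro hom_induced_compose) (auto simp: D_collar)
    ultimately show ?thesis by simp
  qed
  (* The square with the excision maps shows that the map in the middle is bijective. *)
  have bij_m: "bij_betw ?m (carrier (relative_homology_group p (disk n) D.collar))
      (carrier (relative_homology_group p Z collar))"
  proof -
    have eD: "bij_betw ?eD (carrier (relative_homology_group p ?DI (D.collar - disk_sphere n)))
        (carrier (relative_homology_group p (disk n) D.collar))"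
      using D.excision_iso by (simp add: iso_def)
    have g: "bij_betw ?g (carrier (relative_homology_group p ?DI (D.collar - disk_sphere n)))
        (carrier (relative_homology_group p ?ZI (collar - B)))"
      using inner by (simp add: iso_def)
    have eZ: "bij_betw ?eZ (carrier (relative_homology_group p ?ZI (collar - B)))
        (carrier (relative_homology_group p Z collar))"
      using excision_iso by (simp add: iso_def)
    have "bij_betw (?eZ \<circ> ?g) (carrier (relative_homology_group p ?DI (D.collar - disk_sphere n)))
        (carrier (relative_homology_group p Z collar))"
      by (rule bij_betw_trans[OF g eZ])
    then show ?thesis unfolding sq1[symmetric] using bij_betw_comp_iff[OF eD] by blast
  qed
  have iD: "bij_betw ?iD (carrier (relative_homology_group p (disk n) (disk_sphere n)))
        (carrier (relative_homology_group p (disk n) D.collar))"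
    using D.collar_iso by (simp add: iso_def)
  have "bij_betw (?m \<circ> ?iD) (carrier (relative_homology_group p (disk n) (disk_sphere n)))
        (carrier (relative_homology_group p Z collar))"
    by (rule bij_betw_trans[OF iD bij_m])
  then have "bij_betw (?iZ \<circ> ?f) (carrier (relative_homology_group p (disk n) (disk_sphere n)))
        (carrier (relative_homology_group p Z collar))"
    unfolding sq2 .
  moreover have "bij_betw ?iZ (carrier (relative_homology_group p Z B))
        (carrier (relative_homology_group p Z collar))"
    using collar_iso by (simp add: iso_def)
  moreover have "?f ` carrier (relative_homology_group p (disk n) (disk_sphere n))
      \<subseteq> carrier (relative_homology_group p Z B)"
    by (auto simp: hom_induced_carrier)
  ultimately have "bij_betw ?f (carrier (relative_homology_group p (disk n) (disk_sphere n)))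
        (carrier (relative_homology_group p Z B))"
    using bij_betw_comp_iff2 by blast
  then show ?thesis by (simp add: iso_def hom_induced_hom)
qed

end

section \<open>The generator of the homology of the disk relative to its sphere\<close>

text \<open>The disk is contractible, so its relative homology is the reduced homology of the sphere, one
  degree lower. In dimension 0 the sphere is empty and the disk is a point.\<close>

lemma disk_homology_cyclic:
  "relative_homology_group (int n) (disk n) (disk_sphere n) \<cong> integer_group"
proof (cases n)
  case 0
  have "disk_sphere n = {}" by (auto simp: 0 disk_sphere_eq sqnorm_def)
  moreover have "homology_group 0 (disk n) \<cong> integer_group"
  proof (rule isomorphic_integer_zeroth_homology_group)
    show "path_connected_space (disk n)"
      by (rule contractible_imp_path_connected_space[OF contractible_disk])
    show "topspace (disk n) \<noteq> {}"
      using disk_interior_nonempty[of n] by (auto simp: disk_interior_def)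
  qed
  ultimately show ?thesis by (simp add: 0)
next
  case (Suc k)
  have eq: "subtopology (disk n) (disk_sphere n) = nsphere k"
  proof -
    have "{x. \<forall>i\<ge>n. x i = 0} \<inter> {x. (\<Sum>i<n. (x i)\<^sup>2) \<le> 1} \<inter> disk_sphere n
        = {x. \<forall>i\<ge>Suc k. x i = 0} \<inter> {x. (\<Sum>i\<le>k. (x i)\<^sup>2) = (1::real)}"
      by (auto simp: disk_sphere_eq sqnorm_def Suc lessThan_Suc_atMost)
    then show ?thesis
      by (simp add: disk_def nsphere_def Euclidean_space_def subtopology_subtopology Suc)
  qed
  have ne: "topspace (disk n) \<inter> disk_sphere n \<noteq> {}"
    using nonempty_nsphere[of k] unfolding eq[symmetric]
    by (metis topspace_subtopology null_topspace_iff_trivial)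
  have "relative_homology_group (int n) (disk n) (disk_sphere n)
      \<cong> reduced_homology_group (int n - 1) (nsphere k)"
    using iso_relative_homology_of_contractible[OF contractible_disk ne, of "int n"]
    by (auto simp: is_iso_def eq)
  also have "\<dots> \<cong> integer_group"
    using reduced_homology_group_nsphere(1)[of k] by (simp add: Suc)
  finally (iso_trans) show ?thesis .
qed

lemma disk_class:
  fixes n :: nat
  defines "G \<equiv> relative_homology_group (int n) (disk n) (disk_sphere n)"
  shows disk_class_carrier: "disk_class n \<in> carrier G"
    and disk_class_generates: "\<And>c. c \<in> carrier G \<Longrightarrow> \<exists>k::int. c = disk_class n [^]\<^bsub>G\<^esub> k"
    and disk_class_order: "\<And>k::int. disk_class n [^]\<^bsub>G\<^esub> k = \<one>\<^bsub>G\<^esub> \<Longrightarrow> k = 0"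
proof -
  have iso: "G \<cong> integer_group" unfolding G_def by (rule disk_homology_cyclic)
  interpret group G by (simp add: G_def)
  have "cyclic_group G"
    using isomorphic_group_cyclicity[OF iso] by (simp add: group_axioms)
  then have "\<exists>g. g \<in> carrier G \<and> subgroup_generated G {g} = G" by (auto simp: cyclic_group_def)
  then have "disk_class n \<in> carrier G \<and> subgroup_generated G {disk_class n} = G"
    unfolding disk_class_def Let_def G_def by (rule someI_ex)
  then have c: "disk_class n \<in> carrier G" and g: "subgroup_generated G {disk_class n} = G" by auto
  show "disk_class n \<in> carrier G" by (rule c)
  show "\<exists>k::int. x = disk_class n [^]\<^bsub>G\<^esub> k" if "x \<in> carrier G" for x
    using that carrier_subgroup_generated_by_singleton[OF c] g by auto
  have "infinite (carrier G)"
  proof -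
    obtain h where "bij_betw h (carrier G) (UNIV :: int set)"
      using iso by (auto simp: is_iso_def iso_def)
    then show ?thesis using bij_betw_finite infinite_UNIV_int by blast
  qed
  then show "k = 0" if "disk_class n [^]\<^bsub>G\<^esub> k = \<one>\<^bsub>G\<^esub>" for k :: int
    using finite_cyclic_subgroup_int[OF c] that g by auto
qed

section \<open>Integer combinations in an abelian group\<close>

text \<open>Homology groups are written multiplicatively, so coefficients appear as exponents.\<close>

definition combination :: "('g, 'm) monoid_scheme \<Rightarrow> ('c \<Rightarrow> 'g) \<Rightarrow> 'c set \<Rightarrow> ('c \<Rightarrow> int) \<Rightarrow> 'g" where
  "combination G \<gamma> I m = finprod G (\<lambda>s. \<gamma> s [^]\<^bsub>G\<^esub> m s) I"

context comm_group begin

lemma combination_closed: "\<gamma> \<in> I \<rightarrow> carrier G \<Longrightarrow> combination G \<gamma> I m \<in> carrier G"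
  unfolding combination_def by (intro finprod_closed) auto

lemma combination_insert:
  assumes "finite I" "s \<notin> I" "\<gamma> \<in> insert s I \<rightarrow> carrier G"
  shows "combination G \<gamma> (insert s I) m = \<gamma> s [^] m s \<otimes> combination G \<gamma> I m"
  using assms unfolding combination_def by (subst finprod_insert) auto

lemma combination_empty [simp]: "combination G \<gamma> {} m = \<one>"
  by (simp add: combination_def)

lemma combination_add:
  assumes "\<gamma> \<in> I \<rightarrow> carrier G"
  shows "combination G \<gamma> I (\<lambda>s. m s + k s) = combination G \<gamma> I m \<otimes> combination G \<gamma> I k"
  unfolding combination_def
proof (subst finprod_multf[symmetric])
  show "(\<Otimes>s\<in>I. \<gamma> s [^] (m s + k s)) = (\<Otimes>s\<in>I. \<gamma> s [^] m s \<otimes> \<gamma> s [^] k s)"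
    using assms by (intro finprod_cong') (auto simp: int_pow_mult Pi_iff)
qed (use assms in auto)

lemma combination_cong:
  "(\<And>s. s \<in> I \<Longrightarrow> \<gamma> s = \<gamma>' s) \<Longrightarrow> (\<And>s. s \<in> I \<Longrightarrow> m s = m' s) \<Longrightarrow> \<gamma>' \<in> I \<rightarrow> carrier G \<Longrightarrow>
    combination G \<gamma> I m = combination G \<gamma>' I m'"
  unfolding combination_def by (intro finprod_cong') auto

lemma combination_hom:
  assumes H: "comm_group H" and h: "h \<in> hom G H" and "finite I" "\<gamma> \<in> I \<rightarrow> carrier G"
  shows "h (combination G \<gamma> I m) = combination H (\<lambda>s. h (\<gamma> s)) I m"
proof -
  interpret H: comm_group H by (rule H)
  interpret hom: group_hom G H h by unfold_locales (rule h)
  from assms(3,4) show ?thesis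
  proof (induction I)
    case (insert s I)
    then have c: "(\<lambda>s. h (\<gamma> s)) \<in> insert s I \<rightarrow> carrier H" by (auto intro!: hom.hom_closed)
    show ?case
      using insert
      by (simp add: combination_insert H.combination_insert[OF insert.hyps(1,2) c] combination_closed hom.hom_int_pow)
  qed simp
qed

lemma combination_scale:
  assumes "finite I" "\<gamma> \<in> I \<rightarrow> carrier G"
  shows "combination G \<gamma> I (\<lambda>s. k * m s) = combination G \<gamma> I m [^] k"
  using assms
proof (induction I)
  case (insert s I)
  then show ?case
    by (simp add: combination_insert combination_closed int_pow_distrib int_pow_pow mult.commute)
qed simp

lemma combination_combination:
  assumes "finite I" "finite J" "\<gamma> \<in> J \<rightarrow> carrier G"
  shows "combination G (\<lambda>b. combination G \<gamma> J (a b)) I m = combination G \<gamma> J (\<lambda>f. \<Sum>b\<in>I. m b * a b f)"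
  using assms(1)
proof (induction I)
  case empty
  have "combination G \<gamma> J (\<lambda>f. 0 * 0) = combination G \<gamma> J (\<lambda>f. 0) [^] (0::int)"
    using assms by (intro combination_scale) auto
  then show ?case by simp
next
  case (insert s I)
  have "(\<lambda>b. combination G \<gamma> J (a b)) \<in> insert s I \<rightarrow> carrier G"
    using assms combination_closed by blast
  then show ?case
    using insert assms by (simp add: combination_insert combination_add combination_scale)
qed

end

section \<open>Skeleta of a finite CW complex\<close>

locale finite_cw =
  fixes X :: "('a, 'c) cw"
  assumes cw: "finite_cw_complex X"
begin

lemma Hausdorff: "Hausdorff_space (cw_top X)"
  and cells_negative: "n < 0 \<Longrightarrow> cw_cells X n = {}"
  and topspace_cells: "topspace (cw_top X) = (\<Union>n. \<Union>s\<in>cw_cells X n. open_cell X n s)"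
  using cw by (simp_all add: finite_cw_complex_def)

lemma open_cells_disjoint:
  assumes "s \<in> cw_cells X m" "t \<in> cw_cells X n" "(m, s) \<noteq> (n, t)"
  shows "open_cell X m s \<inter> open_cell X n t = {}"
proof -
  have "\<forall>m n. \<forall>s\<in>cw_cells X m. \<forall>t\<in>cw_cells X n.
        (m, s) \<noteq> (n, t) \<longrightarrow> disjnt (open_cell X m s) (open_cell X n t)"
    using cw unfolding finite_cw_complex_def by (elim conjE)
  then show ?thesis using assms unfolding disjnt_def by blast
qed

lemma
  assumes "s \<in> cw_cells X n"
  shows char_continuous: "continuous_map (disk (nat n)) (cw_top X) (cw_char X n s)"
    and char_homeo: "homeomorphic_map (subtopology (disk (nat n)) (disk_interior (nat n)))
          (subtopology (cw_top X) (open_cell X n s)) (cw_char X n s)"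
    and char_sphere: "cw_char X n s ` disk_sphere (nat n) \<subseteq> skeleton X (n - 1)"
proof -
  have "\<forall>n. \<forall>s\<in>cw_cells X n.
        continuous_map (disk (nat n)) (cw_top X) (cw_char X n s) \<and>
        homeomorphic_map (subtopology (disk (nat n)) (disk_interior (nat n)))
          (subtopology (cw_top X) (open_cell X n s)) (cw_char X n s) \<and>
        cw_char X n s ` disk_sphere (nat n) \<subseteq> skeleton X (n - 1)"
    using cw unfolding finite_cw_complex_def by (elim conjE)
  then show "continuous_map (disk (nat n)) (cw_top X) (cw_char X n s)"
    "homeomorphic_map (subtopology (disk (nat n)) (disk_interior (nat n)))
          (subtopology (cw_top X) (open_cell X n s)) (cw_char X n s)"
    "cw_char X n s ` disk_sphere (nat n) \<subseteq> skeleton X (n - 1)"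
    using assms by simp_all
qed

lemma finite_cells: "finite (cw_cells X n)"
proof -
  have "finite (SIGMA n:UNIV. cw_cells X n)" using cw by (simp add: finite_cw_complex_def)
  moreover have "Pair n ` cw_cells X n \<subseteq> (SIGMA n:UNIV. cw_cells X n)" by auto
  ultimately have "finite (Pair n ` cw_cells X n)" using finite_subset by blast
  then show ?thesis by (rule finite_imageD) (auto simp: inj_on_def)
qed

lemma open_cell_nonempty: "open_cell X n s \<noteq> {}"
  by (simp add: open_cell_def disk_interior_nonempty)

lemma open_cell_subset: "s \<in> cw_cells X n \<Longrightarrow> open_cell X n s \<subseteq> topspace (cw_top X)"
  unfolding topspace_cells by blast

lemma open_cell_skeleton_disjoint:
  "s \<in> cw_cells X n \<Longrightarrow> m < n \<Longrightarrow> open_cell X n s \<inter> skeleton X m = {}"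
proof -
  assume s: "s \<in> cw_cells X n" and m: "m < n"
  have "open_cell X n s \<inter> open_cell X k t = {}" if "k \<le> m" "t \<in> cw_cells X k" for k t
    using that s m by (intro open_cells_disjoint) auto
  then show ?thesis unfolding skeleton_def by blast
qed

lemma skeleton_subset: "skeleton X n \<subseteq> topspace (cw_top X)"
  unfolding skeleton_def topspace_cells by blast

lemma skeleton_negative: "n < 0 \<Longrightarrow> skeleton X n = {}"
  unfolding skeleton_def using cells_negative by force

lemma skeleton_mono: "m \<le> n \<Longrightarrow> skeleton X m \<subseteq> skeleton X n"
  unfolding skeleton_def by force

text \<open>These sets are the stages by which the cells are attached one after the other, and at the same
  time the subcomplexes among which trees and co-trees are found.\<close>

definition partial_skeleton :: "int \<Rightarrow> 'c set \<Rightarrow> 'a set" where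
  "partial_skeleton n F = skeleton X (n - 1) \<union> (\<Union>s\<in>F. open_cell X n s)"

lemma partial_skeleton_full: "partial_skeleton n (cw_cells X n) = skeleton X n"
proof -
  have "{..n} = insert n {..n - 1}" by auto
  then show ?thesis unfolding partial_skeleton_def skeleton_def by auto
qed

lemma partial_skeleton_empty [simp]: "partial_skeleton n {} = skeleton X (n - 1)"
  by (simp add: partial_skeleton_def)

lemma partial_skeleton_mono: "F \<subseteq> F' \<Longrightarrow> partial_skeleton n F \<subseteq> partial_skeleton n F'"
  unfolding partial_skeleton_def by blast

lemma skeleton_subset_partial: "skeleton X (n - 1) \<subseteq> partial_skeleton n F"
  unfolding partial_skeleton_def by blast

lemma partial_skeleton_subset: "F \<subseteq> cw_cells X n \<Longrightarrow> partial_skeleton n F \<subseteq> topspace (cw_top X)"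
  unfolding partial_skeleton_def using skeleton_subset open_cell_subset by blast

lemma topspace_disk_split: "topspace (disk k) = disk_interior k \<union> disk_sphere k"
  using disk_sphere_subset[of k] by (auto simp: disk_interior_def)

lemma char_image_partial:
  assumes "s \<in> F" "F \<subseteq> cw_cells X n"
  shows "cw_char X n s ` topspace (disk (nat n)) \<subseteq> partial_skeleton n F"
  using char_sphere[of s n] assms unfolding topspace_disk_split partial_skeleton_def open_cell_def
  by blast

text \<open>Adding the open cells has the same effect as adding the images of the closed disks, and these
  are finitely many compact sets.\<close>

lemma closedin_partial_step:
  assumes F: "F \<subseteq> cw_cells X n" and sk: "closedin (cw_top X) (skeleton X (n - 1))"
  shows "closedin (cw_top X) (partial_skeleton n F)"
proof -
  have "partial_skeleton n F = skeleton X (n - 1) \<union> (\<Union>s\<in>F. cw_char X n s ` topspace (disk (nat n)))"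
  proof
    show "partial_skeleton n F \<subseteq> skeleton X (n - 1) \<union> (\<Union>s\<in>F. cw_char X n s ` topspace (disk (nat n)))"
      unfolding partial_skeleton_def open_cell_def topspace_disk_split by blast
    show "skeleton X (n - 1) \<union> (\<Union>s\<in>F. cw_char X n s ` topspace (disk (nat n))) \<subseteq> partial_skeleton n F"
      using char_image_partial[OF _ F] skeleton_subset_partial by blast
  qed
  moreover have "closedin (cw_top X) (\<Union>s\<in>F. cw_char X n s ` topspace (disk (nat n)))"
  proof (rule closedin_Union)
    show "finite ((\<lambda>s. cw_char X n s ` topspace (disk (nat n))) ` F)"
      using F finite_cells finite_subset by blast
    show "closedin (cw_top X) S" if "S \<in> (\<lambda>s. cw_char X n s ` topspace (disk (nat n))) ` F" for S
      using that F char_continuous compact_space_disk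
      by (auto intro!: compactin_imp_closedin[OF Hausdorff] image_compactin simp: compact_space_def)
  qed
  ultimately show ?thesis using sk by (simp add: closedin_Un)
qed

lemma closedin_skeleton: "closedin (cw_top X) (skeleton X n)"
proof (cases "n < 0")
  case True then show ?thesis by (simp add: skeleton_negative)
next
  case False
  have "closedin (cw_top X) (skeleton X (int k - 1))" for k
  proof (induction k)
    case (Suc k)
    then show ?case
      using closedin_partial_step[of "cw_cells X (int k)" "int k"] by (simp add: partial_skeleton_full)
  qed (simp add: skeleton_negative)
  from this[of "nat n + 1"] show ?thesis using False by simp
qed

lemma closedin_partial_skeleton:
  "F \<subseteq> cw_cells X n \<Longrightarrow> closedin (cw_top X) (partial_skeleton n F)"
  by (rule closedin_partial_step[OF _ closedin_skeleton])

lemma open_cell_partial_disjoint: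
  assumes "s \<in> cw_cells X n" "F \<subseteq> cw_cells X n" "s \<notin> F"
  shows "open_cell X n s \<inter> partial_skeleton n F = {}"
proof -
  have "open_cell X n s \<inter> open_cell X n t = {}" if "t \<in> F" for t
    using that assms by (intro open_cells_disjoint) auto
  then show ?thesis
    using open_cell_skeleton_disjoint[OF assms(1), of "n - 1"] unfolding partial_skeleton_def by auto
qed

abbreviation stage :: "int \<Rightarrow> 'c set \<Rightarrow> 'a topology" where
  "stage n F \<equiv> subtopology (cw_top X) (partial_skeleton n F)"

lemma topspace_stage: "F \<subseteq> cw_cells X n \<Longrightarrow> topspace (stage n F) = partial_skeleton n F"
  using partial_skeleton_subset by (simp add: Int_absorb1)

text \<open>Cells can be attached in any order; in particular every \<open>n\<close>-cell can be regarded as the last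
  one.\<close>

lemma cell_attachment_stage:
  assumes s: "s \<in> cw_cells X n" "s \<notin> F" and F: "F \<subseteq> cw_cells X n"
  shows "cell_attachment (stage n (insert s F)) (partial_skeleton n F) (nat n) (cw_char X n s)"
proof
  have sub: "insert s F \<subseteq> cw_cells X n" using s F by blast
  show "Hausdorff_space (stage n (insert s F))"
    by (rule Hausdorff_space_subtopology[OF Hausdorff])
  show "closedin (stage n (insert s F)) (partial_skeleton n F)"
    by (rule closedin_subset_topspace[OF closedin_partial_skeleton[OF F]])
      (intro partial_skeleton_mono subset_insertI)
  show "continuous_map (disk (nat n)) (stage n (insert s F)) (cw_char X n s)"
    using char_continuous[OF s(1)] char_image_partial[OF _ sub, of s]
    by (simp add: continuous_map_in_subtopology image_subset_iff_funcset)
  show "cw_char X n s ` disk_sphere (nat n) \<subseteq> partial_skeleton n F"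
    using char_sphere[OF s(1)] skeleton_subset_partial by blast
  have "partial_skeleton n (insert s F) - partial_skeleton n F = open_cell X n s"
    using open_cell_partial_disjoint[OF s(1) F s(2)] unfolding partial_skeleton_def by blast
  then have "subtopology (stage n (insert s F)) (topspace (stage n (insert s F)) - partial_skeleton n F)
      = subtopology (cw_top X) (open_cell X n s)"
    using open_cell_subset[OF s(1)] topspace_stage[OF sub]
    by (simp add: subtopology_subtopology) (metis Int_absorb1 Un_upper2 Diff_subset)
  then show "homeomorphic_map (subtopology (disk (nat n)) (disk_interior (nat n)))
     (subtopology (stage n (insert s F)) (topspace (stage n (insert s F)) - partial_skeleton n F))
     (cw_char X n s)"
    using char_homeo[OF s(1)] by simp
qed

section \<open>The cells are a basis of the cellular chain group\<close>

lemma stage_subtopology: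
  "F \<subseteq> F' \<Longrightarrow> subtopology (stage n F') (partial_skeleton n F) = stage n F"
  using partial_skeleton_mono by (simp add: subtopology_subtopology Int_absorb1)

abbreviation stage_group :: "int \<Rightarrow> 'c set \<Rightarrow> 'a chain set monoid" where
  "stage_group n F \<equiv> relative_homology_group n (stage n F) (skeleton X (n - 1))"

abbreviation stage_class :: "int \<Rightarrow> 'c set \<Rightarrow> 'c \<Rightarrow> 'a chain set" where
  "stage_class n F s \<equiv> hom_induced n (disk (nat n)) (disk_sphere (nat n))
     (stage n F) (skeleton X (n - 1)) (cw_char X n s) (disk_class (nat n))"

lemma stage_class_full: "stage_class n (cw_cells X n) s = cell_class X n s"
  by (simp add: cell_class_def partial_skeleton_full)

lemma stage_group_full: "stage_group n (cw_cells X n) = cellular_group X n"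
  by (simp add: cellular_group_def partial_skeleton_full)

lemma comm_group_stage: "comm_group (stage_group n F)"
  by simp

lemma stage_class_closed: "stage_class n F s \<in> carrier (stage_group n F)"
  by (rule hom_induced_carrier)

lemma char_stage:
  "s \<in> F \<Longrightarrow> F \<subseteq> cw_cells X n \<Longrightarrow> continuous_map (disk (nat n)) (stage n F) (cw_char X n s)"
  using char_continuous[of s n] char_image_partial[of s F n]
  by (auto simp: continuous_map_in_subtopology image_subset_iff_funcset)

lemma stage_class_inclusion:
  assumes "s \<in> F" "F \<subseteq> F'" "F' \<subseteq> cw_cells X n" "skeleton X (n - 1) \<subseteq> P"
  shows "hom_induced n (stage n F) (skeleton X (n - 1)) (stage n F') P id (stage_class n F s)
       = hom_induced n (disk (nat n)) (disk_sphere (nat n)) (stage n F') P (cw_char X n s) (disk_class (nat n))"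
proof -
  have "F \<subseteq> cw_cells X n" using assms by blast
  moreover have "partial_skeleton n F \<subseteq> partial_skeleton n F'"
    using assms(2) by (rule partial_skeleton_mono)
  ultimately show ?thesis
    using assms char_stage[of s F n] char_sphere[of s n]
    by (subst hom_induced_compose') (auto simp: continuous_map_in_subtopology)
qed

text \<open>Induction on the number of attached cells. If \<open>s\<close> is the last cell, \<open>characteristic_map_iso\<close>
  shows that modulo the previous stage every class is a multiple of the class of \<open>s\<close>. Subtracting
  this multiple leaves a class that comes from the previous stage, by exactness of the sequence of
  the triple.\<close>

lemma stage_generated:
  assumes "0 \<le> n" "F \<subseteq> cw_cells X n" "c \<in> carrier (stage_group n F)"
  shows "\<exists>m. c = combination (stage_group n F) (stage_class n F) F m"
proof -
  have "finite F" using assms(2) finite_cells finite_subset by blast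
  then show ?thesis using assms(2,3)
  proof (induction F arbitrary: c)
    case empty
    interpret comm_group "stage_group n {}" by (rule comm_group_stage)
    have "trivial_group (stage_group n {})"
      using trivial_relative_homology_group_topspace[of n "stage n {}"]
      by (simp add: Int_absorb1 skeleton_subset)
    then have "c = \<one>\<^bsub>stage_group n {}\<^esub>" using empty by (simp add: trivial_group_def)
    then show ?case by (simp only: combination_empty simp_thms)
  next
    case (insert s F)
    let ?F = "insert s F" and ?A = "skeleton X (n - 1)"
    have s: "s \<in> cw_cells X n" and F: "F \<subseteq> cw_cells X n" using insert.prems by auto
    interpret G: comm_group "stage_group n ?F" by (rule comm_group_stage)
    interpret GF: comm_group "stage_group n F" by (rule comm_group_stage)
    interpret att: cell_attachment "stage n ?F" "partial_skeleton n F" "nat n" "cw_char X n s"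
      using s insert.hyps(2) F by (rule cell_attachment_stage)
    let ?R = "relative_homology_group n (stage n ?F) (partial_skeleton n F)"
    let ?D = "relative_homology_group n (disk (nat n)) (disk_sphere (nat n))"
    let ?j = "hom_induced n (stage n ?F) ?A (stage n ?F) (partial_skeleton n F) id"
    let ?i = "hom_induced n (stage n F) ?A (stage n ?F) ?A id"
    let ?h = "hom_induced n (disk (nat n)) (disk_sphere (nat n)) (stage n ?F) (partial_skeleton n F)
      (cw_char X n s)"
    let ?g = "disk_class (nat n)"
    interpret j: group_hom "stage_group n ?F" ?R ?j
      by (intro group_hom.intro group_hom_axioms.intro) (simp_all add: hom_induced_hom)
    interpret h: group_hom ?D ?R ?h
      by (intro group_hom.intro group_hom_axioms.intro) (simp_all add: hom_induced_hom)
    have g: "?g \<in> carrier ?D" using disk_class_carrier[of "nat n"] assms(1) by simp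
    have js: "?j (stage_class n ?F s) = ?h ?g"
      using s F by (intro stage_class_inclusion) (auto simp: skeleton_subset_partial)
    have "?j c \<in> ?h ` carrier ?D"
      using att.characteristic_map_iso[of n] j.hom_closed[OF insert.prems(2)] by (auto simp: iso_def bij_betw_def)
    then obtain k where k: "?j c = ?h (?g [^]\<^bsub>?D\<^esub> (k::int))"
      using disk_class_generates[of _ "nat n"] assms(1) by auto
    then have jc: "?j c = ?j (stage_class n ?F s [^]\<^bsub>stage_group n ?F\<^esub> k)"
      using g js by (simp add: h.hom_int_pow j.hom_int_pow stage_class_closed)
    let ?u = "stage_class n ?F s [^]\<^bsub>stage_group n ?F\<^esub> k"
    have u: "?u \<in> carrier (stage_group n ?F)" using stage_class_closed by (rule G.int_pow_closed)
    have "?j (c \<otimes>\<^bsub>stage_group n ?F\<^esub> inv\<^bsub>stage_group n ?F\<^esub> ?u) = \<one>\<^bsub>?R\<^esub>"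
      using u insert.prems(2) jc by (simp add: j.hom_mult)
    then have "c \<otimes>\<^bsub>stage_group n ?F\<^esub> inv\<^bsub>stage_group n ?F\<^esub> ?u \<in> kernel (stage_group n ?F) ?R ?j"
      using u insert.prems(2) by (simp add: kernel_def)
    also have "\<dots> = ?i ` carrier (stage_group n F)"
      using homology_exactness_triple_3[of ?A "partial_skeleton n F" n "stage n ?F"]
      by (simp add: skeleton_subset_partial stage_subtopology subset_insertI)
    finally obtain e where e: "e \<in> carrier (stage_group n F)"
      "c \<otimes>\<^bsub>stage_group n ?F\<^esub> inv\<^bsub>stage_group n ?F\<^esub> ?u = ?i e" by blast
    obtain m where m: "e = combination (stage_group n F) (stage_class n F) F m"
      using insert.IH[OF F e(1)] by blast
    let ?m = "m(s := k)"
    have "?i e = combination (stage_group n ?F) (\<lambda>t. ?i (stage_class n F t)) F m"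
      unfolding m using insert.hyps(1) stage_class_closed
      by (intro GF.combination_hom comm_group_stage hom_induced_hom) auto
    also have "\<dots> = combination (stage_group n ?F) (stage_class n ?F) F ?m"
      using insert.hyps(2) insert.prems(1)
      by (intro G.combination_cong stage_class_inclusion) (auto simp: stage_class_closed)
    finally have "c = ?u \<otimes>\<^bsub>stage_group n ?F\<^esub> combination (stage_group n ?F) (stage_class n ?F) F ?m"
      using e(2) u insert.prems(2)
      by (metis G.inv_solve_right' G.m_comm G.m_closed G.inv_closed)
    also have "\<dots> = combination (stage_group n ?F) (stage_class n ?F) ?F ?m"
      using insert.hyps stage_class_closed by (subst G.combination_insert) auto
    finally show ?case by blast
  qed
qed

text \<open>Such a class factors through the homology of a space relative to itself.\<close>

lemma stage_class_trivial:
  assumes t: "t \<in> F" "F \<subseteq> F'" "F' \<subseteq> cw_cells X n"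
  shows "hom_induced n (disk (nat n)) (disk_sphere (nat n)) (stage n F') (partial_skeleton n F)
      (cw_char X n t) c = \<one>\<^bsub>relative_homology_group n (stage n F') (partial_skeleton n F)\<^esub>"
proof -
  let ?P = "partial_skeleton n F"
  let ?R = "relative_homology_group n (stage n F') ?P"
  let ?T = "relative_homology_group n (stage n F) ?P"
  have F: "F \<subseteq> cw_cells X n" using t by blast
  have "hom_induced n (disk (nat n)) (disk_sphere (nat n)) (stage n F') ?P (cw_char X n t) c
     = hom_induced n (stage n F) ?P (stage n F') ?P id
        (hom_induced n (disk (nat n)) (disk_sphere (nat n)) (stage n F) ?P (cw_char X n t) c)"
    using t F char_stage[OF t(1) F] char_image_partial[OF t(1) F] disk_sphere_subset[of "nat n"]
      partial_skeleton_mono[OF t(2), of n]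
    by (subst hom_induced_compose') (auto simp: continuous_map_in_subtopology)
  moreover have "hom_induced n (disk (nat n)) (disk_sphere (nat n)) (stage n F) ?P (cw_char X n t) c
      = \<one>\<^bsub>?T\<^esub>"
    using trivial_relative_homology_group_topspace[of n "stage n F"]
      hom_induced_carrier[of n "disk (nat n)" "disk_sphere (nat n)" "stage n F" ?P "cw_char X n t" c]
    by (simp add: Int_absorb1 partial_skeleton_subset[OF F] trivial_group_def)
  moreover have "hom_induced n (stage n F) ?P (stage n F') ?P id \<one>\<^bsub>?T\<^esub> = \<one>\<^bsub>?R\<^esub>"
    by (intro hom_one[OF hom_induced_hom]) simp_all
  ultimately show ?thesis by simp
qed

lemma cell_class_closed: "cell_class X n s \<in> carrier (cellular_group X n)"
  unfolding cell_class_def cellular_group_def by (rule hom_induced_carrier)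

lemma comm_group_cellular: "comm_group (cellular_group X n)"
  by (simp add: cellular_group_def)

lemma cellular_group_generated:
  "0 \<le> n \<Longrightarrow> c \<in> carrier (cellular_group X n) \<Longrightarrow>
    \<exists>m. c = combination (cellular_group X n) (cell_class X n) (cw_cells X n) m"
  using stage_generated[of n "cw_cells X n" c]
  unfolding stage_group_full stage_class_full by simp

text \<open>Passing to the homology relative to the complement of the cell \<open>s\<close> kills the classes of all
  other cells, while the class of \<open>s\<close> stays of infinite order by \<open>characteristic_map_iso\<close>.\<close>

lemma cellular_group_independent:
  assumes n: "0 \<le> n" and one: "combination (cellular_group X n) (cell_class X n) (cw_cells X n) m = \<one>\<^bsub>cellular_group X n\<^esub>"
    and s: "s \<in> cw_cells X n"
  shows "m s = 0"
proof -
  let ?I = "cw_cells X n" and ?G = "cellular_group X n"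
  let ?F = "?I - {s}"
  have ins: "insert s ?F = ?I" using s by blast
  interpret G: comm_group ?G by (rule comm_group_cellular)
  interpret att: cell_attachment "stage n ?I" "partial_skeleton n ?F" "nat n" "cw_char X n s"
    using cell_attachment_stage[of s n ?F] s ins by simp
  let ?R = "relative_homology_group n (stage n ?I) (partial_skeleton n ?F)"
  let ?D = "relative_homology_group n (disk (nat n)) (disk_sphere (nat n))"
  let ?j = "hom_induced n (stage n ?I) (skeleton X (n - 1)) (stage n ?I) (partial_skeleton n ?F) id"
  let ?h = "hom_induced n (disk (nat n)) (disk_sphere (nat n)) (stage n ?I) (partial_skeleton n ?F)
      (cw_char X n s)"
  let ?g = "disk_class (nat n)"
  interpret R: comm_group ?R by simp
  interpret D: comm_group ?D by simp
  have g: "?g \<in> carrier ?D" using disk_class_carrier[of "nat n"] n by simp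
  have hom: "?j \<in> hom ?G ?R" unfolding stage_group_full[symmetric] by (rule hom_induced_hom)
  interpret j: group_hom ?G ?R ?j by unfold_locales (rule hom)
  interpret h: group_hom ?D ?R ?h by unfold_locales (rule hom_induced_hom)
  have jt: "?j (cell_class X n t)
      = hom_induced n (disk (nat n)) (disk_sphere (nat n)) (stage n ?I) (partial_skeleton n ?F) (cw_char X n t) ?g"
    if "t \<in> ?I" for t
    unfolding stage_class_full[symmetric] using that
    by (intro stage_class_inclusion) (auto simp: skeleton_subset_partial)
  have j1: "?j (cell_class X n t) = \<one>\<^bsub>?R\<^esub>" if "t \<in> ?F" for t
    using that jt stage_class_trivial[of t ?F ?I n ?g] by auto
  have "\<one>\<^bsub>?R\<^esub> = ?j (combination ?G (cell_class X n) ?I m)"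
    unfolding one by (rule j.hom_one[symmetric])
  also have "\<dots> = combination ?R (\<lambda>t. ?j (cell_class X n t)) ?I m"
    using finite_cells cell_class_closed by (intro G.combination_hom hom) (auto simp: R.comm_group_axioms)
  also have "\<dots> = ?j (cell_class X n s) [^]\<^bsub>?R\<^esub> m s \<otimes>\<^bsub>?R\<^esub> combination ?R (\<lambda>t. ?j (cell_class X n t)) ?F m"
    using R.combination_insert[of ?F s "\<lambda>t. ?j (cell_class X n t)" m] finite_cells cell_class_closed
    unfolding ins by (auto intro!: j.hom_closed)
  also have "combination ?R (\<lambda>t. ?j (cell_class X n t)) ?F m = combination ?R (\<lambda>t. \<one>\<^bsub>?R\<^esub>) ?F m"
    by (intro R.combination_cong) (auto simp: j1)
  also have "\<dots> = \<one>\<^bsub>?R\<^esub>" by (simp add: combination_def)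
  also have "?j (cell_class X n s) [^]\<^bsub>?R\<^esub> m s \<otimes>\<^bsub>?R\<^esub> \<one>\<^bsub>?R\<^esub> = ?h (?g [^]\<^bsub>?D\<^esub> m s)"
    using g by (simp add: jt[OF s] h.hom_int_pow)
  finally have "?h (?g [^]\<^bsub>?D\<^esub> m s) = ?h \<one>\<^bsub>?D\<^esub>" by simp
  moreover have "inj_on ?h (carrier ?D)"
    using att.characteristic_map_iso[of n] by (auto simp: iso_def bij_betw_def)
  ultimately have "?g [^]\<^bsub>?D\<^esub> m s = \<one>\<^bsub>?D\<^esub>"
    using g by (meson inj_onD D.int_pow_closed D.one_closed)
  then show ?thesis using disk_class_order[of "nat n" "m s"] n by simp
qed

text \<open>Since the cells of dimension \<open>n - 1\<close> are a basis, the description that defines the incidence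
  numbers is satisfied by exactly one family of integers.\<close>

lemma cell_boundary:
  assumes n: "1 \<le> n" and b: "b \<in> cw_cells X n"
  shows "hom_relboundary n (subtopology (cw_top X) (skeleton X n)) (skeleton X (n - 1)) (skeleton X (n - 2))
          (cell_class X n b)
       = combination (cellular_group X (n - 1)) (cell_class X (n - 1)) (cw_cells X (n - 1)) (incidence X n b)"
proof -
  let ?G = "cellular_group X (n - 1)" and ?I = "cw_cells X (n - 1)" and ?\<gamma> = "cell_class X (n - 1)"
  let ?c = "hom_relboundary n (subtopology (cw_top X) (skeleton X n)) (skeleton X (n - 1)) (skeleton X (n - 2))
          (cell_class X n b)"
  interpret G: comm_group ?G by (rule comm_group_cellular)
  have \<gamma>: "?\<gamma> \<in> ?I \<rightarrow> carrier ?G" using cell_class_closed by blast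
  have "subtopology (subtopology (cw_top X) (skeleton X n)) (skeleton X (n - 1))
      = subtopology (cw_top X) (skeleton X (n - 1))"
    using skeleton_mono[of "n - 1" n] by (simp add: subtopology_subtopology Int_absorb1)
  then have "?c \<in> carrier ?G"
    using hom_relboundary[of n "subtopology (cw_top X) (skeleton X n)" "skeleton X (n - 1)" "skeleton X (n - 2)"]
    by (simp add: cellular_group_def)
  then obtain m where m: "?c = combination ?G ?\<gamma> ?I m"
    using cellular_group_generated[of "n - 1"] n by auto
  let ?P = "\<lambda>m::'c \<Rightarrow> int. (\<forall>f. f \<notin> ?I \<longrightarrow> m f = 0) \<and> ?c = finprod ?G (\<lambda>f. ?\<gamma> f [^]\<^bsub>?G\<^esub> m f) ?I"
  have "\<exists>!m. ?P m"
  proof (rule ex_ex1I)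
    have m': "combination ?G ?\<gamma> ?I m = combination ?G ?\<gamma> ?I (\<lambda>f. if f \<in> ?I then m f else 0)"
      by (intro G.combination_cong) (auto simp: \<gamma>)
    show "\<exists>m. ?P m"
    proof (rule exI)
      show "?P (\<lambda>f. if f \<in> ?I then m f else 0)" using m m' by (simp add: combination_def)
    qed
  next
    fix m1 m2 assume 1: "?P m1" and 2: "?P m2"
    have "combination ?G ?\<gamma> ?I (\<lambda>f. m1 f + (- 1) * m2 f) = combination ?G ?\<gamma> ?I m1 \<otimes>\<^bsub>?G\<^esub> combination ?G ?\<gamma> ?I m2 [^]\<^bsub>?G\<^esub> (-1::int)"
      using \<gamma> finite_cells by (simp only: G.combination_add G.combination_scale)
    also have "combination ?G ?\<gamma> ?I m2 = combination ?G ?\<gamma> ?I m1"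
      using 1 2 by (simp add: combination_def)
    also have "combination ?G ?\<gamma> ?I m1 \<otimes>\<^bsub>?G\<^esub> combination ?G ?\<gamma> ?I m1 [^]\<^bsub>?G\<^esub> (-1::int) = \<one>\<^bsub>?G\<^esub>"
      using G.combination_closed[OF \<gamma>] by (simp add: G.int_pow_neg)
    finally have "m1 f + (- 1) * m2 f = 0" if "f \<in> ?I" for f
      using cellular_group_independent[of "n - 1" "\<lambda>f. m1 f + (- 1) * m2 f" f] that n by simp
    then show "m1 = m2" using 1 2 by (intro ext) (metis add.right_neutral add_minus_cancel mult_minus1 add.commute)
  qed
  then have "?P (THE m. ?P m)" by (rule theI')
  then show ?thesis unfolding incidence_def Let_def combination_def by blast
qed

section \<open>The boundary of a boundary vanishes\<close>

text \<open>The composition passes through two consecutive maps in the exact sequence of the pair \<open>(S, T)\<close>.\<close>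

lemma hom_relboundary_twice:
  assumes "c \<in> carrier (relative_homology_group n Y S)" and TS: "T \<subseteq> S"
  shows "hom_relboundary (n - 1) (subtopology Y S) T U (hom_relboundary n Y S T c)
     = \<one>\<^bsub>relative_homology_group (n - 2) (subtopology Y T) U\<^esub>"
proof -
  let ?d = "hom_boundary n Y S c"
  have d: "?d \<in> carrier (homology_group (n - 1) (subtopology Y S))"
    by (rule hom_boundary_carrier)
  have ST: "subtopology (subtopology Y S) T = subtopology Y T"
    using TS by (simp add: subtopology_subtopology Int_absorb1)
  have "hom_boundary (n - 1) (subtopology Y S) T
      (hom_induced (n - 1) (subtopology Y S) {} (subtopology Y S) T id ?d)
      = \<one>\<^bsub>homology_group (n - 1 - 1) (subtopology (subtopology Y S) T)\<^esub>"
  proof -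
    have "hom_induced (n - 1) (subtopology Y S) {} (subtopology Y S) T id ?d
       \<in> kernel (relative_homology_group (n - 1) (subtopology Y S) T)
         (homology_group (n - 1 - 1) (subtopology (subtopology Y S) T))
         (hom_boundary (n - 1) (subtopology Y S) T)"
      using homology_exactness_axiom_1[of "n - 1" "subtopology Y S" T] d by auto
    then show ?thesis by (simp add: kernel_def)
  qed
  then have "hom_relboundary (n - 1) (subtopology Y S) T U (hom_relboundary n Y S T c)
    = hom_induced (n - 1 - 1) (subtopology Y T) {} (subtopology Y T) U id
        \<one>\<^bsub>homology_group (n - 1 - 1) (subtopology Y T)\<^esub>"
    by (simp add: hom_relboundary_def ST)
  also have "\<dots> = \<one>\<^bsub>relative_homology_group (n - 1 - 1) (subtopology Y T) U\<^esub>"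
    by (intro hom_one[OF hom_induced_hom]) simp_all
  finally show ?thesis by simp
qed

lemma incidence_incidence:
  assumes b: "b \<in> cw_cells X n" and g: "g \<in> cw_cells X (n - 2)"
  shows "(\<Sum>f\<in>cw_cells X (n - 1). incidence X n b f * incidence X (n - 1) f g) = 0"
proof -
  have n: "2 \<le> n" using g cells_negative[of "n - 2"] by force
  let ?G1 = "cellular_group X (n - 1)" and ?G2 = "cellular_group X (n - 2)"
  let ?I1 = "cw_cells X (n - 1)" and ?I2 = "cw_cells X (n - 2)"
  let ?\<gamma>1 = "cell_class X (n - 1)" and ?\<gamma>2 = "cell_class X (n - 2)"
  interpret G1: comm_group ?G1 by (rule comm_group_cellular)
  interpret G2: comm_group ?G2 by (rule comm_group_cellular)
  let ?Y = "subtopology (cw_top X) (skeleton X n)"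
  have sub: "subtopology ?Y (skeleton X m) = subtopology (cw_top X) (skeleton X m)" if "m \<le> n" for m
    using skeleton_mono[OF that] by (simp add: subtopology_subtopology Int_absorb1)
  have sub1: "subtopology (subtopology (cw_top X) (skeleton X (n - 1))) (skeleton X (n - 2))
     = subtopology (cw_top X) (skeleton X (n - 2))"
    using skeleton_mono[of "n - 2" "n - 1"] by (simp add: subtopology_subtopology Int_absorb1)
  let ?d = "hom_relboundary (n - 1) (subtopology (cw_top X) (skeleton X (n - 1))) (skeleton X (n - 2)) (skeleton X (n - 3))"
  have hom: "?d \<in> hom ?G1 ?G2"
    using group_homomorphism_hom_relboundary[of "n - 1" "subtopology (cw_top X) (skeleton X (n - 1))"
        "skeleton X (n - 2)" "skeleton X (n - 3)"]
    by (simp add: cellular_group_def sub1)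
  have "\<one>\<^bsub>?G2\<^esub> = ?d (hom_relboundary n ?Y (skeleton X (n - 1)) (skeleton X (n - 2)) (cell_class X n b))"
    using hom_relboundary_twice[of "cell_class X n b" n ?Y "skeleton X (n - 1)" "skeleton X (n - 2)" "skeleton X (n - 3)"]
      cell_class_closed[of n b] skeleton_mono[of "n - 2" "n - 1"]
    by (simp add: cellular_group_def sub)
  also have "\<dots> = ?d (combination ?G1 ?\<gamma>1 ?I1 (incidence X n b))"
    using cell_boundary[OF _ b] n by simp
  also have "\<dots> = combination ?G2 (\<lambda>f. ?d (?\<gamma>1 f)) ?I1 (incidence X n b)"
    using finite_cells cell_class_closed by (intro G1.combination_hom hom) (auto simp: G2.comm_group_axioms)
  also have "\<dots> = combination ?G2 (\<lambda>f. combination ?G2 ?\<gamma>2 ?I2 (incidence X (n - 1) f)) ?I1 (incidence X n b)"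
    using cell_boundary[of "n - 1"] n cell_class_closed
    by (intro G2.combination_cong) (auto intro!: G2.combination_closed)
  also have "\<dots> = combination ?G2 ?\<gamma>2 ?I2 (\<lambda>g. \<Sum>f\<in>?I1. incidence X n b f * incidence X (n - 1) f g)"
    using cell_class_closed finite_cells by (intro G2.combination_combination) auto
  finally show ?thesis
    using cellular_group_independent[of "n - 2" _ g] n g by auto
qed

end

section \<open>Coordinate complements of a subspace\<close>

definition supported :: "'c set \<Rightarrow> ('c \<Rightarrow> 'r::zero) set" where
  "supported T = {c. \<forall>s. s \<notin> T \<longrightarrow> c s = 0}"

definition unit_chain :: "'c \<Rightarrow> 'c \<Rightarrow> 'r::zero_neq_one" where
  "unit_chain t = (\<lambda>s. if s = t then 1 else 0)"

definition submod :: "('c \<Rightarrow> 'r::comm_ring_1) set \<Rightarrow> bool" where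
  "submod K \<longleftrightarrow> 0 \<in> K \<and> (\<forall>x\<in>K. \<forall>y\<in>K. x + y \<in> K) \<and> (\<forall>a. \<forall>x\<in>K. (\<lambda>s. a * x s) \<in> K)"

text \<open>In matroid language, \<open>T\<close> is a basis of the matroid represented by the vectors \<open>unit_chain t\<close>
  modulo \<open>K\<close>.\<close>

definition complements :: "('c \<Rightarrow> 'r::comm_ring_1) set \<Rightarrow> 'c set \<Rightarrow> 'c set \<Rightarrow> bool" where
  "complements K I T \<longleftrightarrow> T \<subseteq> I \<and> supported T \<inter> K \<subseteq> {0} \<and>
     (\<forall>c\<in>supported I. \<exists>u\<in>supported T. c - u \<in> K)"

text \<open>The projection along \<open>K\<close>. The description has a unique solution if \<open>T\<close> is a complement of \<open>K\<close> in
  the sense above, and the value is arbitrary otherwise.\<close>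

definition proj :: "('c \<Rightarrow> 'r::comm_ring_1) set \<Rightarrow> 'c set \<Rightarrow> ('c \<Rightarrow> 'r) \<Rightarrow> 'c \<Rightarrow> 'r" where
  "proj K T c = (THE u. u \<in> supported T \<and> c - u \<in> K)"

lemma supported_mono: "S \<subseteq> T \<Longrightarrow> supported S \<subseteq> supported T"
  by (auto simp: supported_def)

lemma submod_supported: "submod (supported T)"
  by (simp add: submod_def supported_def)

lemma unit_chain_supported: "unit_chain t \<in> supported T \<longleftrightarrow> t \<in> T"
  by (auto simp: supported_def unit_chain_def)

lemma submod_0: "submod K \<Longrightarrow> 0 \<in> K"
  and submod_add: "submod K \<Longrightarrow> x \<in> K \<Longrightarrow> y \<in> K \<Longrightarrow> x + y \<in> K"
  and submod_scale: "submod K \<Longrightarrow> x \<in> K \<Longrightarrow> (\<lambda>s. a * x s) \<in> K"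
  by (simp_all add: submod_def)

lemma submod_uminus: "submod K \<Longrightarrow> x \<in> K \<Longrightarrow> - x \<in> K"
  using submod_scale[of K x "- 1"] by (simp add: fun_Compl_def)

lemma submod_diff: "submod K \<Longrightarrow> x \<in> K \<Longrightarrow> y \<in> K \<Longrightarrow> x - y \<in> K"
  using submod_add[of K x "- y"] submod_uminus[of K y] by simp

lemma submod_sum: "submod K \<Longrightarrow> (\<And>i. i \<in> A \<Longrightarrow> f i \<in> K) \<Longrightarrow> sum f A \<in> K"
  by (induction A rule: infinite_finite_induct) (auto intro: submod_0 submod_add)

lemma sum_fun_apply: "(sum f A :: 'c \<Rightarrow> 'r::comm_monoid_add) s = (\<Sum>i\<in>A. f i s)"
  by (induction A rule: infinite_finite_induct) auto

lemma chain_expansion: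
  fixes c :: "'c \<Rightarrow> 'r::comm_ring_1"
  assumes "finite I" "c \<in> supported I"
  shows "c = (\<Sum>t\<in>I. (\<lambda>s. c t * unit_chain t s))"
proof
  fix s
  show "c s = (\<Sum>t\<in>I. (\<lambda>s. c t * unit_chain t s)) s"
  proof -
    have "(\<Sum>t\<in>I. c t * unit_chain t s) = (\<Sum>t\<in>I. if t = s then c s else 0)"
      by (rule sum.cong) (auto simp: unit_chain_def)
    then show ?thesis using assms by (simp add: sum_fun_apply supported_def)
  qed
qed

lemma proj_unique:
  assumes "submod K" "complements K I T" "u \<in> supported T" "c - u \<in> K"
  shows "proj K T c = u"
  unfolding proj_def
proof (rule the_equality)
  fix v assume v: "v \<in> supported T \<and> c - v \<in> K"
  have "v - u = (c - u) - (c - v)" by simp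
  also have "\<dots> \<in> K" using v by (intro submod_diff[OF assms(1,4)]) blast
  finally have "v - u \<in> supported T \<inter> K"
    using v assms submod_diff[OF submod_supported, of v T u] by auto
  then show "v = u" using assms(2) by (auto simp: complements_def)
qed (use assms in auto)

lemma
  assumes "submod K" "complements K I T" "c \<in> supported I"
  shows proj_supported: "proj K T c \<in> supported T" and proj_diff: "c - proj K T c \<in> K"
proof -
  obtain u where u: "u \<in> supported T" "c - u \<in> K"
    using assms by (auto simp: complements_def)
  have "proj K T c = u" using u assms by (intro proj_unique)
  then show "proj K T c \<in> supported T" "c - proj K T c \<in> K" using u by auto
qed

lemma proj_kernel: "submod K \<Longrightarrow> complements K I T \<Longrightarrow> z \<in> K \<Longrightarrow> proj K T z = 0"
  by (rule proj_unique) (auto simp: supported_def)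

lemma proj_expansion:
  assumes "finite I" "submod K" "complements K I T" "c \<in> supported I"
  shows "proj K T c s = (\<Sum>t\<in>I. c t * proj K T (unit_chain t) s)"
proof -
  have T: "unit_chain t \<in> supported I" if "t \<in> I" for t using that by (simp add: unit_chain_supported)
  let ?u = "\<Sum>t\<in>I. (\<lambda>s. c t * proj K T (unit_chain t) s)"
  have "?u \<in> supported T"
    using proj_supported[OF assms(2,3) T] by (intro submod_sum submod_supported submod_scale) auto
  moreover have "c - ?u = (\<Sum>t\<in>I. (\<lambda>s. c t * (unit_chain t - proj K T (unit_chain t)) s))"
    by (subst chain_expansion[OF assms(1,4)]) (simp add: fun_eq_iff sum_fun_apply sum_subtractf right_diff_distrib)
  moreover have "\<dots> \<in> K"
    by (intro submod_sum submod_scale assms(2) proj_diff[OF assms(2,3) T])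
  ultimately have "?u \<in> supported T" "c - ?u \<in> K" by (simp_all only:)
  then have "proj K T c = ?u" by (intro proj_unique[OF assms(2,3)])
  then show ?thesis by (simp add: sum_fun_apply)
qed

lemma proj_unit_in:
  assumes "submod K" "complements K I T" "t \<in> T"
  shows "proj K T (unit_chain t) = unit_chain t"
  using assms by (intro proj_unique) (auto simp: unit_chain_supported submod_0)

text \<open>The functional \<open>l\<close> vanishes on \<open>K\<close> and on the coordinates in \<open>S\<close>, which together span a
  hyperplane. A coordinate \<open>t\<close> completes \<open>S\<close> to a complement exactly if it lies outside of this
  hyperplane, and the coefficient at \<open>t\<close> of the projection is then measured by \<open>l\<close>.\<close>

lemma complements_exchange:
  fixes K :: "('c \<Rightarrow> 'r::field) set"
  assumes K: "submod K" and T0: "complements K I (insert t0 S)" and t0: "t0 \<notin> S"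
    and t: "t \<in> I" "t \<notin> S"
  defines "l \<equiv> \<lambda>c. proj K (insert t0 S) c t0"
  shows "complements K I (insert t S) \<longleftrightarrow> l (unit_chain t) \<noteq> 0" (is ?iff)
    and "complements K I (insert t S) \<Longrightarrow> c \<in> supported I \<Longrightarrow>
      proj K (insert t S) c t = l c / l (unit_chain t)"
proof -
  let ?A = "insert t0 S" and ?B = "insert t S"
  have et: "unit_chain t \<in> supported I" using t by (simp add: unit_chain_supported)
  define u where "u = proj K ?A (unit_chain t)"
  have u: "u \<in> supported ?A" "unit_chain t - u \<in> K"
    unfolding u_def using proj_supported[OF K T0 et] proj_diff[OF K T0 et] by auto
  have lu: "l (unit_chain t) = u t0" by (simp add: l_def u_def)
  have tt0: "u t = 1" if "t = t0"
    unfolding u_def using that proj_unit_in[OF K T0, of t] by (simp add: unit_chain_def)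
  have ut: "u t = 0" if "t \<noteq> t0" using u(1) t that by (simp add: supported_def)
  (* The only candidate for the projection of c to the new complement: the projection to
     the old one, with t0 eliminated by means of u - unit_chain t, which lies in K. *)
  define u' where "u' c = (\<lambda>s. proj K ?A c s - proj K ?A c t0 / u t0 * (u s - unit_chain t s))" for c
  have u': "u' c \<in> supported ?B" "c - u' c \<in> K" "u' c t = l c / u t0"
    if c: "c \<in> supported I" and "u t0 \<noteq> 0" for c
  proof -
    note p = proj_supported[OF K T0 c] proj_diff[OF K T0 c]
    show "u' c \<in> supported ?B"
      unfolding supported_def
    proof (intro CollectI allI impI)
      fix s assume "s \<notin> ?B"
      then show "u' c s = 0"
        using p(1) u(1) that(2) by (cases "s = t0") (auto simp: supported_def u'_def unit_chain_def)
    qed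
    have "c - u' c = (c - proj K ?A c) - (\<lambda>s. (proj K ?A c t0 / u t0) * (unit_chain t - u) s)"
      by (auto simp: fun_eq_iff u'_def algebra_simps add_divide_distrib diff_divide_distrib)
    also have "\<dots> \<in> K" by (rule submod_diff[OF K p(2) submod_scale[OF K u(2)]])
    finally show "c - u' c \<in> K" .
    show "u' c t = l c / u t0"
    proof (cases "t = t0")
      case True
      then show ?thesis using tt0 by (simp add: u'_def l_def unit_chain_def)
    next
      case False
      then have "proj K ?A c t = 0" using p(1) t by (simp add: supported_def)
      then show ?thesis using ut[OF False] by (simp add: u'_def l_def unit_chain_def)
    qed
  qed
  have onlyif: "u t0 \<noteq> 0" if T: "complements K I ?B"
  proof
    assume z: "u t0 = 0"
    then have uS: "u \<in> supported S" using u(1) by (auto simp: supported_def)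
    then have "unit_chain t - u \<in> supported ?B"
      using submod_diff[OF submod_supported, of "unit_chain t" ?B u] supported_mono[of S ?B]
      by (auto simp: unit_chain_supported)
    then have "unit_chain t - u = 0" using u(2) T by (auto simp: complements_def)
    then have "u t = 1" by (metis diff_eq_diff_eq diff_self eq_iff_diff_eq_0 unit_chain_def)
    then show False using uS t by (simp add: supported_def)
  qed
  have "if": "complements K I ?B" if nz: "u t0 \<noteq> 0"
    unfolding complements_def
  proof (intro conjI ballI)
    show "?B \<subseteq> I" using T0 t by (auto simp: complements_def)
    show "supported ?B \<inter> K \<subseteq> {0}"
    proof
      fix v assume v: "v \<in> supported ?B \<inter> K"
      define w where "w = (\<lambda>s. v s - v t * (unit_chain t - u) s)"
      have "w = v - (\<lambda>s. v t * (unit_chain t - u) s)" by (auto simp: w_def fun_eq_iff)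
      also have "\<dots> \<in> K" using v by (intro submod_diff[OF K _ submod_scale[OF K u(2)]]) blast
      finally have "w \<in> K" .
      moreover have "w \<in> supported ?A"
        using v u(1) unfolding w_def supported_def by (auto simp: unit_chain_def)
      ultimately have w0: "w = 0" using T0 by (auto simp: complements_def)
      have "w t0 = v t * u t0"
        using v t0 tt0 t by (cases "t = t0") (auto simp: w_def unit_chain_def supported_def)
      then have vt: "v t = 0" using w0 nz by simp
      then have "v = w" by (simp add: w_def)
      then show "v \<in> {0}" using w0 by simp
    qed
    fix c :: "'c \<Rightarrow> 'r" assume "c \<in> supported I"
    then show "\<exists>u\<in>supported ?B. c - u \<in> K" using u'[OF _ nz] by blast
  qed
  show ?iff using onlyif "if" lu by auto
  assume T: "complements K I ?B" and c: "c \<in> supported I"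
  have "proj K ?B c = u' c"
    using u'[OF c onlyif[OF T]] by (intro proj_unique[OF K T]) auto
  then show "proj K ?B c t = l c / l (unit_chain t)"
    using u'(3)[OF c onlyif[OF T]] lu by simp
qed

section \<open>The weighted average of the projections\<close>

text \<open>The sum runs over pairs of a complement \<open>T\<close> and a coordinate \<open>s \<in> T\<close>. The weight \<open>x s\<close> of the
  inner product cancels the factor \<open>y s\<close> of the weight of \<open>T\<close>, so that the remaining product
  depends on \<open>S = T - {s}\<close> only. Collecting the terms with a common \<open>S\<close> leaves, by
  \<open>complements_exchange\<close> and the compatibility of \<open>\<theta>\<close>, a multiple of \<open>l z\<close>, which vanishes because
  \<open>l\<close> vanishes on \<open>K\<close>. The compatibility assumption says that \<open>\<theta> (insert t S)\<close> is proportional to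
  the absolute value of \<open>l (unit_chain t)\<close>.\<close>

theorem averaged_projection_orthogonal:
  fixes K :: "('c \<Rightarrow> real) set" and \<theta> :: "'c set \<Rightarrow> real"
  assumes I: "finite I" and K: "submod K" "K \<subseteq> supported I"
    and xy: "\<And>s. s \<in> I \<Longrightarrow> x s * y s = 1"
    and compat: "\<And>S t t'. t \<in> I - S \<Longrightarrow> t' \<in> I - S \<Longrightarrow> complements K I (insert t S) \<Longrightarrow>
      complements K I (insert t' S) \<Longrightarrow>
      (\<theta> (insert t S))\<^sup>2 = (\<theta> (insert t' S))\<^sup>2 * (proj K (insert t' S) (unit_chain t) t')\<^sup>2"
    and c: "c \<in> supported I" and z: "z \<in> K"
  shows "(\<Sum>T | complements K I T. (\<theta> T)\<^sup>2 * (\<Prod>s\<in>T. y s) * (\<Sum>s\<in>I. x s * proj K T c s * z s)) = 0"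
proof -
  let ?\<B> = "{T. complements K I T}"
  have sub: "T \<subseteq> I" if "T \<in> ?\<B>" for T using that by (simp add: complements_def)
  have finB: "finite ?\<B>" using I sub by (auto intro: finite_subset[of _ "Pow I"])
  have finT: "finite T" if "T \<in> ?\<B>" for T using sub[OF that] I finite_subset by blast
  (* The contribution of the pair (T, s), after x s has cancelled y s. *)
  define g where "g = (\<lambda>(T, s). (\<theta> T)\<^sup>2 * (\<Prod>r\<in>T - {s}. y r) * proj K T c s * z s)"
  have "(\<theta> T)\<^sup>2 * (\<Prod>s\<in>T. y s) * (\<Sum>s\<in>I. x s * proj K T c s * z s) = (\<Sum>s\<in>T. g (T, s))"
    if T: "T \<in> ?\<B>" for T
  proof -
    have "(\<Sum>s\<in>I. x s * proj K T c s * z s) = (\<Sum>s\<in>T. x s * proj K T c s * z s)"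
      using sub[OF T] I proj_supported[OF K(1) _ c, of T] T
      by (intro sum.mono_neutral_right) (auto simp: supported_def)
    moreover have "(\<Prod>r\<in>T. y r) * x s = (\<Prod>r\<in>T - {s}. y r)" if "s \<in> T" for s
      using prod.remove[OF finT[OF T] that, of y] xy[of s] sub[OF T] that by (auto simp: algebra_simps)
    ultimately show ?thesis
      by (auto simp: sum_distrib_left g_def intro!: sum.cong)
  qed
  then have "(\<Sum>T\<in>?\<B>. (\<theta> T)\<^sup>2 * (\<Prod>s\<in>T. y s) * (\<Sum>s\<in>I. x s * proj K T c s * z s))
      = (\<Sum>T\<in>?\<B>. \<Sum>s\<in>T. g (T, s))" by (rule sum.cong[OF refl])
  also have "\<dots> = (\<Sum>p\<in>Sigma ?\<B> (\<lambda>T. T). g p)"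
    using finB finT by (subst sum.Sigma) (auto simp: case_prod_unfold)
  also have "\<dots> = (\<Sum>p\<in>(SIGMA S:(\<lambda>(T, s). T - {s}) ` Sigma ?\<B> (\<lambda>T. T). {t \<in> I - S. insert t S \<in> ?\<B>}).
      g (insert (snd p) (fst p), snd p))"
  proof (rule sum.reindex_bij_witness[of _ "\<lambda>(S, t). (insert t S, t)" "\<lambda>(T, s). (T - {s}, s)"])
    fix p assume "p \<in> Sigma ?\<B> (\<lambda>T. T)"
    then obtain T s where p: "p = (T, s)" "T \<in> ?\<B>" "s \<in> T" by auto
    then have "insert s (T - {s}) = T" by auto
    moreover have "T - {s} \<in> (\<lambda>(T, s). T - {s}) ` Sigma ?\<B> (\<lambda>T. T)"
      using p by (intro image_eqI[of _ _ "(T, s)"]) auto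
    ultimately show "(case case p of (T, s) \<Rightarrow> (T - {s}, s) of (S, t) \<Rightarrow> (insert t S, t)) = p"
      "(case p of (T, s) \<Rightarrow> (T - {s}, s)) \<in>
        (SIGMA S:(\<lambda>(T, s). T - {s}) ` Sigma ?\<B> (\<lambda>T. T). {t \<in> I - S. insert t S \<in> ?\<B>})"
      "g (insert (snd (case p of (T, s) \<Rightarrow> (T - {s}, s))) (fst (case p of (T, s) \<Rightarrow> (T - {s}, s))),
        snd (case p of (T, s) \<Rightarrow> (T - {s}, s))) = g p"
      using p sub by auto
  next
    fix q assume "q \<in> (SIGMA S:(\<lambda>(T, s). T - {s}) ` Sigma ?\<B> (\<lambda>T. T). {t \<in> I - S. insert t S \<in> ?\<B>})"
    then show "(case case q of (S, t) \<Rightarrow> (insert t S, t) of (T, s) \<Rightarrow> (T - {s}, s)) = q"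
      "(case q of (S, t) \<Rightarrow> (insert t S, t)) \<in> Sigma ?\<B> (\<lambda>T. T)"
      by auto
  qed
  also have "\<dots> = (\<Sum>S\<in>(\<lambda>(T, s). T - {s}) ` Sigma ?\<B> (\<lambda>T. T).
      \<Sum>t\<in>{t \<in> I - S. insert t S \<in> ?\<B>}. g (insert t S, t))"
    using finB finT I by (subst sum.Sigma) (auto simp: case_prod_unfold)
  also have "\<dots> = 0"
  proof (rule sum.neutral, rule ballI)
    fix S assume "S \<in> (\<lambda>(T, s). T - {s}) ` Sigma ?\<B> (\<lambda>T. T)"
    then obtain T t0 where T: "T \<in> ?\<B>" "t0 \<in> T" "S = T - {t0}" by auto
    have T0: "complements K I (insert t0 S)" and t0S: "t0 \<notin> S" and t0I: "t0 \<in> I"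
      using T sub insert_Diff[OF T(2)] by auto
    define l where "l c = proj K (insert t0 S) c t0" for c
    have ex: "insert t S \<in> ?\<B> \<longleftrightarrow> l (unit_chain t) \<noteq> 0" if "t \<in> I - S" for t
      using complements_exchange(1)[OF K(1) T0 t0S] that by (auto simp: l_def)
    have lS: "l (unit_chain t) = 0" if "t \<in> S" for t
      using proj_unit_in[OF K(1) T0, of t] that t0S by (auto simp: l_def unit_chain_def)
    let ?k = "(\<theta> (insert t0 S))\<^sup>2 * (\<Prod>r\<in>S. y r) * l c"
    have "(\<Sum>t\<in>{t \<in> I - S. insert t S \<in> ?\<B>}. g (insert t S, t))
        = (\<Sum>t\<in>{t \<in> I - S. insert t S \<in> ?\<B>}. ?k * (z t * l (unit_chain t)))"
    proof (rule sum.cong[OF refl])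
      fix t assume t: "t \<in> {t \<in> I - S. insert t S \<in> ?\<B>}"
      then have nz: "l (unit_chain t) \<noteq> 0" using ex by auto
      have p: "proj K (insert t S) c t = l c / l (unit_chain t)"
        using complements_exchange(2)[OF K(1) T0 t0S _ _ _ c] t by (auto simp: l_def)
      have th: "(\<theta> (insert t S))\<^sup>2 = (\<theta> (insert t0 S))\<^sup>2 * (l (unit_chain t))\<^sup>2"
        unfolding l_def using t t0I t0S T0 by (intro compat) auto
      have "insert t S - {t} = S" using t by auto
      then show "g (insert t S, t) = ?k * (z t * l (unit_chain t))"
        using nz by (simp add: g_def p th) (simp add: power2_eq_square)
    qed
    also have "\<dots> = ?k * (\<Sum>t\<in>{t \<in> I - S. insert t S \<in> ?\<B>}. z t * l (unit_chain t))"
      by (simp add: sum_distrib_left)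
    also have "(\<Sum>t\<in>{t \<in> I - S. insert t S \<in> ?\<B>}. z t * l (unit_chain t))
        = (\<Sum>t\<in>I. z t * l (unit_chain t))"
      using I ex lS by (intro sum.mono_neutral_left) auto
    also have "\<dots> = l z"
      unfolding l_def using proj_expansion[OF I K(1) T0, of z t0] K(2) z by auto
    also have "l z = 0"
      unfolding l_def using proj_kernel[OF K(1) T0 z] by simp
    finally show "(\<Sum>t\<in>{t \<in> I - S. insert t S \<in> ?\<B>}. g (insert t S, t)) = 0" by simp
  qed
  finally show ?thesis .
qed

lemma units_span:
  fixes K :: "('c \<Rightarrow> 'r::comm_ring_1) set"
  assumes I: "finite I" and K: "submod K"
    and unit: "\<And>t. t \<in> I \<Longrightarrow> \<exists>u\<in>supported T. unit_chain t - u \<in> K" and c: "c \<in> supported I"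
  shows "\<exists>u\<in>supported T. c - u \<in> K"
proof -
  obtain v where v: "v t \<in> supported T" "unit_chain t - v t \<in> K" if "t \<in> I" for t
    using unit by metis
  let ?u = "\<Sum>t\<in>I. (\<lambda>s. c t * v t s)"
  have "?u \<in> supported T"
    using v(1) by (intro submod_sum submod_supported submod_scale) auto
  moreover have "c - ?u = (\<Sum>t\<in>I. (\<lambda>s. c t * (unit_chain t - v t) s))"
    by (subst chain_expansion[OF I c]) (simp add: fun_eq_iff sum_fun_apply sum_subtractf right_diff_distrib)
  moreover have "\<dots> \<in> K"
    by (intro submod_sum submod_scale K v(2))
  ultimately show ?thesis by (intro bexI[of _ ?u]) (simp_all only:)
qed

text \<open>A maximal set of coordinates whose chains meet \<open>K\<close> only in 0 is a complement.\<close>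

lemma complement_exists:
  fixes K :: "('c \<Rightarrow> 'r::field) set"
  assumes I: "finite I" and K: "submod K"
  shows "\<exists>T. complements K I T"
proof -
  let ?P = "{T. T \<subseteq> I \<and> supported T \<inter> K \<subseteq> {0}}"
  have fin: "finite ?P" using I by (auto intro: finite_subset[of _ "Pow I"])
  have "{} \<in> ?P" by (auto simp: supported_def fun_eq_iff)
  then have "?P \<noteq> {}" by (metis empty_iff)
  from finite_has_maximal[OF fin this] obtain T
    where T: "T \<in> ?P" and max: "\<forall>T'\<in>?P. T \<subseteq> T' \<longrightarrow> T = T'" by (rule bexE)
  have unit: "\<exists>u\<in>supported T. unit_chain t - u \<in> K" if t: "t \<in> I" for t
  proof (cases "t \<in> T")
    case True
    then show ?thesis
      using K by (intro bexI[of _ "unit_chain t"]) (auto simp: unit_chain_supported submod_0)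
  next
    case False
    then have "insert t T \<notin> ?P" using max by blast
    then obtain v where v: "v \<in> supported (insert t T)" "v \<in> K" "v \<noteq> 0" using T t by auto
    have vt: "v t \<noteq> 0"
    proof
      assume "v t = 0"
      then have "v \<in> supported T" using v(1) by (auto simp: supported_def)
      then show False using T v by auto
    qed
    let ?u = "\<lambda>s. unit_chain t s - v s / v t"
    have "?u \<in> supported T" using v(1) vt by (auto simp: supported_def unit_chain_def)
    moreover have "unit_chain t - ?u = (\<lambda>s. (1 / v t) * v s)" by (auto simp: fun_eq_iff)
    then have "unit_chain t - ?u \<in> K" using submod_scale[OF K v(2), of "1 / v t"] by simp
    ultimately show ?thesis by blast
  qed
  have "\<exists>u\<in>supported T. c - u \<in> K" if c: "c \<in> supported I" for c
    using units_span[of I K T c] I K unit c by blast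
  moreover have "T \<subseteq> I" "supported T \<inter> K \<subseteq> {0}" using T by simp_all
  ultimately have "complements K I T" by (simp add: complements_def)
  then show ?thesis ..
qed

section \<open>Indices of lattices\<close>

definition multiples_added :: "('c \<Rightarrow> int) set \<Rightarrow> ('c \<Rightarrow> int) \<Rightarrow> ('c \<Rightarrow> int) set" where
  "multiples_added N a = {x + (\<lambda>s. k * a s) | x k. x \<in> N}"

text \<open>For a group \<open>\<Lambda>\<close> the value 0 stands for infinitely many cosets, so positivity of an index
  expresses its finiteness.\<close>

definition index :: "('c \<Rightarrow> int) set \<Rightarrow> ('c \<Rightarrow> int) set \<Rightarrow> nat" where
  "index \<Lambda> N = card (coset N ` \<Lambda>)"

lemma coset_altdef: "coset B z = {b + z | b. b \<in> B}"
  by (simp add: coset_def plus_fun_def)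

lemma in_coset_iff: "x \<in> coset B z \<longleftrightarrow> x - z \<in> B"
proof
  assume "x - z \<in> B"
  moreover have "x = (x - z) + z" by simp
  ultimately show "x \<in> coset B z" unfolding coset_altdef by blast
qed (auto simp: coset_altdef)

lemma coset_eq_iff:
  assumes "submod B" shows "coset B x = coset B y \<longleftrightarrow> x - y \<in> B"
proof
  assume "coset B x = coset B y"
  moreover have "x \<in> coset B x" using submod_0[OF assms] by (simp add: in_coset_iff)
  ultimately show "x - y \<in> B" by (simp add: in_coset_iff)
next
  assume d: "x - y \<in> B"
  have "z - x \<in> B \<longleftrightarrow> z - y \<in> B" for z
  proof
    assume "z - x \<in> B"
    from submod_add[OF assms this d] show "z - y \<in> B" by simp
  next
    assume "z - y \<in> B"
    from submod_diff[OF assms this d] show "z - x \<in> B" by simp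
  qed
  then show "coset B x = coset B y" by (simp add: set_eq_iff in_coset_iff)
qed

lemma submod_multiples_added:
  assumes "submod N" shows "submod (multiples_added N a)"
  unfolding submod_def
proof (intro conjI ballI allI)
  show "0 \<in> multiples_added N a"
    unfolding multiples_added_def
    by (rule CollectI, rule exI[of _ 0], rule exI[of _ 0]) (auto simp: submod_0[OF assms] fun_eq_iff)
next
  fix x y assume "x \<in> multiples_added N a" "y \<in> multiples_added N a"
  then obtain n k m j where *: "n \<in> N" "m \<in> N" "x = n + (\<lambda>s. k * a s)" "y = m + (\<lambda>s. j * a s)"
    unfolding multiples_added_def by blast
  have "x + y = (n + m) + (\<lambda>s. (k + j) * a s)" by (auto simp: * fun_eq_iff algebra_simps)
  then show "x + y \<in> multiples_added N a"
    using submod_add[OF assms *(1,2)] unfolding multiples_added_def by blast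
next
  fix r x assume "x \<in> multiples_added N a"
  then obtain n k where *: "n \<in> N" "x = n + (\<lambda>s. k * a s)"
    unfolding multiples_added_def by blast
  have "(\<lambda>s. r * x s) = (\<lambda>s. r * n s) + (\<lambda>s. (r * k) * a s)" by (auto simp: * fun_eq_iff algebra_simps)
  then show "(\<lambda>s. r * x s) \<in> multiples_added N a"
    using submod_scale[OF assms *(1)] unfolding multiples_added_def by blast
qed

text \<open>A coset of \<open>N + \<int> a\<close> splits into the \<open>k\<close> cosets of \<open>N + \<int> k a\<close> that are represented by \<open>r, r +
  a, \<dots>, r + (k - 1) a\<close>.\<close>

lemma index_multiple:
  fixes k :: nat
  assumes L: "submod \<Lambda>" and N: "submod N" and a: "a \<in> \<Lambda>" and k: "k > 0"
    and free: "\<And>j. j \<noteq> 0 \<Longrightarrow> (\<lambda>s. j * a s) \<notin> N"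
  shows "index \<Lambda> (multiples_added N (\<lambda>s. int k * a s)) = k * index \<Lambda> (multiples_added N a)"
proof -
  let ?N1 = "multiples_added N a" and ?N2 = "multiples_added N (\<lambda>s. int k * a s)"
  note N1 = submod_multiples_added[OF N, of a] and N2 = submod_multiples_added[OF N, of "\<lambda>s. int k * a s"]
  (* A system of representatives for the cosets of the larger group. *)
  define r where "r C = (SOME z. z \<in> \<Lambda> \<and> coset ?N1 z = C)" for C
  have r: "r C \<in> \<Lambda> \<and> coset ?N1 (r C) = C" if "C \<in> coset ?N1 ` \<Lambda>" for C
  proof -
    have "\<exists>z. z \<in> \<Lambda> \<and> coset ?N1 z = C" using that by blast
    then show ?thesis unfolding r_def by (rule someI_ex)
  qed
  define h where "h = (\<lambda>(C, i::nat). coset ?N2 (r C + (\<lambda>s. int i * a s)))"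
  have "bij_betw h (coset ?N1 ` \<Lambda> \<times> {..<k}) (coset ?N2 ` \<Lambda>)"
  proof (rule bij_betwI')
    fix p q assume p: "p \<in> coset ?N1 ` \<Lambda> \<times> {..<k}" and q: "q \<in> coset ?N1 ` \<Lambda> \<times> {..<k}"
    obtain C i D j where pq: "p = (C, i)" "q = (D, j)" by (metis surj_pair)
    with p q have C: "C \<in> coset ?N1 ` \<Lambda>" "D \<in> coset ?N1 ` \<Lambda>" "i < k" "j < k" by auto
    show "(h p = h q) = (p = q)"
    proof
      assume "h p = h q"
      then have "(r C + (\<lambda>s. int i * a s)) - (r D + (\<lambda>s. int j * a s)) \<in> ?N2"
        unfolding h_def pq by (simp only: prod.case coset_eq_iff[OF N2])
      then obtain n m where n: "n \<in> N"
        and nm: "(r C + (\<lambda>s. int i * a s)) - (r D + (\<lambda>s. int j * a s)) = n + (\<lambda>s. m * (int k * a s))"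
        unfolding multiples_added_def by blast
      have e: "r C s + int i * a s - (r D s + int j * a s) = n s + m * (int k * a s)" for s
        using fun_cong[OF nm, of s] by simp
      have "r C - r D = n + (\<lambda>s. (m * int k + int j - int i) * a s)"
        using e by (simp add: fun_eq_iff algebra_simps)
      then have "r C - r D \<in> ?N1" using n unfolding multiples_added_def by blast
      then have CD: "C = D" using r[OF C(1)] r[OF C(2)] coset_eq_iff[OF N1, of "r C" "r D"] by simp
      have "(\<lambda>s. (int i - int j - m * int k) * a s) = n"
        using e by (simp add: fun_eq_iff algebra_simps CD)
      then have "int i - int j - m * int k = 0" using free[of "int i - int j - m * int k"] n by auto
      then have "int i - int j = m * int k" by simp
      then have "int i mod int k = int j mod int k"
        by (metis mod_eq_dvd_iff dvd_triv_right)
      then have "i = j" using C(3,4) by simp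
      then show "p = q" using CD pq by simp
    qed simp
  next
    fix p assume p: "p \<in> coset ?N1 ` \<Lambda> \<times> {..<k}"
    obtain C i where "p = (C, i)" by (metis surj_pair)
    then show "h p \<in> coset ?N2 ` \<Lambda>"
      using p r[of C] a submod_add[OF L _ submod_scale[OF L a, of "int i"], of "r C"] by (auto simp: h_def)
  next
    fix D assume "D \<in> coset ?N2 ` \<Lambda>"
    then obtain z where z: "z \<in> \<Lambda>" "D = coset ?N2 z" by blast
    let ?C = "coset ?N1 z"
    have C: "?C \<in> coset ?N1 ` \<Lambda>" using z by blast
    then have "z - r ?C \<in> ?N1" using r[OF C] coset_eq_iff[OF N1, of z "r ?C"] by simp
    then obtain n j where n: "n \<in> N" "z - r ?C = n + (\<lambda>s. j * a s)"
      unfolding multiples_added_def by blast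
    define i where "i = nat (j mod int k)"
    have i: "i < k" "int i = j mod int k" using k by (auto simp: i_def nat_less_iff)
    have j: "j = (j div int k) * int k + int i" by (simp add: i(2))
    have "z - (r ?C + (\<lambda>s. int i * a s)) = n + (\<lambda>s. (j div int k) * (int k * a s))"
    proof
      fix s
      have "z s - r ?C s = n s + j * a s" using fun_cong[OF n(2), of s] by simp
      then show "(z - (r ?C + (\<lambda>s. int i * a s))) s = (n + (\<lambda>s. (j div int k) * (int k * a s))) s"
        using arg_cong[OF j, of "\<lambda>x. x * a s"] by (simp add: algebra_simps)
    qed
    then have "z - (r ?C + (\<lambda>s. int i * a s)) \<in> ?N2" using n unfolding multiples_added_def by blast
    then have "D = h (?C, i)" using z coset_eq_iff[OF N2] by (simp add: h_def)
    then show "\<exists>x\<in>coset ?N1 ` \<Lambda> \<times> {..<k}. D = h x" using C i by blast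
  qed
  then have "card (coset ?N2 ` \<Lambda>) = card (coset ?N1 ` \<Lambda> \<times> {..<k})" by (simp add: bij_betw_same_card)
  then show ?thesis by (simp add: index_def card_cartesian_product)
qed

lemma multiples_added_uminus: "multiples_added N (\<lambda>s. - a s) = multiples_added N a"
proof -
  have "multiples_added N (\<lambda>s. - a s) \<subseteq> multiples_added N a" for a :: "'a \<Rightarrow> int"
  proof
    fix x assume "x \<in> multiples_added N (\<lambda>s. - a s)"
    then obtain n k where *: "n \<in> N" "x = n + (\<lambda>s. k * (- a s))" unfolding multiples_added_def by blast
    then have "x = n + (\<lambda>s. (- k) * a s)" by simp
    then show "x \<in> multiples_added N a" using *(1) unfolding multiples_added_def by blast
  qed
  from this[of a] this[of "\<lambda>s. - a s"] show ?thesis by auto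
qed

lemma index_multiple_int:
  assumes L: "submod \<Lambda>" and N: "submod N" and a: "a \<in> \<Lambda>" and k: "k \<noteq> 0"
    and free: "\<And>j. j \<noteq> 0 \<Longrightarrow> (\<lambda>s. j * a s) \<notin> N"
  shows "int (index \<Lambda> (multiples_added N (\<lambda>s. k * a s))) = \<bar>k\<bar> * int (index \<Lambda> (multiples_added N a))"
proof (cases "k > 0")
  case True
  then show ?thesis using index_multiple[OF L N a _ free, of "nat k"] by simp
next
  case False
  then have "multiples_added N (\<lambda>s. k * a s) = multiples_added N (\<lambda>s. int (nat (- k)) * a s)"
    using multiples_added_uminus[of N "\<lambda>s. k * a s"] by simp
  then show ?thesis using index_multiple[OF L N a _ free, of "nat (- k)"] False k by simp
qed

lemma multiples_added_shift:
  assumes N: "submod N" and d: "a - b \<in> N"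
  shows "multiples_added N a = multiples_added N b"
proof -
  have "multiples_added N a \<subseteq> multiples_added N b" if "a - b \<in> N" for a b
  proof
    fix x assume "x \<in> multiples_added N a"
    then obtain n k where *: "n \<in> N" "x = n + (\<lambda>s. k * a s)" unfolding multiples_added_def by blast
    have "x = (n + (\<lambda>s. k * (a - b) s)) + (\<lambda>s. k * b s)" by (simp add: *(2) fun_eq_iff algebra_simps)
    then show "x \<in> multiples_added N b"
      using submod_add[OF N *(1) submod_scale[OF N that, of k]] unfolding multiples_added_def by blast
  qed
  moreover have "b - a \<in> N" using submod_uminus[OF N d] by simp
  ultimately show ?thesis using d by blast
qed

text \<open>The relation makes \<open>N + \<int> p a\<close> and \<open>N + \<int> q b\<close> the same group, whose index is computed in two
  ways.\<close>

lemma index_exchange: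
  assumes L: "submod \<Lambda>" and N: "submod N" and a: "a \<in> \<Lambda>" "b \<in> \<Lambda>" and pq: "p \<noteq> 0" "q \<noteq> 0"
    and rel: "(\<lambda>s. p * a s - q * b s) \<in> N"
    and free: "\<And>j. j \<noteq> 0 \<Longrightarrow> (\<lambda>s. j * a s) \<notin> N" "\<And>j. j \<noteq> 0 \<Longrightarrow> (\<lambda>s. j * b s) \<notin> N"
  shows "\<bar>p\<bar> * int (index \<Lambda> (multiples_added N a)) = \<bar>q\<bar> * int (index \<Lambda> (multiples_added N b))"
proof -
  have "multiples_added N (\<lambda>s. p * a s) = multiples_added N (\<lambda>s. q * b s)"
    using rel by (intro multiples_added_shift[OF N]) (simp add: fun_diff_def)
  then show ?thesis
    using index_multiple_int[OF L N a(1) pq(1) free(1)] index_multiple_int[OF L N a(2) pq(2) free(2)] by simp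
qed

text \<open>The lattices \<open>G T\<close> are built up by adjoining one generator \<open>a t\<close> for each \<open>t \<in> T\<close>, and integer
  relations among these generators modulo \<open>G S\<close> reflect real relations among coordinates modulo
  \<open>K\<close>. An integer relation between \<open>a t\<close>, \<open>a t'\<close> and \<open>G S\<close> with coefficients \<open>p\<close> and \<open>q\<close> then
  determines the \<open>t'\<close>-coordinate of the projection of \<open>unit_chain t\<close> as \<open>q / p\<close>, and by
  \<open>index_exchange\<close> the same quotient relates the indices.\<close>

lemma exchange_compatibility:
  fixes K :: "('c \<Rightarrow> real) set" and G :: "'c set \<Rightarrow> ('c \<Rightarrow> int) set" and a :: "'c \<Rightarrow> 'c \<Rightarrow> int"
  assumes K: "submod K" and L: "submod \<Lambda>" and G: "\<And>S. submod (G S)"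
    and G_insert: "\<And>S t. t \<notin> S \<Longrightarrow> G (insert t S) = multiples_added (G S) (a t)"
    and a: "\<And>t. t \<in> I \<Longrightarrow> a t \<in> \<Lambda>"
    and multiple: "\<And>T t. complements K I T \<Longrightarrow> t \<in> I \<Longrightarrow> \<exists>p. p \<noteq> 0 \<and> (\<lambda>s. p * a t s) \<in> G T"
    and relation: "\<And>S p q t t'. S \<subseteq> I \<Longrightarrow> t \<in> I \<Longrightarrow> t' \<in> I \<Longrightarrow> (\<lambda>s. p * a t s - q * a t' s) \<in> G S \<Longrightarrow>
      \<exists>u\<in>supported S. (\<lambda>s. real_of_int p * unit_chain t s - real_of_int q * unit_chain t' s) - u \<in> K"
    and t: "t \<in> I - S" "t' \<in> I - S" and T: "complements K I (insert t S)" "complements K I (insert t' S)"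
  shows "(real (index \<Lambda> (G (insert t S))))\<^sup>2
    = (real (index \<Lambda> (G (insert t' S))))\<^sup>2 * (proj K (insert t' S) (unit_chain t) t')\<^sup>2"
proof -
  have S: "S \<subseteq> I" using T by (auto simp: complements_def)
  have free: "(\<lambda>s. j * a r s) \<notin> G S" if r: "r \<in> I - S" "complements K I (insert r S)" and j: "j \<noteq> 0" for r j
  proof
    assume "(\<lambda>s. j * a r s) \<in> G S"
    then have "(\<lambda>s. j * a r s - 0 * a r s) \<in> G S" by simp
    from relation[OF S _ _ this] r obtain u
      where u: "u \<in> supported S" "(\<lambda>s. real_of_int j * unit_chain r s - real_of_int 0 * unit_chain r s) - u \<in> K"
      by blast
    have "(\<lambda>s. real_of_int j * unit_chain r s - real_of_int 0 * unit_chain r s) - u \<in> supported (insert r S)"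
      using u(1) by (auto simp: supported_def unit_chain_def)
    with u(2) r(2) have "(\<lambda>s. real_of_int j * unit_chain r s - real_of_int 0 * unit_chain r s) - u = 0"
      by (auto simp: complements_def)
    from fun_cong[OF this, of r] have "real_of_int j = u r" by (simp add: unit_chain_def)
    then show False using u(1) r(1) j by (simp add: supported_def)
  qed
  obtain p where p: "p \<noteq> 0" "(\<lambda>s. p * a t s) \<in> G (insert t' S)" using multiple[OF T(2)] t by blast
  then obtain y q where q: "y \<in> G S" "(\<lambda>s. p * a t s) = y + (\<lambda>s. q * a t' s)"
    using G_insert[of t' S] t unfolding multiples_added_def by blast
  then have y: "(\<lambda>s. p * a t s - q * a t' s) = y" by (auto simp: fun_eq_iff)
  have "q \<noteq> 0" using free[of t p] t T p(1) y q(1) by auto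
  have "\<bar>p\<bar> * int (index \<Lambda> (multiples_added (G S) (a t))) = \<bar>q\<bar> * int (index \<Lambda> (multiples_added (G S) (a t')))"
    using t T y q(1) p(1) \<open>q \<noteq> 0\<close> a by (intro index_exchange L G free) auto
  then have "real_of_int (\<bar>p\<bar> * int (index \<Lambda> (G (insert t S)))) = real_of_int (\<bar>q\<bar> * int (index \<Lambda> (G (insert t' S))))"
    using G_insert t by simp
  then have "\<bar>real_of_int p\<bar> * real (index \<Lambda> (G (insert t S))) = \<bar>real_of_int q\<bar> * real (index \<Lambda> (G (insert t' S)))"
    by simp
  then have idx: "(real_of_int p)\<^sup>2 * (real (index \<Lambda> (G (insert t S))))\<^sup>2
      = (real_of_int q)\<^sup>2 * (real (index \<Lambda> (G (insert t' S))))\<^sup>2"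
    by (metis power_mult_distrib power2_abs)
  from relation[OF S _ _ , of t t' p q] y q(1) t obtain u where
    u: "u \<in> supported S" "(\<lambda>s. real_of_int p * unit_chain t s - real_of_int q * unit_chain t' s) - u \<in> K" by auto
  let ?v = "\<lambda>s. (real_of_int q * unit_chain t' s + u s) / real_of_int p"
  have "proj K (insert t' S) (unit_chain t) = ?v"
  proof (rule proj_unique[OF K T(2)])
    show "?v \<in> supported (insert t' S)" using u(1) by (auto simp: supported_def unit_chain_def)
    have "unit_chain t - ?v = (\<lambda>s. (1 / real_of_int p) *
        ((\<lambda>s. real_of_int p * unit_chain t s - real_of_int q * unit_chain t' s) - u) s)"
      using p(1) by (auto simp: fun_eq_iff field_simps)
    then show "unit_chain t - ?v \<in> K" using submod_scale[OF K u(2), of "1 / real_of_int p"] by simp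
  qed
  moreover have "u t' = 0" using u(1) t by (simp add: supported_def)
  ultimately have pr: "proj K (insert t' S) (unit_chain t) t' = real_of_int q / real_of_int p"
    by (simp add: unit_chain_def)
  show ?thesis unfolding pr using idx p(1) by (simp add: power_divide field_simps)
qed

text \<open>Subtracting the integral parts of the coefficients moves every element of \<open>\<Lambda>\<close>, modulo \<open>N\<close>, to an
  integral point of a bounded region.\<close>

lemma finite_index:
  fixes g :: "'i \<Rightarrow> 'c \<Rightarrow> int"
  assumes F: "finite F" and J: "finite J" and g: "\<And>i. i \<in> F \<Longrightarrow> g i \<in> supported J"
    and N: "submod N" "\<And>i. i \<in> F \<Longrightarrow> g i \<in> N"
    and L: "\<And>z. z \<in> \<Lambda> \<Longrightarrow> \<exists>x. \<forall>s. real_of_int (z s) = (\<Sum>i\<in>F. x i * real_of_int (g i s))"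
  shows "finite (coset N ` \<Lambda>)"
proof -
  define M where "M = (\<Sum>i\<in>F. \<Sum>s\<in>J. \<bar>g i s\<bar>)"
  let ?P = "{z. \<forall>s. (s \<in> J \<longrightarrow> z s \<in> {-M..M}) \<and> (s \<notin> J \<longrightarrow> z s = 0)}"
  have "finite ?P" using finite_set_of_finite_funs[OF J, of "{-M..M}" 0] by simp
  moreover have "coset N ` \<Lambda> \<subseteq> coset N ` ?P"
  proof
    fix C assume "C \<in> coset N ` \<Lambda>"
    then obtain z where z: "z \<in> \<Lambda>" "C = coset N z" by blast
    obtain x where x: "\<And>s. real_of_int (z s) = (\<Sum>i\<in>F. x i * real_of_int (g i s))" using L[OF z(1)] by blast
    (* The real coefficients of w are the fractional parts of those of z. *)
    define w where "w = z - (\<Sum>i\<in>F. (\<lambda>s. \<lfloor>x i\<rfloor> * g i s))"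
    have w: "real_of_int (w s) = (\<Sum>i\<in>F. frac (x i) * real_of_int (g i s))" for s
      by (simp add: w_def sum_fun_apply x frac_def sum_subtractf algebra_simps)
    have "z - w \<in> N"
      unfolding w_def using N by (auto intro!: submod_sum submod_scale)
    then have "C = coset N w" using z coset_eq_iff[OF N(1)] by simp
    moreover have "w \<in> ?P"
    proof (intro CollectI conjI allI impI)
      fix s assume s: "s \<notin> J"
      then have "real_of_int (w s) = 0" using g unfolding w by (auto intro!: sum.neutral simp: supported_def)
      then show "w s = 0" by simp
    next
      fix s assume s: "s \<in> J"
      have "\<bar>real_of_int (w s)\<bar> \<le> (\<Sum>i\<in>F. \<bar>frac (x i) * real_of_int (g i s)\<bar>)"
        unfolding w by (rule sum_abs)
      also have "\<dots> \<le> (\<Sum>i\<in>F. real_of_int (\<Sum>s\<in>J. \<bar>g i s\<bar>))"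
      proof (rule sum_mono)
        fix i
        have "\<bar>g i s\<bar> \<le> (\<Sum>s\<in>J. \<bar>g i s\<bar>)" using s J by (intro member_le_sum) auto
        then have "real_of_int \<bar>g i s\<bar> \<le> real_of_int (\<Sum>s\<in>J. \<bar>g i s\<bar>)" by (simp only: of_int_le_iff)
        moreover have "\<bar>frac (x i)\<bar> * real_of_int \<bar>g i s\<bar> \<le> 1 * real_of_int \<bar>g i s\<bar>"
          by (intro mult_right_mono) (auto simp: frac_lt_1 less_imp_le)
        ultimately show "\<bar>frac (x i) * real_of_int (g i s)\<bar> \<le> real_of_int (\<Sum>s\<in>J. \<bar>g i s\<bar>)"
          by (simp add: abs_mult)
      qed
      also have "\<dots> = real_of_int M" by (simp add: M_def)
      finally show "w s \<in> {-M..M}" by (simp flip: of_int_abs add: abs_le_iff)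
    qed
    ultimately show "C \<in> coset N ` ?P" by blast
  qed
  ultimately show ?thesis by (rule finite_surj)
qed

section \<open>Rational and real complements\<close>

text \<open>The reals are a vector space over the rationals, so a linear function can be prescribed on a
  nonzero real.\<close>

lemma rational_functional:
  fixes r :: real
  assumes "r \<noteq> 0"
  shows "\<exists>f :: real \<Rightarrow> rat. (\<forall>x y. f (x + y) = f x + f y) \<and> (\<forall>q x. f (of_rat q * x) = q * f x) \<and> f r = 1"
proof -
  interpret R: vector_space "\<lambda>(q::rat) (x::real). of_rat q * x"
    by unfold_locales (auto simp: algebra_simps of_rat_add of_rat_mult)
  interpret Q: vector_space "(*) :: rat \<Rightarrow> rat \<Rightarrow> rat"
    by (unfold_locales; simp add: algebra_simps)
  interpret RQ: vector_space_pair "\<lambda>(q::rat) (x::real). of_rat q * x" "(*) :: rat \<Rightarrow> rat \<Rightarrow> rat" ..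
  have "R.independent {r}" using assms by (simp add: R.dependent_single)
  then obtain f where f: "Vector_Spaces.linear (\<lambda>(q::rat) (x::real). of_rat q * x) (*) f" "\<forall>x\<in>{r}. f x = 1"
    using RQ.linear_independent_extend[of "{r}" "\<lambda>_. 1"] by blast
  show ?thesis
  proof (intro exI[of _ f] conjI allI)
    show "f (x + y) = f x + f y" for x y using f(1) by (rule RQ.linear_add)
    show "f (of_rat q * x) = q * f x" for q x using f(1) by (rule RQ.linear_scale)
    show "f r = 1" using f(2) by simp
  qed
qed

lemma common_denominator:
  assumes "finite I"
  shows "\<exists>p::int. p > 0 \<and> (\<forall>s\<in>I. \<exists>m::int. of_int p * (q s :: rat) = of_int m)"
  using assms
proof (induction I)
  case empty
  show ?case by (rule exI[of _ 1]) simp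
next
  case (insert t I)
  then obtain p where p: "p > 0" "\<forall>s\<in>I. \<exists>m::int. of_int p * q s = of_int m" by blast
  obtain a b where ab: "q t = Fract a b" "b > 0" by (metis Rat_cases)
  have qt: "\<exists>m::int. of_int (p * b) * q t = of_int m"
    using ab by (intro exI[of _ "p * a"]) (simp add: Fract_of_int_quotient)
  have "\<exists>m::int. of_int (p * b) * q s = of_int m" if s: "s \<in> I" for s
  proof -
    obtain m where "of_int p * q s = of_int m" using p(2) s by blast
    then have "of_int (p * b) * q s = of_int (m * b)" by (simp add: algebra_simps)
    then show ?thesis by blast
  qed
  then have "\<forall>s\<in>insert t I. \<exists>m::int. of_int (p * b) * q s = of_int m" using qt by blast
  then show ?case using p(1) ab(2) by (intro exI[of _ "p * b"]) simp
qed

text \<open>A real solution of a rational system becomes a rational one by applying a \<open>\<rat>\<close>-linear \<open>f\<close> to its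
  coefficients. For solvability one takes \<open>f 1 = 1\<close>, so that the rational right-hand side is
  preserved; for triviality of the intersection one takes \<open>f = 1\<close> at a nonzero coefficient, so
  that the rational solution is nonzero as well.\<close>

lemma complements_rat_real:
  fixes KQ :: "('c \<Rightarrow> rat) set" and KR :: "('c \<Rightarrow> real) set"
  assumes I: "finite I" and KQ: "submod KQ" and KR: "submod KR"
    and down: "\<And>f x. (\<And>x y. f (x + y) = f x + f y) \<Longrightarrow> (\<And>q x. f (of_rat q * x) = q * f x) \<Longrightarrow>
      x \<in> KR \<Longrightarrow> (\<lambda>s. f (x s)) \<in> KQ"
    and up: "\<And>x. x \<in> KQ \<Longrightarrow> (\<lambda>s. of_rat (x s)) \<in> KR"
  shows "complements KR I T \<longleftrightarrow> complements KQ I T"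
proof
  assume R: "complements KR I T"
  obtain f :: "real \<Rightarrow> rat" where add: "\<And>x y. f (x + y) = f x + f y"
    and scale: "\<And>q x. f (of_rat q * x) = q * f x" and f1: "f 1 = 1"
    using rational_functional[OF one_neq_zero] by blast
  have f0: "f 0 = 0" using scale[of 0 0] by simp
  have fd: "f (x - y) = f x - f y" for x y using add[of "x - y" y] by simp
  have fq: "f (of_rat q) = q" for q using scale[of q 1] f1 by simp
  show "complements KQ I T"
    unfolding complements_def
  proof (intro conjI ballI)
    show "T \<subseteq> I" using R by (simp add: complements_def)
    show "supported T \<inter> KQ \<subseteq> {0}"
    proof
      fix x assume "x \<in> supported T \<inter> KQ"
      then have "(\<lambda>s. of_rat (x s) :: real) \<in> supported T \<inter> KR" using up by (auto simp: supported_def)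
      then have "(\<lambda>s. of_rat (x s) :: real) = 0" using R unfolding complements_def by blast
      then show "x \<in> {0}" by (auto simp: fun_eq_iff)
    qed
    fix c :: "'c \<Rightarrow> rat" assume "c \<in> supported I"
    then have "(\<lambda>s. of_rat (c s) :: real) \<in> supported I" by (auto simp: supported_def)
    then obtain u where u: "u \<in> supported T" "(\<lambda>s. of_rat (c s)) - u \<in> KR"
      using R unfolding complements_def by blast
    have "(\<lambda>s. f (((\<lambda>s. of_rat (c s)) - u) s)) \<in> KQ" using u(2) by (intro down add scale)
    then have "c - (\<lambda>s. f (u s)) \<in> KQ" by (simp add: fd fq fun_diff_def)
    moreover have "(\<lambda>s. f (u s)) \<in> supported T" using u(1) f0 by (auto simp: supported_def)
    ultimately show "\<exists>u\<in>supported T. c - u \<in> KQ" by blast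
  qed
next
  assume Q: "complements KQ I T"
  show "complements KR I T"
    unfolding complements_def
  proof (intro conjI)
    show "T \<subseteq> I" using Q by (simp add: complements_def)
    show "supported T \<inter> KR \<subseteq> {0}"
    proof (rule subsetI, rule ccontr)
      fix x assume x: "x \<in> supported T \<inter> KR" "x \<notin> {0}"
      then obtain s where s: "x s \<noteq> 0" by (auto simp: fun_eq_iff)
      obtain f :: "real \<Rightarrow> rat" where add: "\<And>x y. f (x + y) = f x + f y"
        and scale: "\<And>q x. f (of_rat q * x) = q * f x" and fs: "f (x s) = 1"
        using rational_functional[OF s] by blast
      have f0: "f 0 = 0" using scale[of 0 0] by simp
      have "(\<lambda>s. f (x s)) \<in> KQ" using x by (intro down add scale) auto
      moreover have "(\<lambda>s. f (x s)) \<in> supported T" using x f0 by (auto simp: supported_def)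
      ultimately have "(\<lambda>s. f (x s)) = 0" using Q unfolding complements_def by blast
      from fun_cong[OF this, of s] fs show False by simp
    qed
    show "\<forall>c\<in>supported I. \<exists>u\<in>supported T. c - u \<in> KR"
    proof
      fix c :: "'c \<Rightarrow> real" assume c: "c \<in> supported I"
      show "\<exists>u\<in>supported T. c - u \<in> KR"
      proof (rule units_span[OF I KR _ c])
        fix t assume "t \<in> I"
        then have "unit_chain t \<in> supported I" by (simp add: unit_chain_supported)
        then obtain u where u: "u \<in> supported T" "unit_chain t - u \<in> KQ"
          using Q unfolding complements_def by blast
        have "(\<lambda>s. of_rat ((unit_chain t - u) s)) = unit_chain t - (\<lambda>s. of_rat (u s) :: real)"
          by (auto simp: fun_eq_iff unit_chain_def of_rat_diff)
        then have "unit_chain t - (\<lambda>s. of_rat (u s) :: real) \<in> KR" using up[OF u(2)] by simp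
        moreover have "(\<lambda>s. of_rat (u s) :: real) \<in> supported T" using u(1) by (auto simp: supported_def)
        ultimately show "\<exists>u\<in>supported T. unit_chain t - u \<in> KR" by blast
      qed
    qed
  qed
qed

section \<open>Complements of the kernel and the image of an integer matrix\<close>

definition matrix_map :: "('c \<Rightarrow> 'c \<Rightarrow> int) \<Rightarrow> 'c set \<Rightarrow> 'c set \<Rightarrow> ('c \<Rightarrow> 'r::comm_ring_1) \<Rightarrow> 'c \<Rightarrow> 'r" where
  "matrix_map M I J c = (\<lambda>f. if f \<in> J then \<Sum>b\<in>I. of_int (M b f) * c b else 0)"

lemma clear_denominators:
  fixes u :: "'c \<Rightarrow> rat"
  assumes "finite T" "u \<in> supported T"
  obtains p :: int and m :: "'c \<Rightarrow> int"
  where "p > 0" "m \<in> supported T" "\<And>s. of_int (m s) = of_int p * u s"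
proof -
  obtain p :: int where p: "p > 0" "\<forall>s\<in>T. \<exists>m::int. of_int p * u s = of_int m"
    using common_denominator[OF assms(1), of u] by blast
  then obtain m :: "'c \<Rightarrow> int" where m: "\<forall>s\<in>T. of_int p * u s = of_int (m s)"
    by (metis bchoice)
  show ?thesis
    by (rule that[of p "\<lambda>s. if s \<in> T then m s else 0"])
      (use p m assms in \<open>auto simp: supported_def\<close>)
qed

text \<open>An integer matrix acts on chains over every coefficient ring; the integers, rationals and reals
  occur side by side below.\<close>

locale int_matrix =
  fixes M :: "'c \<Rightarrow> 'c \<Rightarrow> int" and I J :: "'c set"
  assumes finite_I: "finite I" and finite_J: "finite J"
begin

abbreviation A :: "('c \<Rightarrow> 'r::comm_ring_1) \<Rightarrow> 'c \<Rightarrow> 'r" where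
  "A \<equiv> matrix_map M I J"

lemma A_supported: "A c \<in> supported J"
  by (simp add: matrix_map_def supported_def)

lemma A_add: "A (x + y) = A x + A y"
  by (auto simp: matrix_map_def fun_eq_iff algebra_simps sum.distrib)

lemma A_scale: "A (\<lambda>s. a * x s) = (\<lambda>s. a * A x s)"
  by (auto simp: matrix_map_def fun_eq_iff algebra_simps sum_distrib_left)

lemma A_zero [simp]: "A 0 = 0"
  by (auto simp: matrix_map_def fun_eq_iff)

lemma A_diff: "A (x - y) = A x - A y"
  by (auto simp: matrix_map_def fun_eq_iff algebra_simps sum_subtractf)

lemma A_sum: "A (\<lambda>b. \<Sum>p\<in>P. k p * g p b) = (\<lambda>f. \<Sum>p\<in>P. k p * A (g p) f)"
proof
  fix f
  show "A (\<lambda>b. \<Sum>p\<in>P. k p * g p b) f = (\<Sum>p\<in>P. k p * A (g p) f)"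
    unfolding matrix_map_def by (simp add: sum_distrib_left sum.swap[of _ P I] mult.left_commute)
qed

lemma A_map:
  assumes add: "\<And>x y. h (x + y) = h x + h y" and scale: "\<And>k x. h (of_int k * x) = of_int k * h x"
  shows "A (\<lambda>s. h (x s)) f = h (A x f)"
proof -
  have h0: "h 0 = 0" using scale[of 0 0] by simp
  have "h (sum g B) = (\<Sum>b\<in>B. h (g b))" for g and B :: "'c set"
    by (induction B rule: infinite_finite_induct) (simp_all add: h0 add)
  then show ?thesis by (simp add: matrix_map_def h0 scale)
qed

lemma A_of_int: "A (\<lambda>s. of_int (x s)) = (\<lambda>f. of_int (A x f))"
  by (rule ext) (rule A_map; simp)

lemma A_unit_of_int: "of_int (A (unit_chain b) s) = (A (unit_chain b) s :: 'r::comm_ring_1)"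
proof -
  have "(\<lambda>s. of_int (unit_chain b s)) = (unit_chain b :: 'c \<Rightarrow> 'r)"
    by (auto simp: unit_chain_def)
  moreover have "A (\<lambda>s. of_int (unit_chain b s) :: 'r) s = of_int (A (unit_chain b) s)"
    by (simp only: A_of_int)
  ultimately show ?thesis by simp
qed

lemma A_of_rat: "A (\<lambda>s. of_rat (x s) :: real) = (\<lambda>f. of_rat (A x f))"
  by (rule ext) (rule A_map; simp add: of_rat_add of_rat_mult)

definition ker :: "('c \<Rightarrow> 'r::comm_ring_1) set" where
  "ker = {c \<in> supported I. A c = 0}"

definition im :: "('c \<Rightarrow> 'r::comm_ring_1) set" where
  "im = A ` supported I"

lemma submod_image: "submod (A ` (supported S :: ('c \<Rightarrow> 'r::comm_ring_1) set))"
  unfolding submod_def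
proof (intro conjI ballI allI)
  show "0 \<in> A ` (supported S :: ('c \<Rightarrow> 'r) set)"
    using submod_0[OF submod_supported, of S] by (metis A_zero imageI)
  fix x y :: "'c \<Rightarrow> 'r" assume "x \<in> A ` supported S" "y \<in> A ` supported S"
  then obtain c d where "c \<in> supported S" "x = A c" "d \<in> supported S" "y = A d" by blast
  then show "x + y \<in> A ` supported S"
    using submod_add[OF submod_supported, of c S d] A_add[of c d, symmetric] by auto
next
  fix a :: 'r and x :: "'c \<Rightarrow> 'r" assume "x \<in> A ` supported S"
  then obtain c where "c \<in> supported S" "x = A c" by blast
  then show "(\<lambda>s. a * x s) \<in> A ` supported S"
    using submod_scale[OF submod_supported, of c S a] A_scale[of a c, symmetric] by auto
qed

lemma submod_im: "submod im"
  unfolding im_def by (rule submod_image)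

lemma submod_ker: "submod ker"
  unfolding submod_def ker_def
  by (auto simp: A_add A_scale submod_0[OF submod_supported] submod_add[OF submod_supported]
      submod_scale[OF submod_supported] fun_eq_iff)

lemma im_supported: "im \<subseteq> supported J"
  unfolding im_def using A_supported by blast

lemma ker_supported: "ker \<subseteq> supported I"
  unfolding ker_def by blast

lemma complements_ker_rat_real:
  "complements (ker :: ('c \<Rightarrow> real) set) I T \<longleftrightarrow> complements (ker :: ('c \<Rightarrow> rat) set) I T"
proof (rule complements_rat_real[OF finite_I submod_ker submod_ker])
  fix f :: "real \<Rightarrow> rat" and x :: "'c \<Rightarrow> real"
  assume add: "\<And>x y. f (x + y) = f x + f y" and scale: "\<And>q x. f (of_rat q * x) = q * f x"
    and x: "x \<in> ker"
  have f0: "f 0 = 0" using scale[of 0 0] by simp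
  have "A (\<lambda>s. f (x s)) = (\<lambda>s. f (A x s))"
    by (rule ext) (rule A_map[OF add], metis scale of_rat_of_int_eq)
  then show "(\<lambda>s. f (x s)) \<in> ker"
    using x f0 by (auto simp: ker_def supported_def fun_eq_iff)
next
  fix x :: "'c \<Rightarrow> rat" assume "x \<in> ker"
  then show "(\<lambda>s. of_rat (x s) :: real) \<in> ker"
    by (auto simp: ker_def supported_def A_of_rat fun_eq_iff)
qed

lemma complements_im_rat_real:
  "complements (im :: ('c \<Rightarrow> real) set) J L \<longleftrightarrow> complements (im :: ('c \<Rightarrow> rat) set) J L"
proof (rule complements_rat_real[OF finite_J submod_im submod_im])
  fix f :: "real \<Rightarrow> rat" and x :: "'c \<Rightarrow> real"
  assume add: "\<And>x y. f (x + y) = f x + f y" and scale: "\<And>q x. f (of_rat q * x) = q * f x"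
    and x: "x \<in> im"
  then obtain c where c: "c \<in> supported I" "x = A c" by (auto simp: im_def)
  have f0: "f 0 = 0" using scale[of 0 0] by simp
  have "A (\<lambda>s. f (c s)) = (\<lambda>s. f (x s))"
    unfolding c(2) by (rule ext) (rule A_map[OF add], metis scale of_rat_of_int_eq)
  moreover have "(\<lambda>s. f (c s)) \<in> supported I" using c f0 by (auto simp: supported_def)
  ultimately show "(\<lambda>s. f (x s)) \<in> im" unfolding im_def by (metis imageI)
next
  fix x :: "'c \<Rightarrow> rat" assume "x \<in> im"
  then obtain c where c: "c \<in> supported I" "x = A c" by (auto simp: im_def)
  then have "(\<lambda>s. of_rat (x s) :: real) = A (\<lambda>s. of_rat (c s))" by (simp add: A_of_rat)
  moreover have "(\<lambda>s. of_rat (c s) :: real) \<in> supported I" using c by (auto simp: supported_def)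
  ultimately show "(\<lambda>s. of_rat (x s) :: real) \<in> im" unfolding im_def by (metis imageI)
qed

text \<open>The integral chains in the rational span of the image; modulo the image of a tree they form the
  torsion of the cokernel.\<close>

definition saturation :: "('c \<Rightarrow> int) set" where
  "saturation = {z \<in> supported J. \<exists>k. k \<noteq> 0 \<and> (\<lambda>s. k * z s) \<in> im}"

definition tree_lattice_index :: "'c set \<Rightarrow> nat" where
  "tree_lattice_index T = index saturation (A ` supported T)"

definition cotree_lattice :: "'c set \<Rightarrow> ('c \<Rightarrow> int) set" where
  "cotree_lattice L = {l + k | l k. l \<in> supported L \<and> k \<in> im}"

definition cotree_lattice_index :: "'c set \<Rightarrow> nat" where
  "cotree_lattice_index L = index (supported J) (cotree_lattice L)"

lemma submod_saturation: "submod saturation"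
  unfolding submod_def
proof (intro conjI ballI allI)
  show "0 \<in> saturation"
    unfolding saturation_def using submod_0[OF submod_im] submod_0[OF submod_supported]
    by (auto simp: zero_fun_def intro: exI[of _ 1])
  fix x y assume xy: "x \<in> saturation" "y \<in> saturation"
  then obtain k j where k: "k \<noteq> 0" "(\<lambda>s. k * x s) \<in> im" "j \<noteq> 0" "(\<lambda>s. j * y s) \<in> im"
    by (auto simp: saturation_def)
  have "(\<lambda>s. (k * j) * (x + y) s) = (\<lambda>s. j * (k * x s)) + (\<lambda>s. k * (j * y s))"
    by (auto simp: fun_eq_iff algebra_simps)
  also have "\<dots> \<in> im"
    by (rule submod_add[OF submod_im submod_scale[OF submod_im k(2)] submod_scale[OF submod_im k(4)]])
  finally have "\<exists>k. k \<noteq> 0 \<and> (\<lambda>s. k * (x + y) s) \<in> im"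
    using k by (intro exI[of _ "k * j"]) simp
  then show "x + y \<in> saturation"
    using xy submod_add[OF submod_supported, of x J y] unfolding saturation_def by blast
next
  fix a x assume x: "x \<in> saturation"
  then obtain k where k: "k \<noteq> 0" "(\<lambda>s. k * x s) \<in> im" by (auto simp: saturation_def)
  have "(\<lambda>s. k * (a * x s)) \<in> im"
    using submod_scale[OF submod_im k(2), of a] by (simp add: mult.left_commute)
  then show "(\<lambda>s. a * x s) \<in> saturation"
    using x k(1) submod_scale[OF submod_supported, of x J a] unfolding saturation_def by blast
qed

lemma cotree_latticeI: "l \<in> supported L \<Longrightarrow> k \<in> im \<Longrightarrow> l + k \<in> cotree_lattice L"
  unfolding cotree_lattice_def by blast

lemma submod_cotree_lattice: "submod (cotree_lattice L)"
  unfolding submod_def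
proof (intro conjI ballI allI)
  have "(0 :: 'c \<Rightarrow> int) = 0 + 0" by simp
  then show "0 \<in> cotree_lattice L"
    unfolding cotree_lattice_def using submod_0[OF submod_im] submod_0[OF submod_supported] by blast
  fix x y assume "x \<in> cotree_lattice L" "y \<in> cotree_lattice L"
  then obtain l k l' k' where *: "l \<in> supported L" "k \<in> im" "l' \<in> supported L" "k' \<in> im"
    "x = l + k" "y = l' + k'" unfolding cotree_lattice_def by blast
  have "x + y = (l + l') + (k + k')" by (simp add: *)
  then show "x + y \<in> cotree_lattice L"
    unfolding cotree_lattice_def
    using submod_add[OF submod_supported *(1,3)] submod_add[OF submod_im *(2,4)] by blast
next
  fix a x assume "x \<in> cotree_lattice L"
  then obtain l k where *: "l \<in> supported L" "k \<in> im" "x = l + k"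
    unfolding cotree_lattice_def by blast
  have "(\<lambda>s. a * x s) = (\<lambda>s. a * l s) + (\<lambda>s. a * k s)" by (auto simp: * fun_eq_iff algebra_simps)
  then show "(\<lambda>s. a * x s) \<in> cotree_lattice L"
    unfolding cotree_lattice_def
    using submod_scale[OF submod_supported *(1), of a] submod_scale[OF submod_im *(2), of a] by blast
qed

lemma supported_insert_split:
  fixes x :: "'c \<Rightarrow> 'r::comm_ring_1"
  assumes "x \<in> supported (insert t S)"
  shows "x(t := 0) \<in> supported S" "x = x(t := 0) + (\<lambda>s. x t * unit_chain t s)"
  using assms by (auto simp: supported_def unit_chain_def fun_eq_iff)

text \<open>Here the lattice of \<open>S\<close> is generated by the columns of the matrix with index in \<open>S\<close>. A
  complement of the real kernel is one of the rational kernel, and clearing denominators yields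
  the required multiples.\<close>

lemma tree_compatibility:
  assumes "t \<in> I - S" "t' \<in> I - S"
    and "complements (ker :: ('c \<Rightarrow> real) set) I (insert t S)" "complements (ker :: ('c \<Rightarrow> real) set) I (insert t' S)"
  shows "(real (tree_lattice_index (insert t S)))\<^sup>2
    = (real (tree_lattice_index (insert t' S)))\<^sup>2 * (proj ker (insert t' S) (unit_chain t) t')\<^sup>2"
  unfolding tree_lattice_index_def
proof (rule exchange_compatibility[OF submod_ker submod_saturation submod_image _ _ _ _ assms])
  fix S t assume t: "t \<notin> (S :: 'c set)"
  show "A ` supported (insert t S) = multiples_added (A ` supported S) (A (unit_chain t) :: 'c \<Rightarrow> int)"
  proof (intro equalityI subsetI)
    fix y assume "y \<in> A ` (supported (insert t S) :: ('c \<Rightarrow> int) set)"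
    then obtain x where x: "x \<in> supported (insert t S)" "y = A x" by blast
    have "y = A (x(t := 0)) + (\<lambda>s. x t * A (unit_chain t) s)"
      unfolding x(2) by (subst supported_insert_split(2)[OF x(1)]) (simp only: A_add A_scale)
    then show "y \<in> multiples_added (A ` supported S) (A (unit_chain t))"
      using supported_insert_split(1)[OF x(1)] unfolding multiples_added_def by blast
  next
    fix y :: "'c \<Rightarrow> int" assume "y \<in> multiples_added (A ` supported S) (A (unit_chain t))"
    then obtain x k where x: "x \<in> supported S" "y = A x + (\<lambda>s. k * A (unit_chain t) s)"
      unfolding multiples_added_def by blast
    then have "y = A (x + (\<lambda>s. k * unit_chain t s))" by (simp only: A_add A_scale)
    moreover have "x + (\<lambda>s. k * unit_chain t s) \<in> supported (insert t S)"
      using x(1) by (auto simp: supported_def unit_chain_def)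
    ultimately show "y \<in> A ` supported (insert t S)" by blast
  qed
next
  fix t assume t: "t \<in> I"
  have "A (unit_chain t) \<in> (im :: ('c \<Rightarrow> int) set)"
    using t by (auto simp: im_def unit_chain_supported)
  then show "A (unit_chain t) \<in> saturation"
    using A_supported unfolding saturation_def by (auto intro!: exI[of _ 1])
next
  fix T t assume T: "complements (ker :: ('c \<Rightarrow> real) set) I T" and t: "t \<in> I"
  have TI: "T \<subseteq> I" using T by (simp add: complements_def)
  then have "finite T" using finite_I finite_subset by blast
  have "complements (ker :: ('c \<Rightarrow> rat) set) I T" using T complements_ker_rat_real by blast
  moreover have "unit_chain t \<in> supported I" using t by (simp add: unit_chain_supported)
  ultimately obtain u :: "'c \<Rightarrow> rat" where u: "u \<in> supported T" "unit_chain t - u \<in> ker"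
    unfolding complements_def by blast
  obtain p :: int and m where m: "p > 0" "m \<in> supported T" "\<And>s. of_int (m s) = of_int p * u s"
    using clear_denominators[OF \<open>finite T\<close> u(1)] by blast
  have "A (unit_chain t) = A u" using u(2) by (simp add: ker_def A_diff)
  then have "(\<lambda>s. of_int p * A (unit_chain t) s) = A (\<lambda>s. of_int p * u s)" by (simp add: A_scale)
  also have "\<dots> = (\<lambda>s. of_int (A m s))" unfolding m(3)[symmetric] by (rule A_of_int)
  finally have "(of_int (p * A (unit_chain t) s) :: rat) = of_int (A m s)" for s
    by (simp add: A_unit_of_int fun_eq_iff)
  then have "(\<lambda>s. p * A (unit_chain t) s) = A m" by (intro ext) (simp only: of_int_eq_iff)
  then have "(\<lambda>s. p * A (unit_chain t) s) \<in> A ` (supported T :: ('c \<Rightarrow> int) set)"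
    using m(2) by (intro image_eqI)
  then show "\<exists>p. p \<noteq> 0 \<and> (\<lambda>s. p * A (unit_chain t) s) \<in> A ` (supported T :: ('c \<Rightarrow> int) set)"
    using m(1) by (intro exI[of _ p]) simp
next
  fix S p q t t' assume S: "S \<subseteq> I" "t \<in> I" "t' \<in> I"
    and "(\<lambda>s. p * A (unit_chain t) s - q * A (unit_chain t') s) \<in> A ` (supported S :: ('c \<Rightarrow> int) set)"
  then obtain c where c: "c \<in> supported S"
    "(\<lambda>s. p * A (unit_chain t) s - q * A (unit_chain t') s) = A c" by blast
  let ?r = "\<lambda>s. p * unit_chain t s - q * unit_chain t' s - c s"
  have "A ?r = A ((\<lambda>s. p * unit_chain t s) - (\<lambda>s. q * unit_chain t' s) - c)" by (simp add: fun_diff_def)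
  also have "\<dots> = 0" using c(2) by (simp only: A_diff A_scale) (simp add: fun_eq_iff)
  finally have "A (\<lambda>s. real_of_int (?r s)) = 0" unfolding A_of_int by (simp add: fun_eq_iff)
  moreover have "(\<lambda>s. real_of_int (?r s)) \<in> supported I"
    using S c(1) by (auto simp: supported_def unit_chain_def)
  moreover have "(\<lambda>s. real_of_int (?r s))
      = (\<lambda>s. real_of_int p * unit_chain t s - real_of_int q * unit_chain t' s) - (\<lambda>s. of_int (c s))"
    by (auto simp: fun_eq_iff unit_chain_def)
  ultimately have "(\<lambda>s. real_of_int p * unit_chain t s - real_of_int q * unit_chain t' s) - (\<lambda>s. of_int (c s)) \<in> ker"
    by (simp add: ker_def)
  moreover have "(\<lambda>s. of_int (c s)) \<in> supported S" using c(1) by (auto simp: supported_def)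
  ultimately show "\<exists>u\<in>supported S. (\<lambda>s. real_of_int p * unit_chain t s - real_of_int q * unit_chain t' s) - u \<in> ker"
    by blast
qed

text \<open>Here the lattice of \<open>S\<close> is generated by the image of the matrix and the unit vectors with index
  in \<open>S\<close>.\<close>

lemma cotree_compatibility:
  assumes "t \<in> J - S" "t' \<in> J - S"
    and "complements (im :: ('c \<Rightarrow> real) set) J (insert t S)" "complements (im :: ('c \<Rightarrow> real) set) J (insert t' S)"
  shows "(real (cotree_lattice_index (insert t S)))\<^sup>2
    = (real (cotree_lattice_index (insert t' S)))\<^sup>2 * (proj im (insert t' S) (unit_chain t) t')\<^sup>2"
  unfolding cotree_lattice_index_def
proof (rule exchange_compatibility[where a = unit_chain, OF submod_im submod_supported submod_cotree_lattice _ _ _ _ assms])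
  fix S t assume t: "t \<notin> (S :: 'c set)"
  show "cotree_lattice (insert t S) = multiples_added (cotree_lattice S) (unit_chain t)"
  proof (intro equalityI subsetI)
    fix y assume "y \<in> cotree_lattice (insert t S)"
    then obtain x k where x: "x \<in> supported (insert t S)" "y = x + k" "k \<in> im"
      unfolding cotree_lattice_def by blast
    have "y = (x(t := 0) + k) + (\<lambda>s. x t * unit_chain t s)"
      unfolding x(2) by (subst (1) supported_insert_split(2)[OF x(1)]) (simp only: add.assoc add.commute)
    then show "y \<in> multiples_added (cotree_lattice S) (unit_chain t)"
      using supported_insert_split(1)[OF x(1)] x(3) unfolding multiples_added_def cotree_lattice_def by blast
  next
    fix y assume "y \<in> multiples_added (cotree_lattice S) (unit_chain t)"
    then obtain x k j where x: "x \<in> supported S" "k \<in> im" "y = (x + k) + (\<lambda>s. j * unit_chain t s)"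
      unfolding multiples_added_def cotree_lattice_def by blast
    then have "y = (x + (\<lambda>s. j * unit_chain t s)) + k" by (simp only: ac_simps)
    moreover have "x + (\<lambda>s. j * unit_chain t s) \<in> supported (insert t S)"
      using x(1) by (auto simp: supported_def unit_chain_def)
    ultimately show "y \<in> cotree_lattice (insert t S)" using x(2) unfolding cotree_lattice_def by blast
  qed
next
  fix t assume t: "t \<in> J"
  then show "unit_chain t \<in> supported J" by (simp add: unit_chain_supported)
next
  fix T t assume T: "complements (im :: ('c \<Rightarrow> real) set) J T" and t: "t \<in> J"
  have "T \<subseteq> J" using T by (simp add: complements_def)
  then have "finite T" using finite_J finite_subset by blast
  have "complements (im :: ('c \<Rightarrow> rat) set) J T" using T complements_im_rat_real by blast
  moreover have "unit_chain t \<in> supported J" using t by (simp add: unit_chain_supported)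
  ultimately obtain u :: "'c \<Rightarrow> rat" where u: "u \<in> supported T" "unit_chain t - u \<in> im"
    unfolding complements_def by blast
  then obtain x where x: "x \<in> supported I" "unit_chain t - u = A x" by (auto simp: im_def)
  obtain p :: int and m where m: "p > 0" "m \<in> supported T" "\<And>s. of_int (m s) = of_int p * u s"
    using clear_denominators[OF \<open>finite T\<close> u(1)] by blast
  obtain q :: int and n where n: "q > 0" "n \<in> supported I" "\<And>s. of_int (n s) = of_int q * x s"
    using clear_denominators[OF finite_I x(1)] by blast
  have e: "(of_int ((p * q) * unit_chain t s) :: rat) = of_int (q * m s + p * A n s)" for s
  proof -
    have "unit_chain t s = u s + A x s" using fun_cong[OF x(2), of s] by (simp add: algebra_simps)
    moreover have "of_int (A n s) = of_int q * A x s"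
    proof -
      have "(of_int (A n s) :: rat) = A (\<lambda>s. of_int (n s)) s" by (simp only: A_of_int)
      then show ?thesis unfolding n(3) A_scale .
    qed
    moreover have "(of_int (unit_chain t s) :: rat) = unit_chain t s" by (simp add: unit_chain_def)
    ultimately show ?thesis by (simp add: m(3) algebra_simps)
  qed
  have "(\<lambda>s. (p * q) * unit_chain t s) = (\<lambda>s. q * m s) + (\<lambda>s. p * A n s)"
    using e by (simp only: of_int_eq_iff) (simp add: fun_eq_iff)
  moreover have "(\<lambda>s. q * m s) \<in> supported T" by (rule submod_scale[OF submod_supported m(2)])
  moreover have "(\<lambda>s. p * A n s) \<in> im"
    using n(2) by (intro submod_scale[OF submod_im]) (simp add: im_def)
  ultimately have "(\<lambda>s. (p * q) * unit_chain t s) \<in> cotree_lattice T" unfolding cotree_lattice_def by blast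
  then show "\<exists>p. p \<noteq> 0 \<and> (\<lambda>s. p * unit_chain t s) \<in> cotree_lattice T"
    using m(1) n(1) by (intro exI[of _ "p * q"]) simp
next
  fix S p q t t' assume S: "S \<subseteq> J" "t \<in> J" "t' \<in> J"
    and "(\<lambda>s. p * unit_chain t s - q * unit_chain t' s) \<in> cotree_lattice S"
  then obtain l c where l: "l \<in> supported S" "c \<in> supported I"
    "(\<lambda>s. p * unit_chain t s - q * unit_chain t' s) = l + A c"
    unfolding cotree_lattice_def im_def by blast
  have "(\<lambda>s. real_of_int p * unit_chain t s - real_of_int q * unit_chain t' s) - (\<lambda>s. of_int (l s))
      = A (\<lambda>s. of_int (c s))"
  proof
    fix s
    have "real_of_int (p * unit_chain t s - q * unit_chain t' s) = of_int (l s + A c s)"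
      using fun_cong[OF l(3), of s] by simp
    then show "((\<lambda>s. real_of_int p * unit_chain t s - real_of_int q * unit_chain t' s) - (\<lambda>s. of_int (l s))) s
      = A (\<lambda>s. of_int (c s)) s"
      unfolding A_of_int by (simp add: unit_chain_def split: if_splits)
  qed
  moreover have "(\<lambda>s. of_int (c s)) \<in> supported I" "(\<lambda>s. of_int (l s)) \<in> supported S"
    using l by (auto simp: supported_def)
  ultimately show "\<exists>u\<in>supported S. (\<lambda>s. real_of_int p * unit_chain t s - real_of_int q * unit_chain t' s) - u \<in> im"
    unfolding im_def by (intro bexI[of _ "\<lambda>s. of_int (l s)"]) auto
qed

lemma A_expansion:
  fixes u :: "'c \<Rightarrow> 'r::comm_ring_1"
  assumes T: "T \<subseteq> I" and u: "u \<in> supported T"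
  shows "A u s = (\<Sum>b\<in>T. u b * A (unit_chain b) s)"
proof -
  have "finite T" using T finite_I finite_subset by blast
  then have "u s = (\<Sum>b\<in>T. u b * unit_chain b s)" for s
    using fun_cong[OF chain_expansion[of T u], of s] u by (simp add: sum_fun_apply)
  then have "u = (\<lambda>s. \<Sum>b\<in>T. u b * unit_chain b s)" by (rule ext)
  from arg_cong[OF this, of A] show ?thesis unfolding A_sum by (rule fun_cong)
qed

lemma index_positive:
  assumes "finite (coset N ` \<Lambda>)" "submod \<Lambda>" shows "index \<Lambda> N > 0"
  using assms submod_0[OF assms(2)] unfolding index_def by (auto simp: card_gt_0_iff)

lemma tree_lattice_index_positive:
  assumes T: "complements (ker :: ('c \<Rightarrow> real) set) I T"
  shows "tree_lattice_index T > 0"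
  unfolding tree_lattice_index_def
proof (rule index_positive[OF _ submod_saturation])
  have TI: "T \<subseteq> I" using T by (simp add: complements_def)
  then have fT: "finite T" using finite_I finite_subset by blast
  show "finite (coset (A ` supported T) ` saturation)"
  proof (rule finite_index[OF fT finite_J A_supported submod_image])
    show "A (unit_chain b) \<in> A ` supported T" if "b \<in> T" for b
      using that by (simp add: unit_chain_supported)
    fix z assume "z \<in> saturation"
    then obtain k x where k: "k \<noteq> 0" "x \<in> supported I" "(\<lambda>s. k * z s) = A x"
      by (auto simp: saturation_def im_def)
    have "(\<lambda>s. real_of_int (x s)) \<in> supported I" using k(2) by (auto simp: supported_def)
    then obtain u where u: "u \<in> supported T" "(\<lambda>s. real_of_int (x s)) - u \<in> ker"
      using T unfolding complements_def by blast
    have "A u = A (\<lambda>s. real_of_int (x s))" using u(2) by (simp add: ker_def A_diff)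
    then have Au: "A u s = real_of_int k * real_of_int (z s)" for s
    proof -
      have "A x s = k * z s" using fun_cong[OF k(3), of s] by simp
      then show ?thesis using \<open>A u = A (\<lambda>s. real_of_int (x s))\<close> by (simp add: A_of_int)
    qed
    have "real_of_int (z s) = (\<Sum>b\<in>T. u b / real_of_int k * real_of_int (A (unit_chain b) s))" for s
    proof -
      have "(\<Sum>b\<in>T. u b / real_of_int k * real_of_int (A (unit_chain b) s)) = A u s / real_of_int k"
        unfolding A_unit_of_int A_expansion[OF TI u(1)] by (simp add: sum_divide_distrib)
      then show ?thesis using k(1) by (simp add: Au)
    qed
    then show "\<exists>x. \<forall>s. real_of_int (z s) = (\<Sum>i\<in>T. x i * real_of_int (A (unit_chain i) s))"
      by (intro exI[of _ "\<lambda>b. u b / real_of_int k"] allI)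
  qed
qed

lemma cotree_lattice_index_positive:
  assumes L: "complements (im :: ('c \<Rightarrow> real) set) J L"
  shows "cotree_lattice_index L > 0"
  unfolding cotree_lattice_index_def
proof (rule index_positive[OF _ submod_supported])
  have LJ: "L \<subseteq> J" using L by (simp add: complements_def)
  then have fL: "finite L" using finite_J finite_subset by blast
  let ?g = "case_sum unit_chain (\<lambda>b. A (unit_chain b)) :: _ \<Rightarrow> 'c \<Rightarrow> int"
  show "finite (coset (cotree_lattice L) ` supported J)"
  proof (rule finite_index[where g = ?g and F = "L <+> I", OF _ finite_J _ submod_cotree_lattice])
    show "finite (L <+> I)" using fL finite_I by simp
    show "?g i \<in> supported J" if "i \<in> L <+> I" for i
      using that LJ A_supported by (auto simp: unit_chain_supported)
    show "?g i \<in> cotree_lattice L" if "i \<in> L <+> I" for i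
    proof -
      have "unit_chain b \<in> cotree_lattice L" if "b \<in> L" for b
        using cotree_latticeI[OF _ submod_0[OF submod_im], of "unit_chain b" L] that
        by (simp add: unit_chain_supported)
      moreover have "A (unit_chain b) \<in> cotree_lattice L" if "b \<in> I" for b
        using cotree_latticeI[OF submod_0[OF submod_supported], of "A (unit_chain b)" L] that
        by (simp add: im_def unit_chain_supported)
      ultimately show ?thesis using that by (elim PlusE) simp_all
    qed
    fix z :: "'c \<Rightarrow> int" assume "z \<in> supported J"
    then have "(\<lambda>s. real_of_int (z s)) \<in> supported J" by (auto simp: supported_def)
    then obtain u where u: "u \<in> supported L" "(\<lambda>s. real_of_int (z s)) - u \<in> im"
      using L unfolding complements_def by blast
    then obtain x where x: "x \<in> supported I" "(\<lambda>s. real_of_int (z s)) - u = A x" by (auto simp: im_def)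
    (* The generators are the unit vectors of L and the columns of the matrix. *)
    have "real_of_int (z s) = (\<Sum>i\<in>L <+> I. case_sum u x i * real_of_int (?g i s))" for s
    proof -
      have "(\<Sum>i\<in>L <+> I. case_sum u x i * real_of_int (?g i s))
          = (\<Sum>b\<in>L. u b * real_of_int (unit_chain b s)) + (\<Sum>b\<in>I. x b * A (unit_chain b) s)"
        using fL finite_I by (simp add: sum.Plus A_unit_of_int)
      also have "(\<Sum>b\<in>I. x b * A (unit_chain b) s) = A x s"
        using A_expansion[OF order_refl x(1)] by simp
      also have "(\<Sum>b\<in>L. u b * real_of_int (unit_chain b s)) = u s"
        using fun_cong[OF chain_expansion[OF fL u(1)], of s]
        by (simp add: sum_fun_apply unit_chain_def if_distrib cong: if_cong)
      finally show ?thesis using fun_cong[OF x(2), of s] by simp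
    qed
    then show "\<exists>x. \<forall>s. real_of_int (z s) = (\<Sum>i\<in>L <+> I. x i * real_of_int (?g i s))"
      by (intro exI[of _ "case_sum u x"] allI)
  qed
qed

end

section \<open>The pseudo-inverse as a weighted average\<close>

context int_matrix begin

abbreviation trees :: "'c set set" where
  "trees \<equiv> {T. complements (ker :: ('c \<Rightarrow> real) set) I T}"

abbreviation cotrees :: "'c set set" where
  "cotrees \<equiv> {L. complements (im :: ('c \<Rightarrow> real) set) J L}"

lemma finite_trees: "finite trees"
  using finite_I by (rule finite_subset[rotated, OF finite_Pow_iff[THEN iffD2]]) (auto simp: complements_def)

lemma finite_cotrees: "finite cotrees"
  using finite_J by (rule finite_subset[rotated, OF finite_Pow_iff[THEN iffD2]]) (auto simp: complements_def)

text \<open>\<open>\<sigma> L T\<close> is the preimage on the tree \<open>T\<close> of the component of \<open>v\<close> in the image along the co-tree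
  \<open>L\<close>. Averaging over \<open>T\<close> does not change images under \<open>A\<close>, so the residual of \<open>u\<close> is an average
  of projections to co-trees along the image; and for a fixed \<open>L\<close> the \<open>\<sigma> L T\<close> are the projections
  to the trees along the kernel of one and the same chain. Both averages are covered by
  \<open>averaged_projection_orthogonal\<close>.\<close>

theorem weighted_average_normal_equations:
  fixes xW yW xE yE :: "'c \<Rightarrow> real" and v :: "'c \<Rightarrow> real" and \<sigma> :: "'c set \<Rightarrow> 'c set \<Rightarrow> 'c \<Rightarrow> real"
  assumes W: "\<And>b. b \<in> I \<Longrightarrow> xW b * yW b = 1" "\<And>b. yW b > 0"
    and E: "\<And>f. f \<in> J \<Longrightarrow> xE f * yE f = 1" "\<And>f. yE f > 0"
    and v: "v \<in> supported J"
    and \<sigma>: "\<And>L T. L \<in> cotrees \<Longrightarrow> T \<in> trees \<Longrightarrow> \<sigma> L T \<in> supported T \<and> A (\<sigma> L T) = v - proj im L v"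
  defines "w T \<equiv> (real (tree_lattice_index T))\<^sup>2 * (\<Prod>b\<in>T. yW b)"
    and "\<tau> L \<equiv> (real (cotree_lattice_index L))\<^sup>2 * (\<Prod>f\<in>L. yE f)"
  defines "u \<equiv> \<lambda>b. 1 / ((\<Sum>T\<in>trees. w T) * (\<Sum>L\<in>cotrees. \<tau> L)) *
    (\<Sum>L\<in>cotrees. \<Sum>T\<in>trees. \<tau> L * w T * \<sigma> L T b)"
  shows "u \<in> supported I"
    and "\<And>u'. u' \<in> supported I \<Longrightarrow> (\<Sum>f\<in>J. xE f * (A u f - v f) * A u' f) = 0"
    and "\<And>z. z \<in> ker \<Longrightarrow> (\<Sum>b\<in>I. xW b * u b * z b) = 0"
proof -
  let ?D = "\<Sum>T\<in>trees. w T" and ?N = "\<Sum>L\<in>cotrees. \<tau> L"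
  have "?D > 0"
  proof (rule sum_pos[OF finite_trees])
    show "trees \<noteq> {}" using complement_exists[OF finite_I submod_ker] by blast
    show "w T > 0" if "T \<in> trees" for T
      using that tree_lattice_index_positive[of T] W(2) by (auto simp: w_def intro!: mult_pos_pos prod_pos)
  qed
  then have D_nz: "?D \<noteq> 0" by simp
  have "?N > 0"
  proof (rule sum_pos[OF finite_cotrees])
    show "cotrees \<noteq> {}" using complement_exists[OF finite_J submod_im] by blast
    show "\<tau> L > 0" if "L \<in> cotrees" for L
      using that cotree_lattice_index_positive[of L] E(2) by (auto simp: \<tau>_def intro!: mult_pos_pos prod_pos)
  qed
  then have N_nz: "?N \<noteq> 0" by simp
  have TI: "T \<subseteq> I" if "T \<in> trees" for T using that by (simp add: complements_def)
  show "u \<in> supported I"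
  proof -
    have "\<sigma> L T b = 0" if "L \<in> cotrees" "T \<in> trees" "b \<notin> I" for L T b
      using \<sigma>[OF that(1,2)] TI[OF that(2)] that(3) by (auto simp: supported_def)
    then show ?thesis by (auto simp: supported_def u_def)
  qed
  have u_pairs: "u = (\<lambda>b. \<Sum>p\<in>cotrees \<times> trees. (1 / (?D * ?N) * (\<tau> (fst p) * w (snd p))) * \<sigma> (fst p) (snd p) b)"
    unfolding u_def by (simp add: sum_distrib_left sum.cartesian_product case_prod_unfold mult.assoc)
  have Au: "A u f - v f = - (1 / ?N) * (\<Sum>L\<in>cotrees. \<tau> L * proj im L v f)" for f
  proof -
    have "A u f = (\<Sum>p\<in>cotrees \<times> trees. (1 / (?D * ?N) * (\<tau> (fst p) * w (snd p))) * A (\<sigma> (fst p) (snd p)) f)"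
      unfolding u_pairs by (simp only: A_sum)
    also have "\<dots> = (\<Sum>p\<in>cotrees \<times> trees. (1 / (?D * ?N) * (\<tau> (fst p) * w (snd p))) * (v f - proj im (fst p) v f))"
      by (rule sum.cong) (auto simp: \<sigma>)
    also have "\<dots> = (\<Sum>L\<in>cotrees. \<Sum>T\<in>trees. (1 / (?D * ?N) * (\<tau> L * w T)) * (v f - proj im L v f))"
      by (simp add: sum.cartesian_product case_prod_unfold)
    also have "\<dots> = (\<Sum>L\<in>cotrees. 1 / (?D * ?N) * \<tau> L * (v f - proj im L v f) * ?D)"
    proof (rule sum.cong[OF refl])
      fix L
      have "1 / (?D * ?N) * \<tau> L * (v f - proj im L v f) * ?D
          = (\<Sum>T\<in>trees. (1 / (?D * ?N) * \<tau> L * (v f - proj im L v f)) * w T)"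
        by (rule sum_distrib_left)
      also have "\<dots> = (\<Sum>T\<in>trees. (1 / (?D * ?N) * (\<tau> L * w T)) * (v f - proj im L v f))"
        by (rule sum.cong[OF refl]) (simp only: mult_ac)
      finally show "(\<Sum>T\<in>trees. (1 / (?D * ?N) * (\<tau> L * w T)) * (v f - proj im L v f))
          = 1 / (?D * ?N) * \<tau> L * (v f - proj im L v f) * ?D" by (rule sym)
    qed
    also have "\<dots> = (\<Sum>L\<in>cotrees. 1 / ?N * (\<tau> L * v f - \<tau> L * proj im L v f))"
      using D_nz N_nz by (intro sum.cong) (auto simp: field_simps)
    also have "\<dots> = 1 / ?N * (?N * v f - (\<Sum>L\<in>cotrees. \<tau> L * proj im L v f))"
      by (simp only: sum_distrib_left[symmetric] sum_subtractf sum_distrib_right[symmetric])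
    also have "\<dots> = v f - 1 / ?N * (\<Sum>L\<in>cotrees. \<tau> L * proj im L v f)"
      using N_nz by (simp add: field_simps)
    finally show ?thesis by simp
  qed
  show "(\<Sum>f\<in>J. xE f * (A u f - v f) * A u' f) = 0" if u': "u' \<in> supported I" for u'
  proof -
    have "(\<Sum>f\<in>J. xE f * (A u f - v f) * A u' f)
        = (\<Sum>f\<in>J. - (1 / ?N) * (\<Sum>L\<in>cotrees. \<tau> L * (xE f * proj im L v f * A u' f)))"
      unfolding Au by (rule sum.cong[OF refl]) (simp add: sum_distrib_left sum_distrib_right mult_ac)
    also have "\<dots> = - (1 / ?N) * (\<Sum>L\<in>cotrees. \<tau> L * (\<Sum>f\<in>J. xE f * proj im L v f * A u' f))"
      by (simp only: sum_distrib_left[symmetric] sum.swap[of _ cotrees J])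
    also have "(\<Sum>L\<in>cotrees. \<tau> L * (\<Sum>f\<in>J. xE f * proj im L v f * A u' f)) = 0"
      unfolding \<tau>_def using E(1) u'
      by (intro averaged_projection_orthogonal finite_J submod_im im_supported v cotree_compatibility)
        (auto simp: im_def)
    finally show ?thesis by simp
  qed
  show "(\<Sum>b\<in>I. xW b * u b * z b) = 0" if z: "z \<in> ker" for z
  proof -
    have zero: "(\<Sum>T\<in>trees. w T * (\<Sum>b\<in>I. xW b * \<sigma> L T b * z b)) = 0" if L: "L \<in> cotrees" for L
    proof -
      obtain T0 where T0: "T0 \<in> trees" using complement_exists[OF finite_I submod_ker] by blast
      let ?c = "\<sigma> L T0"
      have c: "?c \<in> supported I" using \<sigma>[OF L T0] supported_mono[OF TI[OF T0]] by blast
      have p: "proj ker T ?c = \<sigma> L T" if T: "T \<in> trees" for T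
      proof (rule proj_unique[OF submod_ker])
        show "complements (ker :: ('c \<Rightarrow> real) set) I T" using T by simp
        show "\<sigma> L T \<in> supported T" using \<sigma>[OF L T] by simp
        have "\<sigma> L T \<in> supported I" using \<sigma>[OF L T] supported_mono[OF TI[OF T]] by blast
        then show "?c - \<sigma> L T \<in> ker"
          using c \<sigma>[OF L T] \<sigma>[OF L T0] submod_diff[OF submod_supported] by (simp add: ker_def A_diff)
      qed
      have "(\<Sum>T\<in>trees. w T * (\<Sum>b\<in>I. xW b * \<sigma> L T b * z b))
          = (\<Sum>T\<in>trees. w T * (\<Sum>b\<in>I. xW b * proj ker T ?c b * z b))"
        by (rule sum.cong[OF refl]) (simp add: p)
      also have "\<dots> = 0"
        unfolding w_def using W(1) z
        by (intro averaged_projection_orthogonal finite_I submod_ker ker_supported c tree_compatibility) auto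
      finally show ?thesis .
    qed
    define c where "c = 1 / (?D * ?N)"
    have "(\<Sum>b\<in>I. xW b * u b * z b)
        = (\<Sum>b\<in>I. \<Sum>L\<in>cotrees. \<Sum>T\<in>trees. c * \<tau> L * (w T * (xW b * \<sigma> L T b * z b)))"
      unfolding u_def c_def[symmetric]
      by (rule sum.cong[OF refl]) (simp add: sum_distrib_left sum_distrib_right mult_ac)
    also have "\<dots> = (\<Sum>L\<in>cotrees. \<Sum>b\<in>I. \<Sum>T\<in>trees. c * \<tau> L * (w T * (xW b * \<sigma> L T b * z b)))"
      by (rule sum.swap)
    also have "\<dots> = (\<Sum>L\<in>cotrees. \<Sum>T\<in>trees. \<Sum>b\<in>I. c * \<tau> L * (w T * (xW b * \<sigma> L T b * z b)))"
      by (intro sum.cong[OF refl] sum.swap)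
    also have "\<dots> = (\<Sum>L\<in>cotrees. c * \<tau> L * (\<Sum>T\<in>trees. w T * (\<Sum>b\<in>I. xW b * \<sigma> L T b * z b)))"
      by (simp only: sum_distrib_left)
    also have "\<dots> = 0" using zero by (intro sum.neutral) simp
    finally show ?thesis .
  qed
qed

text \<open>Pythagoras, twice: the residual of \<open>u\<close> is orthogonal to the image, so the least squares
  solutions are the chains that differ from \<open>u\<close> by an element of the kernel; and \<open>u\<close> is orthogonal
  to the kernel, so it is the only shortest one among them.\<close>

lemma pseudo_inverse_eqI:
  fixes xW xE v u :: "'c \<Rightarrow> real"
  assumes W: "\<And>b. b \<in> I \<Longrightarrow> xW b > 0" and E: "\<And>f. f \<in> J \<Longrightarrow> xE f > 0"
    and u: "u \<in> supported I"
    and normal: "\<And>u'. u' \<in> supported I \<Longrightarrow> (\<Sum>f\<in>J. xE f * (A u f - v f) * A u' f) = 0"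
    and orth: "\<And>z. z \<in> ker \<Longrightarrow> (\<Sum>b\<in>I. xW b * u b * z b) = 0"
  shows "pseudo_inverse (supported I) (\<lambda>x. sqrt (\<Sum>b\<in>I. xW b * x b * x b))
    (\<lambda>y. sqrt (\<Sum>f\<in>J. xE f * y f * y f)) A v = u"
proof -
  define nW where "nW x = (\<Sum>b\<in>I. xW b * x b * x b)" for x
  define nE where "nE y = (\<Sum>f\<in>J. xE f * y f * y f)" for y
  have nE0: "nE y \<ge> 0" for y
    unfolding nE_def using E by (intro sum_nonneg) (simp add: mult.assoc less_imp_le)
  have nW0: "nW x \<ge> 0" for x
    unfolding nW_def using W by (intro sum_nonneg) (simp add: mult.assoc less_imp_le)
  have nE_zero: "y f = 0" if "nE y \<le> 0" "f \<in> J" for y f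
  proof -
    have "(\<Sum>f\<in>J. xE f * y f * y f) = 0" using that(1) nE0[of y] by (simp add: nE_def)
    then have "xE f * y f * y f = 0"
      using that(2) finite_J E by (subst (asm) sum_nonneg_eq_0_iff) (auto simp: mult.assoc less_imp_le)
    then show ?thesis using E[OF that(2)] by auto
  qed
  have nW_zero: "x b = 0" if "nW x \<le> 0" "b \<in> I" for x b
  proof -
    have "(\<Sum>b\<in>I. xW b * x b * x b) = 0" using that(1) nW0[of x] by (simp add: nW_def)
    then have "xW b * x b * x b = 0"
      using that(2) finite_I W by (subst (asm) sum_nonneg_eq_0_iff) (auto simp: mult.assoc less_imp_le)
    then show ?thesis using W[OF that(2)] by auto
  qed
  have pythE: "nE (\<lambda>s. A x s - v s) = nE (\<lambda>s. A u s - v s) + nE (A (x - u))" if x: "x \<in> supported I" for x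
  proof -
    have d: "x - u \<in> supported I" using x u by (rule submod_diff[OF submod_supported])
    have "nE (\<lambda>s. A x s - v s)
        = (\<Sum>f\<in>J. (xE f * (A u f - v f) * (A u f - v f) + xE f * A (x - u) f * A (x - u) f)
            + 2 * (xE f * (A u f - v f) * A (x - u) f))"
      unfolding nE_def A_diff by (rule sum.cong) (auto simp: algebra_simps)
    also have "\<dots> = nE (\<lambda>s. A u s - v s) + nE (A (x - u)) + 2 * (\<Sum>f\<in>J. xE f * (A u f - v f) * A (x - u) f)"
      by (simp only: sum.distrib nE_def sum_distrib_left[symmetric])
    finally show ?thesis using normal[OF d] by simp
  qed
  have pythW: "nW x = nW u + nW (x - u)" if "x - u \<in> ker" for x
  proof -
    have "nW x = (\<Sum>b\<in>I. (xW b * u b * u b + xW b * (x - u) b * (x - u) b) + 2 * (xW b * u b * (x - u) b))"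
      unfolding nW_def by (rule sum.cong) (auto simp: algebra_simps)
    also have "\<dots> = nW u + nW (x - u) + 2 * (\<Sum>b\<in>I. xW b * u b * (x - u) b)"
      by (simp only: sum.distrib nW_def sum_distrib_left[symmetric])
    finally show ?thesis using orth[OF that] by simp
  qed
  let ?LS = "least_squares (supported I) (\<lambda>y. sqrt (nE y)) A v"
  have LS_iff: "x \<in> ?LS \<longleftrightarrow> x \<in> supported I \<and> (\<forall>x'\<in>supported I. nE (\<lambda>s. A x s - v s) \<le> nE (\<lambda>s. A x' s - v s))" for x
    by (simp add: least_squares_def)
  have "nE (\<lambda>s. A u s - v s) \<le> nE (\<lambda>s. A x s - v s)" if "x \<in> supported I" for x
    using pythE[OF that] nE0[of "A (x - u)"] by linarith
  then have uLS: "u \<in> ?LS" unfolding LS_iff using u by blast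
  have LS_ker: "x - u \<in> ker" if "x \<in> ?LS" for x
  proof -
    have x: "x \<in> supported I" and le: "nE (\<lambda>s. A x s - v s) \<le> nE (\<lambda>s. A u s - v s)"
      using that u unfolding LS_iff by blast+
    have "nE (A (x - u)) \<le> 0" using pythE[OF x] le by simp
    then have "A (x - u) f = 0" for f
      using nE_zero[of "A (x - u)" f] A_supported[of "x - u"] by (cases "f \<in> J") (auto simp: supported_def)
    then have "A (x - u) = 0" by (simp add: fun_eq_iff)
    then show ?thesis using submod_diff[OF submod_supported x u] by (simp add: ker_def)
  qed
  have "(THE x. x \<in> ?LS \<and> (\<forall>x'\<in>?LS. sqrt (nW x) \<le> sqrt (nW x'))) = u"
  proof (rule the_equality)
    show "u \<in> ?LS \<and> (\<forall>x'\<in>?LS. sqrt (nW u) \<le> sqrt (nW x'))"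
    proof (intro conjI ballI uLS)
      fix x assume "x \<in> ?LS"
      from pythW[OF LS_ker[OF this]] nW0[of "x - u"] show "sqrt (nW u) \<le> sqrt (nW x)" by simp
    qed
    fix x assume x: "x \<in> ?LS \<and> (\<forall>x'\<in>?LS. sqrt (nW x) \<le> sqrt (nW x'))"
    then have "nW x \<le> nW u" using uLS by auto
    moreover have "nW x = nW u + nW (x - u)" using x by (intro pythW LS_ker) blast
    ultimately have "nW (x - u) \<le> 0" by linarith
    then have z: "(x - u) b = 0" if "b \<in> I" for b using nW_zero that by blast
    have "x - u \<in> supported I" using LS_ker x ker_supported by blast
    then have "(x - u) b = 0" for b using z by (cases "b \<in> I") (simp_all add: supported_def)
    then show "x = u" by (simp add: fun_eq_iff)
  qed
  then show ?thesis unfolding pseudo_inverse_def nW_def nE_def .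
qed

end

section \<open>Dimensions of quotient spaces\<close>

text \<open>By the rank theorem the kernel has dimension 0. Dimension is defined as the least size of a
  finite generating set, so the kernel must also be seen to be finitely generated: a maximal
  independent subset is finite because it is independent in \<open>V\<close>.\<close>

lemma (in linear_map) surj_dim_eq_imp_inj:
  assumes fd: "V.fin_dim" and surj: "T ` carrier V = carrier W" and dim: "V.dim = W.dim"
  shows "inj_on T (carrier V)"
proof -
  have sub: "subspace K kerT V" by (rule kerT_is_subspace)
  then interpret Ker: vectorspace K "V.vs kerT" by (rule V.subspace_is_vs)
  have "kerT \<subseteq> carrier V" by (auto simp: ker_def)
  have "submodule K kerT V" using sub by (simp add: subspace_def)
  have li: "V.module.lin_indpt S" if "S \<subseteq> kerT" "Ker.module.lin_indpt S" for S
    using V.module.span_li_not_depend(2)[OF that(1) \<open>submodule K kerT V\<close>] that(2) by simp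
  have "\<exists>S. finite S \<and> maximal S (\<lambda>S. S \<subseteq> carrier (V.vs kerT) \<and> Ker.module.lin_indpt S)"
  proof (rule maximal_exists)
    fix S assume S: "S \<subseteq> carrier (V.vs kerT) \<and> Ker.module.lin_indpt S"
    then have "S \<subseteq> carrier V" "V.module.lin_indpt S" using \<open>kerT \<subseteq> carrier V\<close> li by auto
    then show "finite S \<and> card S \<le> V.dim" using V.li_le_dim[OF fd] by blast
  next
    show "{} \<subseteq> carrier (V.vs kerT) \<and> Ker.module.lin_indpt {}" by (auto simp: Ker.lin_dep_def)
  qed
  then obtain S where S: "finite S" "maximal S (\<lambda>S. S \<subseteq> carrier (V.vs kerT) \<and> Ker.module.lin_indpt S)" by blast
  have basis: "Ker.basis S" by (rule Ker.max_li_is_basis[OF S(2)])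
  have "vectorspace.dim K (W.vs imT) + Ker.dim = V.dim" by (rule rank_nullity[OF fd])
  moreover have "imT = carrier W" by (rule surj_imp_imT_carrier[OF surj])
  ultimately have "Ker.dim = 0" using dim by simp
  then have "S = {}" using Ker.dim_basis[OF S(1) basis] S(1) by simp
  then have "carrier (V.vs kerT) = {\<zero>\<^bsub>V\<^esub>}"
    using basis unfolding Ker.basis_def by (simp add: Ker.span_empty)
  then show ?thesis by (rule Ke0_imp_inj)
qed

lemma field_coeff_ring: "field (coeff_ring :: 'r::field ring)"
proof (rule cring.cring_fieldI2)
  show "cring (coeff_ring :: 'r ring)"
    by (intro cringI abelian_groupI comm_monoidI)
      (auto simp: coeff_ring_def algebra_simps intro: exI[of _ "- _"] add.left_inverse add.right_inverse)
  show "\<zero>\<^bsub>coeff_ring\<^esub> \<noteq> \<one>\<^bsub>coeff_ring :: 'r ring\<^esub>" by (simp add: coeff_ring_def)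
  fix a :: 'r assume "a \<in> carrier coeff_ring" "a \<noteq> \<zero>\<^bsub>coeff_ring\<^esub>"
  then show "\<exists>b\<in>carrier coeff_ring. a \<otimes>\<^bsub>coeff_ring\<^esub> b = \<one>\<^bsub>coeff_ring\<^esub>"
    by (intro bexI[of _ "inverse a"]) (auto simp: coeff_ring_def)
qed

lemma coset_zero: "submod B \<Longrightarrow> coset B 0 = B"
  by (auto simp: in_coset_iff)

lemma coset_add:
  assumes "submod B"
  shows "{\<lambda>s. p s + q s | p q. p \<in> coset B x \<and> q \<in> coset B y} = coset B (x + y)"
proof (intro equalityI subsetI)
  fix z assume "z \<in> {\<lambda>s. p s + q s | p q. p \<in> coset B x \<and> q \<in> coset B y}"
  then obtain p q where pq: "z = p + q" "p - x \<in> B" "q - y \<in> B"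
    by (auto simp: in_coset_iff plus_fun_def)
  have "z - (x + y) = (p - x) + (q - y)" by (simp add: pq)
  also have "\<dots> \<in> B" by (rule submod_add[OF assms pq(2,3)])
  finally show "z \<in> coset B (x + y)" by (simp only: in_coset_iff)
next
  fix z assume "z \<in> coset B (x + y)"
  then have "z - y - x \<in> B" by (simp add: in_coset_iff algebra_simps)
  moreover have "y - y \<in> B" using submod_0[OF assms] by simp
  moreover have "z = (\<lambda>s. (z - y) s + y s)" by (simp add: fun_eq_iff)
  ultimately show "z \<in> {\<lambda>s. p s + q s | p q. p \<in> coset B x \<and> q \<in> coset B y}"
    unfolding mem_Collect_eq in_coset_iff by blast
qed

lemma coset_scale:
  assumes "submod B"
  shows "(\<Union>p\<in>coset B x. coset B (\<lambda>s. a * p s)) = coset B (\<lambda>s. a * x s)"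
proof -
  have "coset B (\<lambda>s. a * p s) = coset B (\<lambda>s. a * x s)" if "p \<in> coset B x" for p
  proof -
    have "(\<lambda>s. a * p s) - (\<lambda>s. a * x s) = (\<lambda>s. a * (p - x) s)" by (auto simp: fun_eq_iff algebra_simps)
    also have "\<dots> \<in> B" using that by (intro submod_scale[OF assms]) (simp only: in_coset_iff)
    finally show ?thesis by (simp add: coset_eq_iff[OF assms])
  qed
  moreover have "x \<in> coset B x" using submod_0[OF assms] by (simp add: in_coset_iff)
  ultimately show ?thesis by blast
qed

lemma coset_coset:
  assumes B: "submod B" and sub: "B' \<subseteq> B"  "submod B'"
  shows "(\<Union>z\<in>coset B' x. coset B z) = coset B x"
proof -
  have "coset B z = coset B x" if "z \<in> coset B' x" for z
    using that sub by (auto simp: coset_eq_iff[OF B] in_coset_iff)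
  moreover have "x \<in> coset B' x" using submod_0[OF sub(2)] by (simp add: in_coset_iff)
  ultimately show ?thesis by blast
qed

lemma quotient_module_simps:
  assumes "submod B"
  shows "carrier (quotient_module Z B) = coset B ` Z"
    and "\<zero>\<^bsub>quotient_module Z B\<^esub> = coset B 0"
    and "coset B x \<oplus>\<^bsub>quotient_module Z B\<^esub> coset B y = coset B (x + y)"
    and "a \<odot>\<^bsub>quotient_module Z B\<^esub> coset B x = coset B (\<lambda>s. a * x s)"
  using assms by (simp_all add: quotient_module_def coset_zero coset_add coset_scale)

lemma module_quotient:
  fixes Z B :: "('c \<Rightarrow> 'r::field) set"
  assumes Z: "submod Z" and B: "submod B"
  shows "module (coeff_ring :: 'r ring) (quotient_module Z B)"
proof (rule moduleI)
  note [simp] = quotient_module_simps[OF B]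
  interpret F: field "coeff_ring :: 'r ring" by (rule field_coeff_ring)
  show "cring (coeff_ring :: 'r ring)" by (rule F.is_cring)
  show "abelian_group (quotient_module Z B)"
  proof (rule abelian_groupI)
    fix x assume "x \<in> carrier (quotient_module Z B)"
    then obtain z where z: "z \<in> Z" "x = coset B z" by auto
    show "\<exists>y\<in>carrier (quotient_module Z B). y \<oplus>\<^bsub>quotient_module Z B\<^esub> x = \<zero>\<^bsub>quotient_module Z B\<^esub>"
      by (rule bexI[of _ "coset B (- z)"]) (simp_all add: z submod_uminus[OF Z])
  qed (auto simp: ac_simps intro!: submod_add[OF Z] submod_0[OF Z] imageI)
qed (auto simp: quotient_module_simps[OF B] coeff_ring_def algebra_simps plus_fun_def
      intro!: submod_scale[OF Z] imageI)

lemma vectorspace_quotient: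
  "submod Z \<Longrightarrow> submod B \<Longrightarrow> vectorspace (coeff_ring :: 'r::field ring) (quotient_module Z B)"
  by (simp add: vectorspace_def module_quotient field_coeff_ring)

text \<open>The unit vectors need not lie in \<open>Z\<close>, but their projections to \<open>Z\<close> along a coordinate complement
  do, and they generate \<open>Z\<close>.\<close>

lemma fin_dim_quotient:
  fixes Z B :: "('c \<Rightarrow> 'r::field) set"
  assumes J: "finite J" and Z: "submod Z" "Z \<subseteq> supported J" and B: "submod B"
  shows "vectorspace.fin_dim (coeff_ring :: 'r ring) (quotient_module Z B)"
proof -
  let ?V = "quotient_module Z B"
  interpret V: vectorspace "coeff_ring :: 'r ring" ?V by (rule vectorspace_quotient[OF Z(1) B])
  note simps = quotient_module_simps[OF B, of Z]
  obtain T where T: "complements Z J T" using complement_exists[OF J Z(1)] by blast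
  define g where "g t = unit_chain t - proj Z T (unit_chain t)" for t
  have g: "g t \<in> Z" if "t \<in> J" for t
    unfolding g_def using that by (intro proj_diff[OF Z(1) T]) (simp add: unit_chain_supported)
  let ?S = "(\<lambda>t. coset B (g t)) ` J"
  have S: "?S \<subseteq> carrier ?V" using g by (auto simp: simps)
  interpret span: submodule "coeff_ring :: 'r ring" "V.span ?S" ?V by (rule V.span_is_submodule[OF S])
  have in_span: "coset B (\<Sum>t\<in>J'. (\<lambda>s. z t * g t s)) \<in> V.span ?S" if "J' \<subseteq> J" for J' and z :: "'c \<Rightarrow> 'r"
    using finite_subset[OF that J] that
  proof (induction J')
    case empty
    have "\<zero>\<^bsub>?V\<^esub> \<in> V.span ?S" using span.zero_closed by simp
    moreover have "(\<Sum>t\<in>{}. (\<lambda>s. z t * g t s)) = 0" by (rule sum.empty)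
    ultimately show ?case by (simp only: simps)
  next
    case (insert t J')
    have "coset B (g t) \<in> V.span ?S" using V.in_own_span[OF S] insert.prems by blast
    then have "z t \<odot>\<^bsub>?V\<^esub> coset B (g t) \<in> V.span ?S"
      by (intro span.smult_closed) (simp_all add: coeff_ring_def)
    moreover have "coset B (\<Sum>t\<in>J'. (\<lambda>s. z t * g t s)) \<in> V.span ?S" using insert by simp
    ultimately have "z t \<odot>\<^bsub>?V\<^esub> coset B (g t) \<oplus>\<^bsub>?V\<^esub> coset B (\<Sum>t\<in>J'. (\<lambda>s. z t * g t s)) \<in> V.span ?S"
      by (rule span.m_closed)
    then show ?case by (simp only: simps sum.insert[OF insert.hyps(1,2)])
  qed
  have "carrier ?V \<subseteq> V.span ?S"
  proof
    fix x assume "x \<in> carrier ?V"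
    then obtain z where z: "z \<in> Z" "x = coset B z" by (auto simp: simps)
    then have zJ: "z \<in> supported J" using Z(2) by blast
    have "z = (\<Sum>t\<in>J. (\<lambda>s. z t * g t s))"
    proof
      fix s
      have "(\<Sum>t\<in>J. z t * g t s) = (\<Sum>t\<in>J. z t * unit_chain t s) - (\<Sum>t\<in>J. z t * proj Z T (unit_chain t) s)"
        by (simp add: g_def algebra_simps sum_subtractf)
      also have "(\<Sum>t\<in>J. z t * proj Z T (unit_chain t) s) = proj Z T z s"
        by (rule proj_expansion[OF J Z(1) T zJ, symmetric])
      also have "\<dots> = 0" using proj_kernel[OF Z(1) T z(1)] by simp
      also have "(\<Sum>t\<in>J. z t * unit_chain t s) = z s"
        using fun_cong[OF chain_expansion[OF J zJ], of s] by (simp add: sum_fun_apply)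
      finally show "z s = (\<Sum>t\<in>J. (\<lambda>s. z t * g t s)) s" by (simp add: sum_fun_apply)
    qed
    then show "x \<in> V.span ?S" using in_span[OF order_refl, of z] z(2) by simp
  qed
  then have "V.gen_set ?S" using V.span_is_subset2[OF S] by blast
  then show ?thesis unfolding V.fin_dim_def using S J by blast
qed

text \<open>The quotient by \<open>B\<close> maps onto the quotient by the larger \<open>C\<close>. This is how equality of Betti
  numbers turns into equality of boundary groups.\<close>

lemma dim_quotient_eq_iff:
  fixes Z B C :: "('c \<Rightarrow> 'r::field) set"
  assumes J: "finite J" and Z: "submod Z" "Z \<subseteq> supported J"
    and B: "submod B" and C: "submod C" and sub: "B \<subseteq> C" "C \<subseteq> Z"
  shows "vectorspace.dim (coeff_ring :: 'r ring) (quotient_module Z B)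
       = vectorspace.dim (coeff_ring :: 'r ring) (quotient_module Z C) \<longleftrightarrow> B = C"
proof
  assume dim: "vectorspace.dim (coeff_ring :: 'r ring) (quotient_module Z B)
       = vectorspace.dim (coeff_ring :: 'r ring) (quotient_module Z C)"
  let ?V = "quotient_module Z B" and ?W = "quotient_module Z C"
  define f where "f P = (\<Union>z\<in>P. coset C z)" for P
  have f: "f (coset B z) = coset C z" for z unfolding f_def by (rule coset_coset[OF C sub(1) B])
  note VB = quotient_module_simps[OF B, of Z] and VC = quotient_module_simps[OF C, of Z]
  have hom: "f \<in> module_hom (coeff_ring :: 'r ring) ?V ?W"
    unfolding module_hom_def by (auto simp: VB VC f)
  interpret linear_map "coeff_ring :: 'r ring" ?V ?W f
    using hom by (intro linear_map.intro mod_hom.intro mod_hom_axioms.intro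
        vectorspace_quotient module_quotient Z B C)
  have "inj_on f (carrier ?V)"
  proof (rule surj_dim_eq_imp_inj[OF fin_dim_quotient[OF J Z B] _ dim])
    show "f ` carrier ?V = carrier ?W" by (simp add: VB VC image_image f)
  qed
  have "c \<in> B" if c: "c \<in> C" for c
  proof -
    have "f (coset B c) = f (coset B 0)" using c by (simp add: f coset_eq_iff[OF C])
    moreover have "coset B c \<in> carrier ?V" "coset B 0 \<in> carrier ?V"
      using c sub submod_0[OF Z(1)] by (auto simp: VB)
    ultimately have "coset B c = coset B 0" using \<open>inj_on f (carrier ?V)\<close> by (meson inj_onD)
    then show ?thesis by (simp add: coset_eq_iff[OF B])
  qed
  then show "B = C" using sub by blast
qed simp

section \<open>Subcomplexes and cellular homology in coordinates\<close>

lemma chains_supported: "chains X K n = supported (cells_of X K n)"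
  by (simp add: chains_def supported_def)

lemma boundary_matrix_map: "boundary X n = matrix_map (incidence X n) (cw_cells X n) (cw_cells X (n - 1))"
  by (auto simp: boundary_def matrix_map_def fun_eq_iff)

context finite_cw begin

lemma cells_of_empty [simp]: "cells_of X {} n = {}"
  using open_cell_nonempty by (auto simp: cells_of_def)

lemma cells_of_topspace [simp]: "cells_of X (topspace (cw_top X)) n = cw_cells X n"
  using open_cell_subset by (auto simp: cells_of_def)

lemma cells_of_subset: "cells_of X K n \<subseteq> cw_cells X n"
  by (auto simp: cells_of_def)

lemma cells_of_partial_skeleton:
  assumes "F \<subseteq> cw_cells X n" shows "cells_of X (partial_skeleton n F) n = F"
proof
  show "cells_of X (partial_skeleton n F) n \<subseteq> F"
    using open_cell_partial_disjoint[OF _ assms] open_cell_nonempty unfolding cells_of_def by blast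
  show "F \<subseteq> cells_of X (partial_skeleton n F) n"
    using assms by (auto simp: cells_of_def partial_skeleton_def)
qed

lemma cells_of_partial_skeleton_low:
  assumes "k < n" shows "cells_of X (partial_skeleton n F) k = cw_cells X k"
proof -
  have "open_cell X k s \<subseteq> skeleton X (n - 1)" if "s \<in> cw_cells X k" for s
    using that assms unfolding skeleton_def by force
  then show ?thesis by (auto simp: cells_of_def partial_skeleton_def)
qed

lemma cells_of_partial_skeleton_high:
  assumes "F \<subseteq> cw_cells X n" "n < k" shows "cells_of X (partial_skeleton n F) k = {}"
proof -
  have "partial_skeleton n F \<subseteq> skeleton X n"
    using partial_skeleton_mono[OF assms(1)] partial_skeleton_full by blast
  then show ?thesis
    using open_cell_skeleton_disjoint[OF _ assms(2)] open_cell_nonempty unfolding cells_of_def by blast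
qed

text \<open>Trees and co-trees are defined as sets of points; this makes them sets of cells.\<close>

lemma subcomplex_between_skeleta:
  "subcomplex X T \<and> skeleton X (n - 1) \<subseteq> T \<and> T \<subseteq> skeleton X n \<longleftrightarrow>
    (\<exists>F\<subseteq>cw_cells X n. T = partial_skeleton n F)"
proof
  assume T: "subcomplex X T \<and> skeleton X (n - 1) \<subseteq> T \<and> T \<subseteq> skeleton X n"
  let ?F = "cells_of X T n"
  have T_cells: "T = (\<Union>k. \<Union>s\<in>cells_of X T k. open_cell X k s)"
    using T by (simp add: subcomplex_def)
  have "T \<subseteq> partial_skeleton n ?F"
  proof
    fix x assume x: "x \<in> T"
    then obtain k s where ks: "s \<in> cells_of X T k" "x \<in> open_cell X k s" using T_cells by blast
    then have s: "s \<in> cw_cells X k" by (simp add: cells_of_def)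
    have "k \<le> n"
    proof (rule ccontr)
      assume "\<not> k \<le> n"
      then have "open_cell X k s \<inter> skeleton X n = {}" by (intro open_cell_skeleton_disjoint[OF s]) simp
      then show False using ks(2) x T by blast
    qed
    then consider "k \<le> n - 1" | "k = n" by linarith
    then show "x \<in> partial_skeleton n ?F"
    proof cases
      case 1
      then have "x \<in> skeleton X (n - 1)" using ks s unfolding skeleton_def by blast
      then show ?thesis unfolding partial_skeleton_def by blast
    next
      case 2
      then show ?thesis using ks unfolding partial_skeleton_def by blast
    qed
  qed
  moreover have "partial_skeleton n ?F \<subseteq> T"
    using T unfolding partial_skeleton_def cells_of_def by blast
  ultimately have "T = partial_skeleton n ?F" by (rule subset_antisym)
  then show "\<exists>F\<subseteq>cw_cells X n. T = partial_skeleton n F"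
    by (intro exI[of _ ?F] conjI cells_of_subset)
next
  assume "\<exists>F\<subseteq>cw_cells X n. T = partial_skeleton n F"
  then obtain F where F: "F \<subseteq> cw_cells X n" "T = partial_skeleton n F" by blast
  have "T \<subseteq> (\<Union>k. \<Union>s\<in>cells_of X T k. open_cell X k s)"
  proof
    fix x assume "x \<in> T"
    then consider "x \<in> skeleton X (n - 1)" | s where "s \<in> F" "x \<in> open_cell X n s"
      unfolding F(2) partial_skeleton_def by blast
    then show "x \<in> (\<Union>k. \<Union>s\<in>cells_of X T k. open_cell X k s)"
    proof cases
      case 1
      then obtain k s where k: "k \<le> n - 1" "s \<in> cw_cells X k" "x \<in> open_cell X k s"
        unfolding skeleton_def by blast
      then have "s \<in> cells_of X T k" unfolding F(2) using cells_of_partial_skeleton_low[of k n F] by simp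
      then show ?thesis using k by blast
    next
      case 2
      then have "s \<in> cells_of X T n" unfolding F(2) using cells_of_partial_skeleton[OF F(1)] by simp
      then show ?thesis using 2 by blast
    qed
  qed
  moreover have "(\<Union>k. \<Union>s\<in>cells_of X T k. open_cell X k s) \<subseteq> T" by (auto simp: cells_of_def)
  ultimately have "subcomplex X T"
    using closedin_partial_skeleton[OF F(1)] F(2) unfolding subcomplex_def by auto
  then show "subcomplex X T \<and> skeleton X (n - 1) \<subseteq> T \<and> T \<subseteq> skeleton X n"
    using skeleton_subset_partial partial_skeleton_mono[OF F(1), of n] F(2) partial_skeleton_full by auto
qed

lemma inj_partial_skeleton: "inj_on (partial_skeleton n) (Pow (cw_cells X n))"
  by (rule inj_on_inverseI[where g = "\<lambda>T. cells_of X T n"]) (simp add: cells_of_partial_skeleton)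

lemma boundary_boundary: "boundary X (n - 1) (boundary X n c) = (0 :: 'c \<Rightarrow> 'r::comm_ring_1)"
proof
  fix g
  show "boundary X (n - 1) (boundary X n c) g = (0 :: 'c \<Rightarrow> 'r) g"
  proof (cases "g \<in> cw_cells X (n - 2)")
    case True
    have "boundary X (n - 1) (boundary X n c) g
        = (\<Sum>f\<in>cw_cells X (n - 1). \<Sum>b\<in>cw_cells X n. of_int (incidence X (n - 1) f g) * (of_int (incidence X n b f) * c b))"
      using True by (simp add: boundary_def sum_distrib_left)
    also have "\<dots> = (\<Sum>b\<in>cw_cells X n. \<Sum>f\<in>cw_cells X (n - 1). of_int (incidence X (n - 1) f g) * (of_int (incidence X n b f) * c b))"
      by (rule sum.swap)
    also have "\<dots> = (\<Sum>b\<in>cw_cells X n. of_int (\<Sum>f\<in>cw_cells X (n - 1). incidence X n b f * incidence X (n - 1) f g) * c b)"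
      by (simp add: sum_distrib_right sum_distrib_left mult_ac)
    also have "\<dots> = 0" using incidence_incidence[OF _ True] by simp
    finally show ?thesis by simp
  qed (simp add: boundary_def)
qed

end

locale cw_boundary = finite_cw X for X :: "('a, 'c) cw" +
  fixes d :: int
begin

sublocale int_matrix "incidence X d" "cw_cells X d" "cw_cells X (d - 1)"
  by unfold_locales (rule finite_cells)+

sublocale lower: int_matrix "incidence X (d - 1)" "cw_cells X (d - 1)" "cw_cells X (d - 2)"
  by unfold_locales (rule finite_cells)+

abbreviation "I \<equiv> cw_cells X d"
abbreviation "J \<equiv> cw_cells X (d - 1)"

lemma boundary_A: "boundary X d = A"
  by (rule boundary_matrix_map)

lemma boundary_lower: "boundary X (d - 1) = lower.A"
  using boundary_matrix_map[of X "d - 1"] by simp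

lemma im_subset_lower_ker: "(im :: ('c \<Rightarrow> 'r::comm_ring_1) set) \<subseteq> lower.ker"
proof
  fix x :: "'c \<Rightarrow> 'r" assume "x \<in> im"
  then obtain c where "x = A c" by (auto simp: im_def)
  then show "x \<in> lower.ker"
    using boundary_boundary[of d c] A_supported[of c]
    unfolding boundary_A boundary_lower by (simp add: lower.ker_def)
qed

lemma rel_cycles_eq:
  "rel_cycles X K {} n = {c \<in> supported (cells_of X K n). boundary X n c = 0}"
  by (auto simp: rel_cycles_def chains_supported supported_def fun_eq_iff)

lemma rel_boundaries_eq:
  "rel_boundaries X K {} n = boundary X (n + 1) ` supported (cells_of X K (n + 1))"
proof (intro equalityI subsetI)
  fix x assume "x \<in> boundary X (n + 1) ` supported (cells_of X K (n + 1))"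
  then obtain e where e: "e \<in> chains X K (n + 1)" "x = boundary X (n + 1) e"
    by (auto simp: chains_supported)
  show "x \<in> rel_boundaries X K {} n"
    unfolding rel_boundaries_def mem_Collect_eq
  proof (intro exI conjI)
    show "x = (\<lambda>s. boundary X (n + 1) e s + (0 :: 'c \<Rightarrow> _) s)" using e by simp
    show "0 \<in> chains X {} n" by (simp add: chains_def)
  qed (rule e)
qed (auto simp: rel_boundaries_def chains_supported supported_def)

lemma boundary_supported_empty: "boundary X n ` supported {} = {0}"
proof -
  have "supported {} = {0 :: 'c \<Rightarrow> 'b}" by (auto simp: supported_def fun_eq_iff)
  moreover have "boundary X n 0 = (0 :: 'c \<Rightarrow> 'b)" by (auto simp: boundary_def fun_eq_iff)
  ultimately show ?thesis by simp
qed

lemma homology_eq: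
  "homology X K n = quotient_module {c \<in> supported (cells_of X K n). boundary X n c = 0}
     (boundary X (n + 1) ` supported (cells_of X K (n + 1)))"
  by (simp add: rel_homology_def rel_cycles_eq rel_boundaries_eq)

lemma submod_zero: "submod {0}"
  by (auto simp: submod_def fun_eq_iff)

lemma coset_zero_set: "coset {0} z = {z}"
  by (auto simp: in_coset_iff)

lemma supported_subset_image:
  "S \<subseteq> S' \<Longrightarrow> matrix_map M P Q ` supported S \<subseteq> matrix_map M P Q ` supported S'"
  using supported_mono by blast

section \<open>Spanning trees are complements of the kernel\<close>

text \<open>The conditions on \<open>F\<close> express that the \<open>d\<close>-dimensional integral homology of the tree vanishes,
  and that tree and complex have the same boundaries.\<close>

lemma complements_ker_iff:
  "complements (ker :: ('c \<Rightarrow> rat) set) I F \<longleftrightarrow> F \<subseteq> I \<and>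
    {c \<in> supported F. A c = 0} \<subseteq> {0 :: 'c \<Rightarrow> int} \<and> A ` supported F = (A ` supported I :: ('c \<Rightarrow> rat) set)"
proof (cases "F \<subseteq> I")
  case F: True
  then have fin: "finite F" using finite_cells finite_subset by blast
  have FI: "supported F \<subseteq> (supported I :: ('c \<Rightarrow> rat) set)" using F by (rule supported_mono)
  have "supported F \<inter> ker \<subseteq> {0 :: 'c \<Rightarrow> rat} \<longleftrightarrow> {c \<in> supported F. A c = 0} \<subseteq> {0 :: 'c \<Rightarrow> int}"
  proof
    assume q: "supported F \<inter> ker \<subseteq> {0 :: 'c \<Rightarrow> rat}"
    show "{c \<in> supported F. A c = 0} \<subseteq> {0 :: 'c \<Rightarrow> int}"
    proof
      fix c :: "'c \<Rightarrow> int" assume c: "c \<in> {c \<in> supported F. A c = 0}"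
      then have "(\<lambda>s. of_int (c s) :: rat) \<in> supported F" by (simp add: supported_def)
      moreover have "A (\<lambda>s. of_int (c s) :: rat) = 0" using c unfolding A_of_int by (auto simp: fun_eq_iff)
      ultimately have "(\<lambda>s. of_int (c s) :: rat) = 0" using q FI by (auto simp: ker_def)
      then show "c \<in> {0}" by (simp add: fun_eq_iff)
    qed
  next
    assume z: "{c \<in> supported F. A c = 0} \<subseteq> {0 :: 'c \<Rightarrow> int}"
    show "supported F \<inter> ker \<subseteq> {0 :: 'c \<Rightarrow> rat}"
    proof
      fix u :: "'c \<Rightarrow> rat" assume u: "u \<in> supported F \<inter> ker"
      then have uF: "u \<in> supported F" by blast
      obtain p :: int and m where m: "p > 0" "m \<in> supported F" "\<And>s. of_int (m s) = of_int p * u s"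
        by (rule clear_denominators[OF fin uF]) blast
      have "of_int (A m f) = (0 :: rat)" for f
      proof -
        have "(\<lambda>f. of_int (A m f) :: rat) = A (\<lambda>s. of_int p * u s)"
          unfolding m(3)[symmetric] A_of_int ..
        also have "\<dots> = (\<lambda>f. of_int p * A u f)" by (rule A_scale)
        finally show ?thesis using u by (simp add: ker_def fun_eq_iff)
      qed
      then have "A m = 0" by (simp add: fun_eq_iff)
      then have "m = 0" using z m(2) by blast
      then have "of_int p * u s = 0" for s using m(3)[of s] by simp
      then show "u \<in> {0}" using m(1) by (simp add: fun_eq_iff)
    qed
  qed
  moreover have "(\<forall>c\<in>supported I. \<exists>u\<in>supported F. c - u \<in> (ker :: ('c \<Rightarrow> rat) set)) \<longleftrightarrow> A ` supported F = (A ` supported I :: ('c \<Rightarrow> rat) set)"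
  proof
    assume span: "\<forall>c\<in>supported I. \<exists>u\<in>supported F. c - u \<in> (ker :: ('c \<Rightarrow> rat) set)"
    have "A c \<in> A ` supported F" if "c \<in> supported I" for c :: "'c \<Rightarrow> rat"
      using span that by (auto simp: ker_def A_diff)
    then show "A ` supported F = (A ` supported I :: ('c \<Rightarrow> rat) set)"
      by (rule subset_antisym[OF image_mono[OF FI] image_subsetI])
  next
    assume im: "A ` supported F = (A ` supported I :: ('c \<Rightarrow> rat) set)"
    show "\<forall>c\<in>supported I. \<exists>u\<in>supported F. c - u \<in> (ker :: ('c \<Rightarrow> rat) set)"
    proof
      fix c :: "'c \<Rightarrow> rat" assume c: "c \<in> supported I"
      then have "A c \<in> A ` supported F" unfolding im by (rule imageI)
      then obtain u where u: "u \<in> supported F" "A c = A u" by (elim imageE)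
      then have "c - u \<in> supported I" using c FI submod_diff[OF submod_supported, of c I u] by blast
      then show "\<exists>u\<in>supported F. c - u \<in> ker" using u by (auto simp: ker_def A_diff)
    qed
  qed
  ultimately show ?thesis by (simp only: complements_def F simp_thms)
qed (simp add: complements_def)

text \<open>A tree has no cells of dimension \<open>d + 1\<close> and the same cells as the complex below dimension \<open>d\<close>.
  So its homology in degree \<open>d\<close> consists of cycles, and in degree \<open>d - 1\<close> it has the cycles of the
  complex modulo fewer boundaries.\<close>

lemma spanning_tree_partial:
  assumes F: "F \<subseteq> I"
  shows "spanning_tree X d (partial_skeleton d F) \<longleftrightarrow> complements (ker :: ('c \<Rightarrow> real) set) I F"
proof -
  let ?T = "partial_skeleton d F"
  have top: "homology X ?T d = quotient_module {c \<in> supported F. A c = 0} {0 :: 'c \<Rightarrow> int}"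
    unfolding homology_eq cells_of_partial_skeleton[OF F]
    using cells_of_partial_skeleton_high[OF F, of "d + 1"]
    by (simp add: boundary_supported_empty boundary_A)
  have "carrier (homology X ?T d :: (int, ('c \<Rightarrow> int) set) module)
       = {\<zero>\<^bsub>(homology X ?T d :: (int, ('c \<Rightarrow> int) set) module)\<^esub>}
      \<longleftrightarrow> (\<lambda>z. {z}) ` {c \<in> supported F. A c = 0} = {{0 :: 'c \<Rightarrow> int}}"
    unfolding top by (simp add: quotient_module_simps[OF submod_zero] coset_zero_set)
  also have "\<dots> \<longleftrightarrow> {c \<in> supported F. A c = 0} \<subseteq> {0 :: 'c \<Rightarrow> int}"
  proof -
    have "0 \<in> {c \<in> supported F. A c = (0 :: 'c \<Rightarrow> int)}" using submod_0[OF submod_supported] by simp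
    then show ?thesis by blast
  qed
  finally have H: "carrier (homology X ?T d :: (int, ('c \<Rightarrow> int) set) module)
       = {\<zero>\<^bsub>(homology X ?T d :: (int, ('c \<Rightarrow> int) set) module)\<^esub>}
      \<longleftrightarrow> {c \<in> supported F. A c = 0} \<subseteq> {0 :: 'c \<Rightarrow> int}" .
  have cells_low: "cells_of X ?T (d - 1) = J" by (rule cells_of_partial_skeleton_low) simp
  have betti: "betti X ?T (d - 1) = betti X (topspace (cw_top X)) (d - 1) \<longleftrightarrow>
      A ` supported F = (A ` supported I :: ('c \<Rightarrow> rat) set)"
    unfolding betti_def homology_eq cells_low cells_of_topspace
    using cells_of_partial_skeleton[OF F]
  proof (simp add: boundary_A boundary_lower, intro dim_quotient_eq_iff[OF finite_cells[of "d - 1"]])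
    have Z: "{c \<in> supported J. lower.A c = 0} = (lower.ker :: ('c \<Rightarrow> rat) set)" by (auto simp: lower.ker_def)
    show "submod {c \<in> supported J. lower.A c = (0 :: 'c \<Rightarrow> rat)}" unfolding Z by (rule lower.submod_ker)
    show "A ` supported I \<subseteq> {c \<in> supported J. lower.A c = (0 :: 'c \<Rightarrow> rat)}"
      unfolding Z using im_subset_lower_ker by (simp add: im_def)
  qed (auto intro: submod_image supported_subset_image[OF F, THEN subsetD])
  have "subcomplex X ?T \<and> skeleton X (d - 1) \<subseteq> ?T \<and> ?T \<subseteq> skeleton X d"
    by (rule subcomplex_between_skeleta[THEN iffD2]) (use F in blast)
  then show ?thesis
    unfolding spanning_tree_def complements_ker_rat_real complements_ker_iff
    by (simp only: H betti F simp_thms)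
qed

lemma spanning_trees: "{T. spanning_tree X d T} = partial_skeleton d ` trees"
proof (intro equalityI subsetI)
  fix T assume "T \<in> {T. spanning_tree X d T}"
  then have T: "spanning_tree X d T" by simp
  then obtain F where F: "F \<subseteq> I" "T = partial_skeleton d F"
    using subcomplex_between_skeleta[of T d] unfolding spanning_tree_def by blast
  then show "T \<in> partial_skeleton d ` trees" using T spanning_tree_partial by blast
next
  fix T assume "T \<in> partial_skeleton d ` trees"
  then obtain F where "F \<in> trees" "T = partial_skeleton d F" by blast
  then show "T \<in> {T. spanning_tree X d T}" using spanning_tree_partial[of F] by (auto simp: complements_def)
qed

text \<open>Tree and complex have the same rational boundaries, so up to a multiple they have the same
  integral ones.\<close>

lemma saturation_tree:
  assumes F: "complements (ker :: ('c \<Rightarrow> real) set) I F" and z: "z \<in> saturation"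
  shows "\<exists>k. k \<noteq> 0 \<and> (\<lambda>s. k * z s) \<in> A ` (supported F :: ('c \<Rightarrow> int) set)"
proof -
  have "F \<subseteq> I" using F by (simp add: complements_def)
  then have fin: "finite F" using finite_cells finite_subset by blast
  have im: "A ` supported F = (A ` supported I :: ('c \<Rightarrow> rat) set)"
    using F by (simp only: complements_ker_rat_real complements_ker_iff)
  obtain k x where k: "k \<noteq> 0" "x \<in> supported I" "(\<lambda>s. k * z s) = A x"
    using z by (auto simp: saturation_def im_def)
  have "(\<lambda>s. of_int (x s) :: rat) \<in> supported I" using k(2) by (simp add: supported_def)
  then have "A (\<lambda>s. of_int (x s) :: rat) \<in> A ` supported F" unfolding im by (rule imageI)
  then obtain u where u: "u \<in> supported F" "A (\<lambda>s. of_int (x s) :: rat) = A u" by (elim imageE)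
  obtain p :: int and m where m: "p > 0" "m \<in> supported F" "\<And>s. of_int (m s) = of_int p * u s"
    by (rule clear_denominators[OF fin u(1)]) blast
  have "(\<lambda>s. (p * k) * z s) = A m"
  proof
    fix s
    have "(of_int (A m s) :: rat) = A (\<lambda>s. of_int (m s)) s" by (simp only: A_of_int)
    also have "\<dots> = of_int p * A u s" unfolding m(3) A_scale ..
    also have "A u s = of_int (A x s)" unfolding u(2)[symmetric] A_of_int ..
    also have "A x s = k * z s" using fun_cong[OF k(3), of s] by simp
    finally have "(of_int (A m s) :: rat) = of_int ((p * k) * z s)" by simp
    then show "(p * k) * z s = A m s" by (simp only: of_int_eq_iff)
  qed
  then show ?thesis using m(1,2) k(1) by (intro exI[of _ "p * k"]) (auto intro!: image_eqI)
qed

text \<open>A chain with a nonzero multiple that is a boundary is a cycle, because integers have no zero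
  divisors. Hence the torsion classes are represented by the whole \<open>saturation\<close>, which is the same
  for all trees.\<close>

lemma tree_torsion_eq:
  assumes F: "complements (ker :: ('c \<Rightarrow> real) set) I F"
  shows "tree_torsion X d (partial_skeleton d F) = tree_lattice_index F"
proof -
  have FI: "F \<subseteq> I" using F by (simp add: complements_def)
  let ?B = "A ` (supported F :: ('c \<Rightarrow> int) set)"
  let ?Z = "{c \<in> supported J. lower.A c = (0 :: 'c \<Rightarrow> int)}"
  let ?H = "quotient_module ?Z ?B"
  have B: "submod ?B" by (rule submod_image)
  have H: "homology X (partial_skeleton d F) (d - 1) = ?H"
    using cells_of_partial_skeleton[OF FI] cells_of_partial_skeleton_low[of "d - 1" d F]
    by (simp add: homology_eq boundary_A boundary_lower)
  have "torsion ?H = coset ?B ` {z \<in> ?Z. \<exists>k. k \<noteq> 0 \<and> (\<lambda>s. k * z s) \<in> ?B}"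
  proof -
    have "k \<odot>\<^bsub>?H\<^esub> coset ?B z = \<zero>\<^bsub>?H\<^esub> \<longleftrightarrow> (\<lambda>s. k * z s) \<in> ?B" for k z
      by (simp add: quotient_module_simps[OF B] coset_eq_iff[OF B])
    then show ?thesis unfolding torsion_def quotient_module_simps(1)[OF B] by blast
  qed
  also have "{z \<in> ?Z. \<exists>k. k \<noteq> 0 \<and> (\<lambda>s. k * z s) \<in> ?B} = saturation"
  proof (intro equalityI subsetI)
    fix z assume "z \<in> {z \<in> ?Z. \<exists>k. k \<noteq> 0 \<and> (\<lambda>s. k * z s) \<in> ?B}"
    then show "z \<in> saturation"
      using supported_mono[OF FI] unfolding saturation_def im_def by blast
  next
    fix z assume z: "z \<in> saturation"
    then obtain k where k: "k \<noteq> 0" "(\<lambda>s. k * z s) \<in> im" and zJ: "z \<in> supported J"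
      by (auto simp: saturation_def)
    have "lower.A (\<lambda>s. k * z s) = 0" using im_subset_lower_ker k(2) by (auto simp: lower.ker_def)
    then have "lower.A z = 0" using k(1) unfolding lower.A_scale by (simp add: fun_eq_iff)
    then show "z \<in> {z \<in> ?Z. \<exists>k. k \<noteq> 0 \<and> (\<lambda>s. k * z s) \<in> ?B}"
      using zJ saturation_tree[OF F z] by simp
  qed
  finally show ?thesis
    unfolding tree_torsion_def H tree_lattice_index_def index_def by (rule arg_cong)
qed

end

context cw_boundary begin

section \<open>Spanning co-trees are complements of the image\<close>

abbreviation cycles_on :: "'c set \<Rightarrow> ('c \<Rightarrow> 'r::comm_ring_1) set" where
  "cycles_on F \<equiv> {c \<in> supported F. lower.A c = 0}"

text \<open>The first two conditions express that the inclusion of the co-tree induces an isomorphism in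
  homology of degree \<open>d - 1\<close>, the last one that co-tree and complex have the same boundaries in
  degree \<open>d - 2\<close>. Given a chain \<open>c\<close>, the last condition provides a chain on the co-tree with the
  same boundary; the difference is a cycle, and by the second condition it is homologous to a
  cycle on the co-tree.\<close>

lemma complements_im_iff:
  "complements (im :: ('c \<Rightarrow> rat) set) J F \<longleftrightarrow> F \<subseteq> J \<and>
    inj_on (coset (im :: ('c \<Rightarrow> rat) set)) (cycles_on F) \<and> coset (im :: ('c \<Rightarrow> rat) set) ` cycles_on F = coset im ` cycles_on J \<and>
    lower.A ` supported F = (lower.A ` supported J :: ('c \<Rightarrow> rat) set)"
proof (cases "F \<subseteq> J")
  case F: True
  let ?im = "im :: ('c \<Rightarrow> rat) set"
  have FJ: "supported F \<subseteq> (supported J :: ('c \<Rightarrow> rat) set)" using F by (rule supported_mono)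
  have im_cyc: "lower.A c = 0" if "c \<in> ?im" for c
    using im_subset_lower_ker that by (auto simp: lower.ker_def)
  show ?thesis
  proof
    assume C: "complements ?im J F"
    have inj: "inj_on (coset ?im) (cycles_on F)"
    proof (rule inj_onI)
      fix x y assume xy: "x \<in> cycles_on F" "y \<in> cycles_on F" "coset ?im x = coset ?im y"
      then have "x - y \<in> supported F \<inter> ?im"
        using submod_diff[OF submod_supported, of x F y] by (simp add: coset_eq_iff[OF submod_im])
      then have "x - y = 0" using C unfolding complements_def by blast
      then show "x = y" by simp
    qed
    have surj: "coset ?im c \<in> coset ?im ` cycles_on F" if c: "c \<in> cycles_on J" for c
    proof -
      obtain u where u: "u \<in> supported F" "c - u \<in> ?im" using C c unfolding complements_def by blast
      have "lower.A u = 0" using im_cyc[OF u(2)] c by (simp add: lower.A_diff)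
      then show ?thesis using u by (intro image_eqI[of _ _ u]) (simp_all add: coset_eq_iff[OF submod_im])
    qed
    have low: "lower.A c \<in> lower.A ` supported F" if c: "c \<in> supported J" for c :: "'c \<Rightarrow> rat"
    proof -
      obtain u where u: "u \<in> supported F" "c - u \<in> ?im" using C c unfolding complements_def by blast
      have "lower.A c = lower.A u" using im_cyc[OF u(2)] by (simp add: lower.A_diff)
      then show ?thesis using u(1) by (rule image_eqI)
    qed
    have "coset ?im ` cycles_on F \<subseteq> coset ?im ` cycles_on J" using FJ by (intro image_mono) auto
    then have "coset ?im ` cycles_on F = coset ?im ` cycles_on J"
      by (rule subset_antisym[OF _ image_subsetI]) (rule surj)
    moreover have "lower.A ` supported F = (lower.A ` supported J :: ('c \<Rightarrow> rat) set)"
      by (rule subset_antisym[OF image_mono[OF FJ] image_subsetI]) (rule low)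
    ultimately show "F \<subseteq> J \<and> inj_on (coset ?im) (cycles_on F) \<and> coset ?im ` cycles_on F = coset im ` cycles_on J \<and>
        lower.A ` supported F = (lower.A ` supported J :: ('c \<Rightarrow> rat) set)" using F inj by (intro conjI)
  next
    assume R: "F \<subseteq> J \<and> inj_on (coset ?im) (cycles_on F) \<and> coset ?im ` cycles_on F = coset im ` cycles_on J \<and>
        lower.A ` supported F = (lower.A ` supported J :: ('c \<Rightarrow> rat) set)"
    then have inj: "inj_on (coset ?im) (cycles_on F)" by (elim conjE)
    from R have surj: "coset ?im ` cycles_on F = coset ?im ` cycles_on J" by (elim conjE)
    from R have low: "lower.A ` supported F = (lower.A ` supported J :: ('c \<Rightarrow> rat) set)" by (elim conjE)
    show "complements ?im J F"
      unfolding complements_def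
    proof (intro conjI ballI F subsetI)
      fix c assume c: "c \<in> supported F \<inter> ?im"
      then have "c \<in> cycles_on F" using im_cyc by simp
      moreover have "(0 :: 'c \<Rightarrow> rat) \<in> cycles_on F" using submod_0[OF submod_supported] by simp
      moreover have "coset ?im c = coset ?im 0" using c by (simp add: coset_eq_iff[OF submod_im])
      ultimately have "c = 0" by (intro inj_onD[OF inj])
      then show "c \<in> {0}" by simp
    next
      fix c :: "'c \<Rightarrow> rat" assume c: "c \<in> supported J"
      then have "lower.A c \<in> lower.A ` supported F" unfolding low by (rule imageI)
      then obtain c' where c': "c' \<in> supported F" "lower.A c = lower.A c'" by (elim imageE)
      have "c - c' \<in> supported J" using c c' FJ submod_diff[OF submod_supported, of c J c'] by blast
      then have "c - c' \<in> cycles_on J" using c' by (simp add: lower.A_diff)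
      then have "coset ?im (c - c') \<in> coset ?im ` cycles_on F" unfolding surj by (rule imageI)
      then obtain u where u: "u \<in> cycles_on F" "coset ?im (c - c') = coset ?im u" by (elim imageE)
      have "c - (c' + u) = (c - c') - u" by simp
      also have "\<dots> \<in> ?im" using u(2) by (simp only: coset_eq_iff[OF submod_im])
      finally show "\<exists>u\<in>supported F. c - u \<in> ?im"
        using submod_add[OF submod_supported c'(1), of u] u(1) by blast
    qed
  qed
qed (simp add: complements_def)

text \<open>A co-tree has no \<open>d\<close>-cells, so its homology classes in degree \<open>d - 1\<close> are singletons.\<close>

lemma spanning_cotree_partial:
  assumes F: "F \<subseteq> J"
  shows "spanning_cotree X d (partial_skeleton (d - 1) F) \<longleftrightarrow> complements (im :: ('c \<Rightarrow> real) set) J F"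
proof -
  let ?L = "partial_skeleton (d - 1) F" and ?im = "im :: ('c \<Rightarrow> rat) set"
  have im: "boundary X d ` supported I = (im :: ('c \<Rightarrow> 'r::comm_ring_1) set)"
    by (simp add: boundary_A im_def)
  have HL: "homology X ?L (d - 1) = quotient_module (cycles_on F) {0 :: 'c \<Rightarrow> rat}"
    using cells_of_partial_skeleton[OF F] cells_of_partial_skeleton_high[OF F, of d]
    by (simp add: homology_eq boundary_supported_empty boundary_lower)
  have HX: "homology X (topspace (cw_top X)) (d - 1) = quotient_module (cycles_on J) ?im"
    by (simp add: homology_eq im boundary_lower)
  have map: "inclusion_map X (d - 1) {z} = coset ?im z" for z
    by (simp add: inclusion_map_def rel_boundaries_eq im)
  note q0 = quotient_module_simps[OF submod_zero, unfolded coset_zero_set]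
    and q = quotient_module_simps[OF submod_im]
  have sub: "cycles_on F \<subseteq> (cycles_on J :: ('c \<Rightarrow> rat) set)" using supported_mono[OF F] by blast
  have hom: "inclusion_map X (d - 1) \<in> module_hom (coeff_ring :: rat ring)
      (homology X ?L (d - 1)) (homology X (topspace (cw_top X)) (d - 1))"
    unfolding HL HX module_hom_def mem_Collect_eq
  proof (intro conjI allI impI)
    show "inclusion_map X (d - 1) \<in> carrier (quotient_module (cycles_on F) {0})
        \<rightarrow> carrier (quotient_module (cycles_on J) ?im)"
      using sub by (auto simp: q0 q map)
  next
    fix m1 m2 assume "m1 \<in> carrier (quotient_module (cycles_on F) {0 :: 'c \<Rightarrow> rat}) \<and>
      m2 \<in> carrier (quotient_module (cycles_on F) {0 :: 'c \<Rightarrow> rat})"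
    then obtain x y where "m1 = {x}" "m2 = {y}" by (auto simp: q0)
    then show "inclusion_map X (d - 1) (m1 \<oplus>\<^bsub>quotient_module (cycles_on F) {0}\<^esub> m2)
      = inclusion_map X (d - 1) m1 \<oplus>\<^bsub>quotient_module (cycles_on J) ?im\<^esub> inclusion_map X (d - 1) m2"
      by (simp only: q0 q map)
  next
    fix r :: rat and m assume "r \<in> carrier coeff_ring \<and> m \<in> carrier (quotient_module (cycles_on F) {0 :: 'c \<Rightarrow> rat})"
    then obtain x where "m = {x}" by (auto simp: q0)
    then show "inclusion_map X (d - 1) (r \<odot>\<^bsub>quotient_module (cycles_on F) {0}\<^esub> m)
      = r \<odot>\<^bsub>quotient_module (cycles_on J) ?im\<^esub> inclusion_map X (d - 1) m"
      by (simp only: q0 q map)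
  qed
  have bij: "bij_betw (inclusion_map X (d - 1)) (carrier (homology X ?L (d - 1) :: (rat, ('c \<Rightarrow> rat) set) module))
       (carrier (homology X (topspace (cw_top X)) (d - 1)))
    \<longleftrightarrow> inj_on (coset ?im) (cycles_on F) \<and> coset ?im ` cycles_on F = coset ?im ` cycles_on J"
  proof -
    have "inj_on (\<lambda>z::'c \<Rightarrow> rat. {z}) (cycles_on F)" by (rule inj_onI) simp
    then have "inj_on (inclusion_map X (d - 1)) ((\<lambda>z::'c \<Rightarrow> rat. {z}) ` cycles_on F) \<longleftrightarrow> inj_on (coset ?im) (cycles_on F)"
      by (subst comp_inj_on_iff) (simp_all add: o_def map)
    moreover have "inclusion_map X (d - 1) ` (\<lambda>z::'c \<Rightarrow> rat. {z}) ` cycles_on F = coset ?im ` cycles_on F"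
      by (simp add: image_image map)
    ultimately show ?thesis unfolding HL HX q0 q bij_betw_def by simp
  qed
  have betti: "betti X ?L (d - 2) = betti X (topspace (cw_top X)) (d - 2) \<longleftrightarrow>
      lower.A ` supported F = (lower.A ` supported J :: ('c \<Rightarrow> rat) set)"
  proof -
    let ?P = "cw_cells X (d - 2)"
    interpret low2: int_matrix "incidence X (d - 2)" ?P "cw_cells X (d - 3)"
      by unfold_locales (rule finite_cells)+
    let ?Z = "low2.ker :: ('c \<Rightarrow> rat) set"
    have bd: "boundary X (d - 2) = low2.A" using boundary_matrix_map[of X "d - 2"] by simp
    have Z: "{c \<in> supported ?P. boundary X (d - 2) c = 0} = ?Z" by (simp add: low2.ker_def bd)
    have cells: "cells_of X ?L (d - 2) = ?P" by (rule cells_of_partial_skeleton_low) simp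
    have e: "d - 2 + 1 = d - 1" by simp
    have 1: "homology X ?L (d - 2) = quotient_module ?Z (lower.A ` supported F)"
      unfolding homology_eq cells Z e cells_of_partial_skeleton[OF F] boundary_lower ..
    have 2: "homology X (topspace (cw_top X)) (d - 2) = quotient_module ?Z (lower.A ` supported J)"
      unfolding homology_eq cells_of_topspace Z e boundary_lower ..
    have "lower.A ` supported J \<subseteq> ?Z"
    proof (rule image_subsetI)
      fix c :: "'c \<Rightarrow> rat"
      show "lower.A c \<in> ?Z"
        using boundary_boundary[of "d - 1" c] lower.A_supported[of c]
        by (simp add: bd boundary_lower low2.ker_def)
    qed
    then show ?thesis
      unfolding betti_def 1 2
      by (intro dim_quotient_eq_iff[OF finite_cells low2.submod_ker low2.ker_supported
            lower.submod_image lower.submod_image supported_subset_image[OF F]])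
  qed
  have "subcomplex X ?L \<and> skeleton X (d - 2) \<subseteq> ?L \<and> ?L \<subseteq> skeleton X (d - 1)"
    using subcomplex_between_skeleta[THEN iffD2, of "d - 1" ?L] F by auto
  then show ?thesis
    unfolding spanning_cotree_def complements_im_rat_real complements_im_iff
    by (simp only: hom bij betti F simp_thms conj_assoc)
qed

lemma spanning_cotrees: "{L. spanning_cotree X d L} = partial_skeleton (d - 1) ` cotrees"
proof (intro equalityI subsetI)
  fix L assume "L \<in> {L. spanning_cotree X d L}"
  then have L: "spanning_cotree X d L" by simp
  have e: "d - 1 - 1 = d - 2" by simp
  obtain F where F: "F \<subseteq> J" "L = partial_skeleton (d - 1) F"
    using subcomplex_between_skeleta[of L "d - 1"] L unfolding spanning_cotree_def e by blast
  then show "L \<in> partial_skeleton (d - 1) ` cotrees" using L spanning_cotree_partial by blast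
next
  fix L assume "L \<in> partial_skeleton (d - 1) ` cotrees"
  then obtain F where "F \<in> cotrees" "L = partial_skeleton (d - 1) F" by blast
  then show "L \<in> {L. spanning_cotree X d L}" using spanning_cotree_partial[of F] by (auto simp: complements_def)
qed

text \<open>A co-tree contains all cells of dimension \<open>d - 2\<close>, so every \<open>(d - 1)\<close>-chain is a relative cycle.\<close>

lemma cotree_index_eq:
  assumes F: "F \<subseteq> J"
  shows "cotree_index X d (partial_skeleton (d - 1) F) = cotree_lattice_index F"
proof -
  let ?L = "partial_skeleton (d - 1) F" and ?X = "topspace (cw_top X)"
  have low: "cells_of X ?L (d - 2) = cw_cells X (d - 2)" by (rule cells_of_partial_skeleton_low) simp
  have e: "d - 1 - 1 = d - 2" "d - 1 + 1 = d" by simp_all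
  have Z: "rel_cycles X ?X ?L (d - 1) = (supported J :: ('c \<Rightarrow> int) set)"
    unfolding rel_cycles_def chains_supported e low cells_of_topspace boundary_lower
    using lower.A_supported by blast
  have B: "rel_boundaries X ?X ?L (d - 1) = cotree_lattice F"
  proof -
    have "rel_boundaries X ?X ?L (d - 1) = {A c + l | c l. c \<in> supported I \<and> l \<in> (supported F :: ('c \<Rightarrow> int) set)}"
      unfolding rel_boundaries_def chains_supported e cells_of_topspace boundary_A
        cells_of_partial_skeleton[OF F] plus_fun_def ..
    also have "\<dots> = {l + k | l k. l \<in> supported F \<and> k \<in> im}"
      unfolding im_def by (auto simp: add.commute)
    finally show ?thesis by (simp only: cotree_lattice_def)
  qed
  show ?thesis
    unfolding cotree_index_def rel_homology_def Z B quotient_module_simps(1)[OF submod_cotree_lattice]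
      cotree_lattice_index_def index_def ..
qed

section \<open>The pseudo-inverse of the boundary operator\<close>

lemma real_chains_eq: "real_chains X n = supported (cw_cells X n)"
  by (simp add: real_chains_def chains_supported)

lemma real_boundaries_eq: "real_boundaries X (d - 1) = (im :: ('c \<Rightarrow> real) set)"
  by (simp add: real_boundaries_def real_chains_eq boundary_A im_def)

text \<open>The element of the image that is congruent to \<open>v\<close> modulo chains on the co-tree is the
  complementary component of the projection to the co-tree.\<close>

lemma zeta_eq:
  assumes L: "L \<in> cotrees" and v: "v \<in> supported J"
  shows "zeta X d (partial_skeleton (d - 1) L) v = v - proj im L v"
proof -
  have LJ: "L \<subseteq> J" and C: "complements (im :: ('c \<Rightarrow> real) set) J L"
    using L by (auto simp: complements_def)
  let ?q = "coset (supported L :: ('c \<Rightarrow> real) set)"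
  have ch: "chains X (partial_skeleton (d - 1) L) (d - 1) = (supported L :: ('c \<Rightarrow> real) set)"
    by (simp add: chains_supported cells_of_partial_skeleton[OF LJ])
  let ?b = "inv_into im ?q (?q v)"
  have "?q v = ?q (v - proj im L v)"
    using proj_supported[OF submod_im C v] by (simp add: coset_eq_iff[OF submod_supported])
  then have mem: "?q v \<in> ?q ` im" using proj_diff[OF submod_im C v] by (rule image_eqI)
  have b: "?b \<in> im" by (rule inv_into_into[OF mem])
  have "?q v = ?q ?b" by (rule f_inv_into_f[OF mem, symmetric])
  then have "v - ?b \<in> supported L" by (simp only: coset_eq_iff[OF submod_supported])
  moreover have "v - (v - ?b) \<in> im" using b by simp
  ultimately have "proj im L v = v - ?b" by (rule proj_unique[OF submod_im C])
  then show ?thesis by (simp add: zeta_def ch real_boundaries_eq)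
qed

lemma sigma_eq:
  assumes L: "L \<in> cotrees" and T: "T \<in> trees" and v: "v \<in> supported J"
  defines "s \<equiv> sigma X d (partial_skeleton (d - 1) L) (partial_skeleton d T) v"
  shows "s \<in> supported T \<and> A s = v - proj im L v"
proof -
  have TI: "T \<subseteq> I" and C: "complements (ker :: ('c \<Rightarrow> real) set) I T"
    using T by (auto simp: complements_def)
  have ch: "chains X (partial_skeleton d T) d = (supported T :: ('c \<Rightarrow> real) set)"
    by (simp add: chains_supported cells_of_partial_skeleton[OF TI])
  have s: "s = inv_into (supported T) A (v - proj im L v)"
    unfolding s_def sigma_def o_def zeta_eq[OF L v] phi_def ch boundary_A ..
  have "v - proj im L v \<in> im" using L by (intro proj_diff[OF submod_im _ v]) simp
  then obtain x where x: "x \<in> supported I" "v - proj im L v = A x" by (auto simp: im_def)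
  obtain u where u: "u \<in> supported T" "x - u \<in> ker" using C x(1) unfolding complements_def by blast
  have "A x = A u" using u(2) by (simp add: ker_def A_diff)
  then have mem: "v - proj im L v \<in> A ` supported T" using x(2) u(1) by (intro image_eqI[of _ _ u]) simp_all
  show ?thesis unfolding s using inv_into_into[OF mem] f_inv_into_f[OF mem] by blast
qed

lemma cell_norm_eq: "cell_norm X n \<beta> F = (\<lambda>x. sqrt (\<Sum>s\<in>cw_cells X n. exp (\<beta> * F s) * x s * x s))"
  by (simp add: fun_eq_iff cell_norm_def cell_inner_def)

lemma sum_spanning_trees:
  "(\<Sum>T | spanning_tree X d T. f T) = (\<Sum>F\<in>trees. f (partial_skeleton d F))"
  unfolding spanning_trees
  by (rule sum.reindex_cong[OF inj_on_subset[OF inj_partial_skeleton]]) (auto simp: complements_def)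

lemma sum_spanning_cotrees:
  "(\<Sum>L | spanning_cotree X d L. f L) = (\<Sum>F\<in>cotrees. f (partial_skeleton (d - 1) F))"
  unfolding spanning_cotrees
  by (rule sum.reindex_cong[OF inj_on_subset[OF inj_partial_skeleton]]) (auto simp: complements_def)

lemma tree_weight_eq:
  "F \<in> trees \<Longrightarrow> tree_weight X d \<beta> W (partial_skeleton d F)
    = (real (tree_lattice_index F))\<^sup>2 * (\<Prod>b\<in>F. exp (- \<beta> * W b))"
  by (simp add: tree_weight_def tree_torsion_eq cells_of_partial_skeleton complements_def)

lemma cotree_weight_eq:
  "F \<in> cotrees \<Longrightarrow> cotree_weight X d \<beta> E (partial_skeleton (d - 1) F)
    = (real (cotree_lattice_index F))\<^sup>2 * (\<Prod>f\<in>F. exp (- \<beta> * E f))"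
  by (simp add: cotree_weight_def cotree_index_eq cells_of_partial_skeleton complements_def)

theorem boundary_pinv_eq:
  assumes v: "v \<in> real_chains X (d - 1)"
  shows "boundary_pinv X d \<beta> E W v =
    (\<lambda>b. 1 / (total_tree_weight X d \<beta> W * total_cotree_weight X d \<beta> E) *
      (\<Sum>L | spanning_cotree X d L. \<Sum>T | spanning_tree X d T.
        cotree_weight X d \<beta> E L * tree_weight X d \<beta> W T * sigma X d L T v b))"
proof -
  have v: "v \<in> supported J" using v by (simp add: real_chains_eq)
  let ?w = "\<lambda>T. (real (tree_lattice_index T))\<^sup>2 * (\<Prod>b\<in>T. exp (- \<beta> * W b))"
  let ?\<tau> = "\<lambda>L. (real (cotree_lattice_index L))\<^sup>2 * (\<Prod>f\<in>L. exp (- \<beta> * E f))"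
  let ?\<sigma> = "\<lambda>L T. sigma X d (partial_skeleton (d - 1) L) (partial_skeleton d T) v"
  let ?u = "\<lambda>b. 1 / ((\<Sum>T\<in>trees. ?w T) * (\<Sum>L\<in>cotrees. ?\<tau> L)) *
    (\<Sum>L\<in>cotrees. \<Sum>T\<in>trees. ?\<tau> L * ?w T * ?\<sigma> L T b)"
  have inverse_W: "exp (\<beta> * W b) * exp (- \<beta> * W b) = 1" and pos_W: "exp (- \<beta> * W b) > 0"
    and inverse_E: "exp (\<beta> * E b) * exp (- \<beta> * E b) = 1" and pos_E: "exp (- \<beta> * E b) > 0" for b
    by (simp_all flip: exp_add)
  have sig: "?\<sigma> L T \<in> supported T \<and> A (?\<sigma> L T) = v - proj im L v" if "L \<in> cotrees" "T \<in> trees" for L T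
    using that by (rule sigma_eq[OF _ _ v])
  note normal = weighted_average_normal_equations[where xW = "\<lambda>b. exp (\<beta> * W b)" and yW = "\<lambda>b. exp (- \<beta> * W b)"
      and xE = "\<lambda>f. exp (\<beta> * E f)" and yE = "\<lambda>f. exp (- \<beta> * E f)" and v = v and \<sigma> = ?\<sigma>,
      OF inverse_W pos_W inverse_E pos_E v sig]
  have "pseudo_inverse (supported I) (\<lambda>x. sqrt (\<Sum>b\<in>I. exp (\<beta> * W b) * x b * x b))
    (\<lambda>y. sqrt (\<Sum>f\<in>J. exp (\<beta> * E f) * y f * y f)) A v = ?u"
    by (rule pseudo_inverse_eqI[OF exp_gt_zero exp_gt_zero normal])
  moreover have "(\<Sum>T | spanning_tree X d T. tree_weight X d \<beta> W T) = (\<Sum>T\<in>trees. ?w T)"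
    unfolding sum_spanning_trees by (rule sum.cong[OF refl tree_weight_eq])
  moreover have "(\<Sum>L | spanning_cotree X d L. cotree_weight X d \<beta> E L) = (\<Sum>L\<in>cotrees. ?\<tau> L)"
    unfolding sum_spanning_cotrees by (rule sum.cong[OF refl cotree_weight_eq])
  moreover have "(\<Sum>L | spanning_cotree X d L. \<Sum>T | spanning_tree X d T.
        cotree_weight X d \<beta> E L * tree_weight X d \<beta> W T * sigma X d L T v b)
     = (\<Sum>L\<in>cotrees. \<Sum>T\<in>trees. ?\<tau> L * ?w T * ?\<sigma> L T b)" for b
    unfolding sum_spanning_cotrees sum_spanning_trees
    by (intro sum.cong refl arg_cong2[of _ _ _ _ "(*)"] cotree_weight_eq tree_weight_eq)
  ultimately show ?thesis
    unfolding boundary_pinv_def total_tree_weight_def total_cotree_weight_def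
      cell_norm_eq real_chains_eq boundary_A by simp
qed

end

theorem theorem6p1:
  fixes X :: "('a, 'c) cw" and d :: int and E W :: "'c \<Rightarrow> real" and \<beta> :: real
  assumes "finite_cw_complex X" and "connected_space (cw_top X)"
    and "1 \<le> d" and "d \<le> cw_dim X"
    and "\<beta> > 0"
  shows "\<forall>v\<in>real_chains X (d - 1). boundary_pinv X d \<beta> E W v =
    (\<lambda>b. 1 / (total_tree_weight X d \<beta> W * total_cotree_weight X d \<beta> E) *
      (\<Sum>L | spanning_cotree X d L. \<Sum>T | spanning_tree X d T.
        cotree_weight X d \<beta> E L * tree_weight X d \<beta> W T * sigma X d L T v b))"
proof -
  interpret cw_boundary X d by unfold_locales (rule assms(1))
  show ?thesis using boundary_pinv_eq by blast
qed

end
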